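(* Let $\varpi=dx^{12}+dx^{34}+dx^{56}$ be the Kähler form of $\mathbb{C}^3=\mathbb{R}^6$ and $\Omega=\frac12\varpi^2$ the Kähler calibration of rank $4$. Then every three-dimensional (round) sphere of a 2-dimensional complex subspace $\mathbb{C}^2\subset\mathbb{C}^3$ is an $\Omega$-stable submanifold of $\mathbb{C}^3$ with parallel mean curvature.
   Context: Notation: $dx^{ij}=dx^i\wedge dx^j$, so $\Omega=dx^{1234}+dx^{1256}+dx^{3456}$. Let $\phi:M\to\mathbb{C}^3$ be a closed oriented immersed submanifold of dimension $m=3$ with second fundamental form $B$, normal connection $\nabla^\perp$ on the normal bundle $NM$, and mean curvature vector $H=\frac1m\sum_i B(e_i,e_i)$ (with $e_1,\ldots,e_m$ a local direct orthonormal frame of $M$). $M$ has parallel mean curvature if $\nabla^\perp H=0$. Assume $H\neq0$, set $\nu=H/\|H\|$, and let $E$ be the orthogonal complement of $\nu$ in $NM$. The extended tangent space $H\oplus TM$ is calibrated by $\Omega$ if (for the chosen orientation of $M$) $\Omega(\nu,e_1,\ldots,e_m)=1$ (for a sphere in a complex 2-plane this holds for one of the orientations, which is the one chosen). For $M$ with nonzero parallel mean curvature and calibrated extended tangent space, $M$ is called $\Omega$-stable if the quadratic form of the $\Omega$-Jacobi operator is non-negative on the twisted normal bundle, that is, $$\int_M\Big(\|\nabla^\perp W\|^2-\sum_{i,j}\langle B(e_i,e_j),W\rangle^2+m\|H\|\sum_{i}\Omega(W,e_1,\ldots,\nabla^\perp_{e_i}W,\ldots,e_m)\Big)dM\ \ge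 0$$ (with $\nabla^\perp_{e_i}W$ in the place of $e_i$) for all normal sections $W=f\nu+W'$ with $f\in C^\infty(M)$, $\int_M f\,dM=0$, and $W'$ a smooth section of $E$. *)

theory Defs
  imports "HOL-Analysis.Analysis" "HOL-Combinatorics.Permutations"
begin

section \<open>Exterior forms\<close>

text \<open>A constant-coefficient \<open>k\<close>-form is a real function on lists of vectors; only its values on
  lists of length \<open>k\<close> matter.\<close>

definition alternating_form :: "nat \<Rightarrow> ('a::real_vector list \<Rightarrow> real) \<Rightarrow> bool" where
  "alternating_form k \<alpha> \<longleftrightarrow>
     (\<forall>vs i. length vs = k \<and> i < k \<longrightarrow> linear (\<lambda>v. \<alpha> (vs[i := v]))) \<and>
     (\<forall>vs i j. length vs = k \<and> i < j \<and> j < k \<and> vs ! i = vs ! j \<longrightarrow> \<alpha> vs = 0)"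

text \<open>The determinant convention: \<open>dx\<^sup>1 \<and> \<dots> \<and> dx\<^sup>k\<close> takes the value 1 on the first \<open>k\<close> unit vectors.\<close>

definition wedge :: "nat \<Rightarrow> nat \<Rightarrow> ('a list \<Rightarrow> real) \<Rightarrow> ('a list \<Rightarrow> real) \<Rightarrow> 'a list \<Rightarrow> real" where
  "wedge k l \<alpha> \<beta> vs =
     (\<Sum>p | p permutes {..<k + l}.
        of_int (sign p) * \<alpha> (map (\<lambda>i. vs ! p i) [0..<k]) * \<beta> (map (\<lambda>i. vs ! p (k + i)) [0..<l]))
     / (fact k * fact l)"

text \<open>The real coordinates \<open>x\<^sup>1, \<dots>, x\<^sup>6\<close> of \<open>\<complex>\<^sup>3 = \<real>\<^sup>6\<close>, with \<open>z\<^sup>k = x\<^sup>2\<^sup>k\<^sup>-\<^sup>1 + \<i> x\<^sup>2\<^sup>k\<close>.\<close>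

definition dx :: "nat \<Rightarrow> (complex^3) list \<Rightarrow> real" where
  "dx j vs = (let v = vs ! 0 in
     [Re (v $ 1), Im (v $ 1), Re (v $ 2), Im (v $ 2), Re (v $ 3), Im (v $ 3)] ! (j - 1))"

definition kahler_form :: "(complex^3) list \<Rightarrow> real" where
  "kahler_form vs = wedge 1 1 (dx 1) (dx 2) vs + wedge 1 1 (dx 3) (dx 4) vs + wedge 1 1 (dx 5) (dx 6) vs"

definition kahler_calibration :: "(complex^3) list \<Rightarrow> real" where
  "kahler_calibration vs = 1/2 * wedge 2 2 kahler_form kahler_form vs"


section \<open>Smoothness and three-dimensional submanifolds of a Euclidean space\<close>

text \<open>\<open>Ck_on k S f\<close>: \<open>f\<close> is of class \<open>C\<^sup>k\<close> on \<open>S\<close>; meaningful for open \<open>S\<close> only.\<close>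

primrec Ck_on :: "nat \<Rightarrow> 'a::euclidean_space set \<Rightarrow> ('a \<Rightarrow> 'b::euclidean_space) \<Rightarrow> bool" where
  "Ck_on 0 S f \<longleftrightarrow> continuous_on S f"
| "Ck_on (Suc k) S f \<longleftrightarrow> (\<forall>x\<in>S. f differentiable (at x)) \<and>
     (\<forall>v. Ck_on k S (\<lambda>x. frechet_derivative f (at x) v))"

definition smooth_on :: "'a::euclidean_space set \<Rightarrow> ('a \<Rightarrow> 'b::euclidean_space) \<Rightarrow> bool" where
  "smooth_on S f \<longleftrightarrow> (\<forall>k. Ck_on k S f)"

definition local_param :: "'a::euclidean_space set \<Rightarrow> (real^3) set \<Rightarrow> (real^3 \<Rightarrow> 'a) \<Rightarrow> bool" where
  "local_param M U \<psi> \<longleftrightarrow> open U \<and> smooth_on U \<psi> \<and>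
     openin (top_of_set M) (\<psi> ` U) \<and> (\<exists>\<phi>. homeomorphism U (\<psi> ` U) \<psi> \<phi>) \<and>
     (\<forall>x\<in>U. inj (frechet_derivative \<psi> (at x)))"

definition submanifold3 :: "'a::euclidean_space set \<Rightarrow> bool" where
  "submanifold3 M \<longleftrightarrow> (\<forall>p\<in>M. \<exists>U \<psi>. local_param M U \<psi> \<and> p \<in> \<psi> ` U)"

definition closed_submanifold3 :: "'a::euclidean_space set \<Rightarrow> bool" where
  "closed_submanifold3 M \<longleftrightarrow> submanifold3 M \<and> compact M"

definition smooth_map :: "'a::euclidean_space set \<Rightarrow> ('a \<Rightarrow> 'b::euclidean_space) \<Rightarrow> bool" where
  "smooth_map M f \<longleftrightarrow>
     (\<forall>p\<in>M. \<exists>U g. open U \<and> p \<in> U \<and> smooth_on U g \<and> (\<forall>x\<in>M \<inter> U. f x = g x))"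

definition curve_in :: "'a::euclidean_space set \<Rightarrow> 'a \<Rightarrow> 'a \<Rightarrow> (real \<Rightarrow> 'a) \<Rightarrow> bool" where
  "curve_in M p v \<gamma> \<longleftrightarrow> (\<exists>\<epsilon>>0. smooth_on {-\<epsilon><..<\<epsilon>} \<gamma> \<and> \<gamma> ` {-\<epsilon><..<\<epsilon>} \<subseteq> M) \<and>
     \<gamma> 0 = p \<and> (\<gamma> has_vector_derivative v) (at 0)"

definition tangent_space :: "'a::euclidean_space set \<Rightarrow> 'a \<Rightarrow> 'a set" where
  "tangent_space M p = {v. \<exists>\<gamma>. curve_in M p v \<gamma>}"

definition normal_space :: "'a::euclidean_space set \<Rightarrow> 'a \<Rightarrow> 'a set" where
  "normal_space M p = orthogonal_comp (tangent_space M p)"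

definition normal_part :: "'a::euclidean_space set \<Rightarrow> 'a \<Rightarrow> 'a \<Rightarrow> 'a" where
  "normal_part M p w = (THE n. n \<in> normal_space M p \<and> w - n \<in> tangent_space M p)"

text \<open>The derivative at \<open>p\<close>, in the direction of the tangent vector \<open>v\<close>, of a map \<open>f\<close> that is
  smooth on \<open>M\<close>. For vector valued \<open>f\<close> it is the flat connection of the ambient space.\<close>

definition tderiv :: "'a::euclidean_space set \<Rightarrow> ('a \<Rightarrow> 'b::euclidean_space) \<Rightarrow> 'a \<Rightarrow> 'a \<Rightarrow> 'b" where
  "tderiv M f p v =
     (THE d. \<forall>\<gamma>. curve_in M p v \<gamma> \<longrightarrow> ((f \<circ> \<gamma>) has_vector_derivative d) (at 0))"

definition tangent_field :: "'a::euclidean_space set \<Rightarrow> ('a \<Rightarrow> 'a) \<Rightarrow> bool" where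
  "tangent_field M X \<longleftrightarrow> smooth_map M X \<and> (\<forall>p\<in>M. X p \<in> tangent_space M p)"

definition normal_connection :: "'a::euclidean_space set \<Rightarrow> ('a \<Rightarrow> 'a) \<Rightarrow> 'a \<Rightarrow> 'a \<Rightarrow> 'a" where
  "normal_connection M W p v = normal_part M p (tderiv M W p v)"

definition second_ff :: "'a::euclidean_space set \<Rightarrow> 'a \<Rightarrow> 'a \<Rightarrow> 'a \<Rightarrow> 'a" where
  "second_ff M p u v =
     (THE b. \<forall>X. tangent_field M X \<and> X p = v \<longrightarrow> b = normal_part M p (tderiv M X p u))"

definition orthonormal_frame :: "'a::euclidean_space set \<Rightarrow> 'a \<Rightarrow> 'a list \<Rightarrow> bool" where
  "orthonormal_frame M p es \<longleftrightarrow> length es = 3 \<and> set es \<subseteq> tangent_space M p \<and>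
     (\<forall>i<3. \<forall>j<3. es ! i \<bullet> es ! j = (if i = j then 1 else 0))"

definition mean_curvature :: "'a::euclidean_space set \<Rightarrow> 'a \<Rightarrow> 'a" where
  "mean_curvature M p = (THE h. \<forall>es. orthonormal_frame M p es \<longrightarrow>
     h = (1/3) *\<^sub>R (\<Sum>i<3. second_ff M p (es ! i) (es ! i)))"

definition parallel_mean_curvature :: "'a::euclidean_space set \<Rightarrow> bool" where
  "parallel_mean_curvature M \<longleftrightarrow>
     (\<forall>p\<in>M. \<forall>v\<in>tangent_space M p. normal_connection M (mean_curvature M) p v = 0)"

definition nonzero_mean_curvature :: "'a::euclidean_space set \<Rightarrow> bool" where
  "nonzero_mean_curvature M \<longleftrightarrow> (\<forall>p\<in>M. mean_curvature M p \<noteq> 0)"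

definition unit_mean_curvature :: "'a::euclidean_space set \<Rightarrow> 'a \<Rightarrow> 'a" where
  "unit_mean_curvature M p = mean_curvature M p /\<^sub>R norm (mean_curvature M p)"

text \<open>The unique Borel measure on \<open>M\<close> that has density \<open>\<surd>det (g\<^sub>i\<^sub>j)\<close> in every local
  parametrization.\<close>

definition gram_density :: "(real^3 \<Rightarrow> 'a::euclidean_space) \<Rightarrow> real^3 \<Rightarrow> real" where
  "gram_density \<psi> x = sqrt (det (\<chi> i j.
     frechet_derivative \<psi> (at x) (axis i 1) \<bullet> frechet_derivative \<psi> (at x) (axis j 1)
       :: real^3^3))"

definition riemannian_measure :: "'a::euclidean_space set \<Rightarrow> 'a measure" where
  "riemannian_measure M = (THE \<mu>. sets \<mu> = sets (restrict_space borel M) \<and>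
     (\<forall>U \<psi> A. local_param M U \<psi> \<and> A \<in> sets \<mu> \<and> A \<subseteq> \<psi> ` U \<longrightarrow>
        emeasure \<mu> A = (\<integral>\<^sup>+ x \<in> U \<inter> \<psi> -` A. ennreal (gram_density \<psi> x) \<partial>lborel)))"

text \<open>An orientation is given by a nowhere vanishing 3-form on \<open>M\<close>. For convenience the form is
  defined on all ambient vectors; only its sign on tangent frames matters.\<close>

definition orientation :: "'a::euclidean_space set \<Rightarrow> ('a \<Rightarrow> 'a list \<Rightarrow> real) \<Rightarrow> bool" where
  "orientation M \<eta> \<longleftrightarrow>
     (\<forall>p\<in>M. alternating_form 3 (\<eta> p)) \<and>
     (\<forall>vs. length vs = 3 \<longrightarrow> smooth_map M (\<lambda>p. \<eta> p vs)) \<and>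
     (\<forall>p\<in>M. \<forall>es. orthonormal_frame M p es \<longrightarrow> \<eta> p es \<noteq> 0)"

definition direct_frame :: "'a::euclidean_space set \<Rightarrow> ('a \<Rightarrow> 'a list \<Rightarrow> real) \<Rightarrow> 'a \<Rightarrow> 'a list \<Rightarrow> bool" where
  "direct_frame M \<eta> p es \<longleftrightarrow> orthonormal_frame M p es \<and> \<eta> p es > 0"


section \<open>Stability with respect to a form of rank 4\<close>

definition calibrated_extended_tangent ::
    "('a::euclidean_space list \<Rightarrow> real) \<Rightarrow> 'a set \<Rightarrow> ('a \<Rightarrow> 'a list \<Rightarrow> real) \<Rightarrow> bool" where
  "calibrated_extended_tangent \<Omega> M \<eta> \<longleftrightarrow>
     (\<forall>p\<in>M. \<forall>es. direct_frame M \<eta> p es \<longrightarrow> \<Omega> (unit_mean_curvature M p # es) = 1)"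

definition twisted_normal_field :: "'a::euclidean_space set \<Rightarrow> ('a \<Rightarrow> 'a) \<Rightarrow> bool" where
  "twisted_normal_field M W \<longleftrightarrow> (\<exists>f W'.
     smooth_map M f \<and> (\<integral>p. f p \<partial>riemannian_measure M) = 0 \<and>
     smooth_map M W' \<and>
     (\<forall>p\<in>M. W' p \<in> normal_space M p \<and> W' p \<bullet> unit_mean_curvature M p = 0) \<and>
     W = (\<lambda>p. f p *\<^sub>R unit_mean_curvature M p + W' p))"

text \<open>The integrand of the quadratic form of the Jacobi operator, computed in the frame \<open>es\<close> at \<open>p\<close>.\<close>

definition jacobi_integrand ::
    "('a::euclidean_space list \<Rightarrow> real) \<Rightarrow> 'a set \<Rightarrow> ('a \<Rightarrow> 'a) \<Rightarrow> 'a \<Rightarrow> 'a list \<Rightarrow> real" where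
  "jacobi_integrand \<Omega> M W p es =
     (\<Sum>i<3. (norm (normal_connection M W p (es ! i)))\<^sup>2)
     - (\<Sum>i<3. \<Sum>j<3. (second_ff M p (es ! i) (es ! j) \<bullet> W p)\<^sup>2)
     + 3 * norm (mean_curvature M p) *
         (\<Sum>i<3. \<Omega> (W p # es[i := normal_connection M W p (es ! i)]))"

text \<open>The integrand does not depend on the direct orthonormal frame, so that the frames \<open>e p\<close> can
  be chosen point by point, without any continuity.\<close>

definition Omega_stable ::
    "('a::euclidean_space list \<Rightarrow> real) \<Rightarrow> 'a set \<Rightarrow> ('a \<Rightarrow> 'a list \<Rightarrow> real) \<Rightarrow> bool" where
  "Omega_stable \<Omega> M \<eta> \<longleftrightarrow>
     closed_submanifold3 M \<and> orientation M \<eta> \<and>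
     parallel_mean_curvature M \<and> nonzero_mean_curvature M \<and>
     calibrated_extended_tangent \<Omega> M \<eta> \<and>
     (\<forall>W e. twisted_normal_field M W \<and> (\<forall>p\<in>M. direct_frame M \<eta> p (e p)) \<longrightarrow>
        (\<integral>p. jacobi_integrand \<Omega> M W p (e p) \<partial>riemannian_measure M) \<ge> 0)"

end

theory Submission
  imports Defs
begin

text \<open>
  Let \<open>M\<close> be the sphere of radius \<open>r\<close> about \<open>c\<close> in the complex plane \<open>V\<close> of complex dimension two.
  Its normal bundle is spanned by the unit mean curvature \<open>\<nu> = - (x - c) / r\<close>, which is parallel, and
  by the constant complex line orthogonal to \<open>V\<close>. For \<open>W = f \<nu> + W'\<close> the terms of the stability
  form that mix \<open>f\<close> and \<open>W'\<close> vanish, because \<open>V\<close> and its orthogonal complement are complex, hence orthogonal for the Kaehler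
  form. In the calibrated case \<open>\<varpi>(e\<^sub>j, e\<^sub>k) = \<varpi>(\<nu>, e\<^sub>i)\<close> for cyclic \<open>i, j, k\<close>, so that the calibration
  term only sees the derivative of \<open>W'\<close> in the Hopf direction \<open>\<i> \<nu>\<close>. With the three Killing fields
  \<open>X\<^sub>1 = \<i> (x - c)\<close>, \<open>X\<^sub>2\<close>, \<open>X\<^sub>3\<close> of a quaternionic structure on \<open>V\<close>, which form an orthogonal frame of
  length \<open>r\<close>, the quadratic form times \<open>r\<^sup>2\<close> is (\<open>jacobi_integrand_twisted\<close>)
  \<open>\<integral> (\<Sum>\<^sub>k (X\<^sub>k f)\<^sup>2 - 3 f\<^sup>2) + \<integral> (\<Sum>\<^sub>k \<bar>X\<^sub>k W'\<bar>\<^sup>2 - 3 \<langle>\<i> W', X\<^sub>1 W'\<rangle>)\<close>.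
  Both integrals are shown to be nonnegative. On spherical harmonics this would be the comparison of
  \<open>k (k + 2)\<close> with \<open>3\<close> for \<open>k \<ge> 1\<close>, and with \<open>3 m\<close> for weights \<open>\<bar>m\<bar> \<le> k\<close>. The proof below uses instead
  that the sphere is filled by great circles, the orbits of \<open>x \<mapsto> c + cos t (x - c) + sin t J (x - c)\<close>
  for complex structures \<open>J\<close> on \<open>V\<close>: these rotations preserve the measure, so that an inequality for
  functions on the circle integrates to one on \<open>M\<close> (\<open>integral_nonneg_circles\<close>).

  The first integral is the sharp Poincare inequality for mean-zero functions (\<open>poincare_inequality\<close>).
  The odd part of \<open>f\<close> is antiperiodic with antiperiod \<open>\<pi>\<close> on each great circle, so that
  \<open>\<integral> f\<^sup>2 \<le> \<integral> (X\<^sub>k f)\<^sup>2\<close> for each \<open>k\<close>; this is where the constant \<open>3\<close> is attained. For the even part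
  \<open>F\<close>, which has mean zero, \<open>2 \<integral> F\<^sup>2\<close> is the average over a unit quaternion \<open>q\<close> of
  \<open>\<integral> (F (x q) - F x)\<^sup>2\<close>. The point \<open>x q\<close> lies on the great circle through \<open>x\<close> in the direction of the
  imaginary part of \<open>q\<close>. An even function has period \<open>\<pi>\<close> on this circle, where a crude estimate of the
  translation suffices, and the directions are isotropic as \<open>q\<close> varies.

  For the second integral (\<open>first_order_inequality\<close>), \<open>[X\<^sub>3, X\<^sub>2] = 2 X\<^sub>1\<close> and integration by parts turn
  \<open>0 \<le> \<integral> \<bar>X\<^sub>2 W' + \<i> X\<^sub>3 W'\<bar>\<^sup>2\<close> into \<open>2 \<integral> \<langle>\<i> W', X\<^sub>1 W'\<rangle> \<le> \<integral> \<bar>X\<^sub>2 W'\<bar>\<^sup>2 + \<bar>X\<^sub>3 W'\<bar>\<^sup>2\<close>. What remains is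
  \<open>\<integral> \<langle>\<i> W', X\<^sub>1 W'\<rangle> \<le> \<integral> \<bar>X\<^sub>1 W'\<bar>\<^sup>2\<close>, that is \<open>m \<le> m\<^sup>2\<close> for the integer frequencies \<open>m\<close> on the circles of
  \<open>X\<^sub>1\<close>.

  The Riemannian measure is defined by its densities in all local parametrizations. Stereographic
  projection realizes it: the change of variables formula in \<open>\<real>\<^sup>3\<close>, applied to the transition to an
  arbitrary parametrization, gives the required densities, and two poles give uniqueness
  (\<open>riemannian_measure_eq_chart\<close>). Since the density is the same for every orthonormal frame of \<open>V\<close>, the
  measure is invariant under linear isometries of \<open>V\<close> (\<open>distr_isometry\<close>).
\<close>

section \<open>Calculus of smooth maps\<close>

lemma Ck_on_SucD:
  assumes "Ck_on (Suc k) S f" "x \<in> S"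
  shows "(f has_derivative frechet_derivative f (at x)) (at x)"
  using assms frechet_derivative_works by auto

text \<open>\<open>Ck_on\<close> is stated with \<open>frechet_derivative\<close> at points of an open set only; the next two lemmas
  allow to replace the map, or its derivative, by any expression that agrees with it there.\<close>

lemma Ck_on_cong:
  assumes "open S" "\<And>x. x \<in> S \<Longrightarrow> f x = g x"
  shows "Ck_on k S f \<Longrightarrow> Ck_on k S g"
  using assms(2)
proof (induction k arbitrary: f g)
  case 0
  then show ?case by (simp cong: continuous_on_cong)
next
  case (Suc k)
  have d: "(g has_derivative frechet_derivative f (at x)) (at x)" if "x \<in> S" for x
    using has_derivative_transform_within_open[OF Ck_on_SucD[OF Suc.prems(1) that] assms(1) that]
      Suc.prems(2) by blast
  have e: "frechet_derivative f (at x) v = frechet_derivative g (at x) v" if "x \<in> S" for x v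
    using frechet_derivative_at[OF d[OF that]] by simp
  have "Ck_on k S (\<lambda>x. frechet_derivative f (at x) v)" for v
    using Suc.prems(1) by simp
  from Suc.IH[OF this e] have "Ck_on k S (\<lambda>x. frechet_derivative g (at x) v)" for v .
  moreover have "g differentiable at x" if "x \<in> S" for x
    using d[OF that] by (rule differentiableI)
  ultimately show ?case by simp
qed

lemma Ck_on_SucI:
  assumes "open S" "\<And>x. x \<in> S \<Longrightarrow> (f has_derivative f' x) (at x)"
    and "\<And>v. Ck_on k S (\<lambda>x. f' x v)"
  shows "Ck_on (Suc k) S f"
proof -
  have "f' x = frechet_derivative f (at x)" if "x \<in> S" for x
    using assms(2)[OF that] by (rule frechet_derivative_at)
  then have "Ck_on k S (\<lambda>x. frechet_derivative f (at x) v)" for v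
    by (intro Ck_on_cong[OF assms(1) _ assms(3)[of v]]) auto
  then show ?thesis using assms(2) by (auto simp: differentiable_def)
qed

lemma Ck_on_Suc_imp: "Ck_on (Suc k) S f \<Longrightarrow> Ck_on k S f"
proof (induction k arbitrary: f)
  case 0
  then show ?case
    by (auto intro!: continuous_at_imp_continuous_on differentiable_imp_continuous_within)
qed auto

lemma Ck_on_subset: "Ck_on k S f \<Longrightarrow> T \<subseteq> S \<Longrightarrow> Ck_on k T f"
  by (induction k arbitrary: f) (auto intro: continuous_on_subset)

lemma Ck_on_const: "open S \<Longrightarrow> Ck_on k S (\<lambda>x. c)"
  by (induction k arbitrary: c) auto

lemma Ck_on_compose_linear:
  assumes "bounded_linear L" "open S"
  shows "Ck_on k S f \<Longrightarrow> Ck_on k S (\<lambda>x. L (f x))"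
proof (induction k arbitrary: f)
  case 0
  then show ?case
    using assms by (auto intro!: bounded_linear.continuous_on[OF assms(1)])
next
  case (Suc k)
  show ?case
    by (rule Ck_on_SucI[OF assms(2) bounded_linear.has_derivative[OF assms(1) Ck_on_SucD[OF Suc.prems]]])
      (use Suc in auto)
qed

lemma Ck_on_id: "open S \<Longrightarrow> Ck_on k S (\<lambda>x. x)"
  by (cases k) (auto intro!: Ck_on_const)

lemma Ck_on_add:
  "open S \<Longrightarrow> Ck_on k S f \<Longrightarrow> Ck_on k S g \<Longrightarrow> Ck_on k S (\<lambda>x. f x + g x)"
proof (induction k arbitrary: f g)
  case 0
  then show ?case by (auto intro: continuous_on_add)
next
  case (Suc k)
  show ?case
    by (rule Ck_on_SucI[OF Suc.prems(1) has_derivative_add[OF Ck_on_SucD[OF Suc.prems(2)] Ck_on_SucD[OF Suc.prems(3)]]])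
      (use Suc in auto)
qed

lemma Ck_on_scaleR:
  fixes f :: "'a::euclidean_space \<Rightarrow> real" and g :: "'a \<Rightarrow> 'b::euclidean_space"
  shows "open S \<Longrightarrow> Ck_on k S f \<Longrightarrow> Ck_on k S g \<Longrightarrow> Ck_on k S (\<lambda>x. f x *\<^sub>R g x)"
proof (induction k arbitrary: f g)
  case 0
  then show ?case by (auto intro: continuous_on_scaleR)
next
  case (Suc k)
  show ?case
  proof (rule Ck_on_SucI[OF Suc.prems(1)])
    show "((\<lambda>x. f x *\<^sub>R g x) has_derivative
        (\<lambda>v. f x *\<^sub>R frechet_derivative g (at x) v + frechet_derivative f (at x) v *\<^sub>R g x)) (at x)"
      if "x \<in> S" for x
      using Ck_on_SucD[OF Suc.prems(2) that] Ck_on_SucD[OF Suc.prems(3) that]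
      by (rule has_derivative_scaleR)
    show "Ck_on k S (\<lambda>x. f x *\<^sub>R frechet_derivative g (at x) v + frechet_derivative f (at x) v *\<^sub>R g x)" for v
      using Suc.prems Ck_on_Suc_imp[OF Suc.prems(2)] Ck_on_Suc_imp[OF Suc.prems(3)]
      by (intro Ck_on_add Suc.IH) auto
  qed
qed

lemma Ck_on_inverse:
  fixes f :: "'a::euclidean_space \<Rightarrow> real"
  assumes "open S" "\<And>x. x \<in> S \<Longrightarrow> f x \<noteq> 0"
  shows "Ck_on k S f \<Longrightarrow> Ck_on k S (\<lambda>x. inverse (f x))"
proof (induction k)
  case 0
  then show ?case using assms(2) by (auto intro!: continuous_on_inverse)
next
  case (Suc k)
  have i: "Ck_on k S (\<lambda>x. inverse (f x))"
    using Suc.IH Ck_on_Suc_imp[OF Suc.prems] by blast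
  have "Ck_on k S (\<lambda>x. (-1) *\<^sub>R (inverse (f x) *\<^sub>R (frechet_derivative f (at x) v *\<^sub>R inverse (f x))))" for v
    using Suc.prems by (intro Ck_on_scaleR assms i Ck_on_const) auto
  then have s: "Ck_on k S (\<lambda>x. - (inverse (f x) * frechet_derivative f (at x) v * inverse (f x)))" for v
    by (simp add: mult.assoc)
  have d: "((\<lambda>x. inverse (f x)) has_derivative
      (\<lambda>v. - (inverse (f x) * frechet_derivative f (at x) v * inverse (f x)))) (at x)" if "x \<in> S" for x
    using Deriv.has_derivative_inverse[OF assms(2)[OF that] Ck_on_SucD[OF Suc.prems that]] .
  show ?case
    by (rule Ck_on_SucI[OF assms(1) d s])
qed

lemma smooth_onD_diff: "smooth_on S f \<Longrightarrow> x \<in> S \<Longrightarrow> (f has_derivative frechet_derivative f (at x)) (at x)"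
  using Ck_on_SucD unfolding smooth_on_def by blast

lemma smooth_on_frechet: "smooth_on S f \<Longrightarrow> smooth_on S (\<lambda>x. frechet_derivative f (at x) v)"
  unfolding smooth_on_def by (metis Ck_on.simps(2))

lemma smooth_on_imp_continuous: "smooth_on S f \<Longrightarrow> continuous_on S f"
  unfolding smooth_on_def by (metis Ck_on.simps(1))

lemma smooth_on_subset: "smooth_on S f \<Longrightarrow> T \<subseteq> S \<Longrightarrow> smooth_on T f"
  unfolding smooth_on_def by (metis Ck_on_subset)

lemma smooth_on_const: "open S \<Longrightarrow> smooth_on S (\<lambda>x. c)"
  by (simp add: smooth_on_def Ck_on_const)

lemma smooth_on_id: "open S \<Longrightarrow> smooth_on S (\<lambda>x. x)"
  by (simp add: smooth_on_def Ck_on_id)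

lemma smooth_on_compose_linear:
  "bounded_linear L \<Longrightarrow> open S \<Longrightarrow> smooth_on S f \<Longrightarrow> smooth_on S (\<lambda>x. L (f x))"
  by (simp add: smooth_on_def Ck_on_compose_linear)

lemma smooth_on_add:
  "open S \<Longrightarrow> smooth_on S f \<Longrightarrow> smooth_on S g \<Longrightarrow> smooth_on S (\<lambda>x. f x + g x)"
  by (simp add: smooth_on_def Ck_on_add)

lemma smooth_on_scaleR:
  fixes f :: "'a::euclidean_space \<Rightarrow> real" and g :: "'a \<Rightarrow> 'b::euclidean_space"
  shows "open S \<Longrightarrow> smooth_on S f \<Longrightarrow> smooth_on S g \<Longrightarrow> smooth_on S (\<lambda>x. f x *\<^sub>R g x)"
  by (simp add: smooth_on_def Ck_on_scaleR)

lemma smooth_on_mult: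
  fixes f g :: "'a::euclidean_space \<Rightarrow> real"
  shows "open S \<Longrightarrow> smooth_on S f \<Longrightarrow> smooth_on S g \<Longrightarrow> smooth_on S (\<lambda>x. f x * g x)"
  using smooth_on_scaleR[of S f g] by simp

lemma smooth_on_inverse:
  fixes f :: "'a::euclidean_space \<Rightarrow> real"
  shows "open S \<Longrightarrow> (\<And>x. x \<in> S \<Longrightarrow> f x \<noteq> 0) \<Longrightarrow> smooth_on S f \<Longrightarrow> smooth_on S (\<lambda>x. inverse (f x))"
  by (simp add: smooth_on_def Ck_on_inverse)

lemma smooth_on_diff:
  assumes "open S" "smooth_on S f" "smooth_on S g" shows "smooth_on S (\<lambda>x. f x - g x)"
  using smooth_on_add[OF assms(1,2) smooth_on_compose_linear[OF _ assms(1,3), of "\<lambda>y. - y"]]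
  by (simp add: bounded_linear_minus bounded_linear_ident)

lemma smooth_on_sum:
  "open S \<Longrightarrow> (\<And>i. i \<in> A \<Longrightarrow> smooth_on S (f i)) \<Longrightarrow> smooth_on S (\<lambda>x. \<Sum>i\<in>A. f i x)"
  by (induction A rule: infinite_finite_induct) (auto intro: smooth_on_const smooth_on_add)

lemma smooth_on_inner_left: "open S \<Longrightarrow> smooth_on S f \<Longrightarrow> smooth_on S (\<lambda>x. f x \<bullet> a)"
  by (rule smooth_on_compose_linear[OF bounded_linear_inner_left])

lemma smooth_on_inner:
  fixes f g :: "'a::euclidean_space \<Rightarrow> 'b::euclidean_space"
  assumes "open S" "smooth_on S f" "smooth_on S g" shows "smooth_on S (\<lambda>x. f x \<bullet> g x)"
proof -
  have "smooth_on S (\<lambda>x. \<Sum>b\<in>Basis. (f x \<bullet> b) * (g x \<bullet> b))"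
    by (intro smooth_on_sum smooth_on_mult smooth_on_inner_left assms)
  moreover have "(\<lambda>x. f x \<bullet> g x) = (\<lambda>x. \<Sum>b\<in>Basis. (f x \<bullet> b) * (g x \<bullet> b))"
    by (rule ext) (rule euclidean_inner)
  ultimately show ?thesis by simp
qed

lemma Ck_on_sin_cos:
  assumes "open S"
  shows "Ck_on k S (\<lambda>t. cos (w * t)) \<and> Ck_on k S (\<lambda>t. sin (w * t :: real))"
proof (induction k)
  case 0
  then show ?case by (auto intro!: continuous_intros)
next
  case (Suc k)
  have 1: "Ck_on k S (\<lambda>t. (-1) *\<^sub>R (w * v) *\<^sub>R sin (w * t))" for v
    using assms Suc by (intro Ck_on_scaleR Ck_on_const) auto
  have 2: "Ck_on k S (\<lambda>t. (w * v) *\<^sub>R cos (w * t))" for v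
    using assms Suc by (intro Ck_on_scaleR Ck_on_const) auto
  have d: "((\<lambda>t. cos (w * t)) has_derivative (\<lambda>v. (-1) *\<^sub>R (w * v) *\<^sub>R sin (w * t))) (at t)"
    "((\<lambda>t. sin (w * t)) has_derivative (\<lambda>v. (w * v) *\<^sub>R cos (w * t))) (at t)" for t
    by (auto intro!: derivative_eq_intros)
  show ?case
    using Ck_on_SucI[OF assms d(1) 1] Ck_on_SucI[OF assms d(2) 2] by blast
qed

lemma smooth_on_cos: "open S \<Longrightarrow> smooth_on S (\<lambda>t. cos (w * t :: real))"
  and smooth_on_sin: "open S \<Longrightarrow> smooth_on S (\<lambda>t. sin (w * t :: real))"
  by (simp_all add: smooth_on_def Ck_on_sin_cos)


text \<open>The second difference \<open>g (x + s a + s b) - g (x + s a) - g (x + s b) + g x\<close> is symmetric in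
  \<open>a\<close> and \<open>b\<close>, and two applications of the mean value theorem write it as \<open>s\<^sup>2\<close> times a second
  derivative at a point near \<open>x\<close>.\<close>

lemma second_difference_mean_value:
  fixes g :: "'a::euclidean_space \<Rightarrow> real"
  assumes sm: "smooth_on (ball x e) g" and "s > 0" and small: "s * (norm a + norm b) < e"
  obtains \<xi> \<eta> where "0 < \<xi>" "\<xi> < s" "0 < \<eta>" "\<eta> < s"
    "g (x + s *\<^sub>R a + s *\<^sub>R b) - g (x + s *\<^sub>R a) - g (x + s *\<^sub>R b) + g x =
      s\<^sup>2 * frechet_derivative (\<lambda>y. frechet_derivative g (at y) a) (at (x + \<xi> *\<^sub>R a + \<eta> *\<^sub>R b)) b"
proof -
  have inb: "x + u *\<^sub>R a + v *\<^sub>R b \<in> ball x e" if "0 \<le> u" "u \<le> s" "0 \<le> v" "v \<le> s" for u v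
  proof -
    have "norm (u *\<^sub>R a + v *\<^sub>R b) \<le> u * norm a + v * norm b"
      using norm_triangle_ineq[of "u *\<^sub>R a" "v *\<^sub>R b"] that by simp
    also have "\<dots> \<le> s * norm a + s * norm b"
      using that by (intro add_mono mult_right_mono) auto
    also have "\<dots> < e" using small by (simp add: algebra_simps)
    finally have "norm (u *\<^sub>R a + v *\<^sub>R b) < e" .
    moreover have "dist x (x + u *\<^sub>R a + v *\<^sub>R b) = norm (u *\<^sub>R a + v *\<^sub>R b)"
      by (metis add.assoc add_diff_cancel_left' dist_commute dist_norm)
    ultimately show ?thesis by simp
  qed
  let ?Da = "\<lambda>y. frechet_derivative g (at y) a"
  have der: "((\<lambda>u. g (x + u *\<^sub>R a + v *\<^sub>R b)) has_derivative
      (\<lambda>h. h * frechet_derivative g (at (x + u *\<^sub>R a + v *\<^sub>R b)) a)) (at u)"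
    if "0 \<le> u" "u \<le> s" "0 \<le> v" "v \<le> s" for u v
  proof -
    have g: "(g has_derivative frechet_derivative g (at (x + u *\<^sub>R a + v *\<^sub>R b))) (at (x + u *\<^sub>R a + v *\<^sub>R b))"
      using smooth_onD_diff[OF sm inb[OF that]] .
    have i: "((\<lambda>u. x + u *\<^sub>R a + v *\<^sub>R b) has_derivative (\<lambda>h. h *\<^sub>R a)) (at u)"
      by (auto intro!: derivative_eq_intros)
    have l: "linear (frechet_derivative g (at (x + u *\<^sub>R a + v *\<^sub>R b)))"
      using g has_derivative_linear by blast
    show ?thesis
      using diff_chain_at[OF i g]
      by (simp add: o_def linear_cmul[OF l])
  qed
  have "((\<lambda>u. g (x + u *\<^sub>R a + s *\<^sub>R b) - g (x + u *\<^sub>R a)) has_derivative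
      (\<lambda>h. h * (?Da (x + u *\<^sub>R a + s *\<^sub>R b) - ?Da (x + u *\<^sub>R a)))) (at u within {0..s})"
    if "0 \<le> u" "u \<le> s" for u
  proof (rule has_derivative_at_withinI)
    have "((\<lambda>u. g (x + u *\<^sub>R a)) has_derivative
        (\<lambda>h. h * ?Da (x + u *\<^sub>R a))) (at u)"
      using der[of u 0] that \<open>s > 0\<close> by simp
    from has_derivative_diff[OF der[of u s] this]
    show "((\<lambda>u. g (x + u *\<^sub>R a + s *\<^sub>R b) - g (x + u *\<^sub>R a)) has_derivative
      (\<lambda>h. h * (?Da (x + u *\<^sub>R a + s *\<^sub>R b) - ?Da (x + u *\<^sub>R a)))) (at u)"
      using that \<open>s > 0\<close> by (simp add: right_diff_distrib)
  qed
  from mvt_simple[OF \<open>s > 0\<close> this] obtain \<xi> where \<xi>: "0 < \<xi>" "\<xi> < s"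
    and 1: "(g (x + s *\<^sub>R a + s *\<^sub>R b) - g (x + s *\<^sub>R a)) - (g (x + s *\<^sub>R b) - g x)
      = s * (?Da (x + \<xi> *\<^sub>R a + s *\<^sub>R b) - ?Da (x + \<xi> *\<^sub>R a))"
    by auto
  define D where "D y = frechet_derivative g (at y) a" for y
  define D2 where "D2 y = frechet_derivative D (at y) b" for y
  define \<gamma> where "\<gamma> v = x + \<xi> *\<^sub>R a + v *\<^sub>R b" for v
  have D: "((D \<circ> \<gamma>) has_derivative (\<lambda>h. h * D2 (\<gamma> v))) (at v within {0..s})" if "0 \<le> v" "v \<le> s" for v
  proof -
    have "\<gamma> v \<in> ball x e"
      unfolding \<gamma>_def using inb[of \<xi> v] that \<xi> by auto
    then have g: "(D has_derivative frechet_derivative D (at (\<gamma> v))) (at (\<gamma> v))"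
      unfolding D_def by (rule smooth_onD_diff[OF smooth_on_frechet[OF sm]])
    have i: "(\<gamma> has_derivative (\<lambda>h. h *\<^sub>R b)) (at v)"
      unfolding \<gamma>_def[abs_def] by (auto intro!: derivative_eq_intros)
    have l: "linear (frechet_derivative D (at (\<gamma> v)))"
      using g has_derivative_linear by blast
    show ?thesis
      using has_derivative_at_withinI[OF diff_chain_at[OF i g]]
      by (simp add: o_def linear_cmul[OF l] D2_def)
  qed
  obtain \<eta> where \<eta>: "0 < \<eta>" "\<eta> < s" and 2: "(D \<circ> \<gamma>) s - (D \<circ> \<gamma>) 0 = (s - 0) * D2 (\<gamma> \<eta>)"
    using mvt_simple[OF \<open>s > 0\<close> D] by auto
  have "(g (x + s *\<^sub>R a + s *\<^sub>R b) - g (x + s *\<^sub>R a)) - (g (x + s *\<^sub>R b) - g x) = s * (s * D2 (\<gamma> \<eta>))"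
    using 1 2 by (simp add: \<gamma>_def D_def)
  then show ?thesis
    using that[OF \<xi> \<eta>] unfolding \<gamma>_def D2_def D_def power2_eq_square mult.assoc by linarith
qed

lemma frechet_derivative_commute_real:
  fixes g :: "'a::euclidean_space \<Rightarrow> real"
  assumes "open U" "smooth_on U g" "x \<in> U"
  shows "frechet_derivative (\<lambda>y. frechet_derivative g (at y) a) (at x) b =
    frechet_derivative (\<lambda>y. frechet_derivative g (at y) b) (at x) a"
proof -
  obtain e where e: "e > 0" "ball x e \<subseteq> U" using assms openE by blast
  note sm = smooth_on_subset[OF assms(2) e(2)]
  define P where "P a b y = frechet_derivative (\<lambda>y. frechet_derivative g (at y) a) (at y) b" for a b y
  have cont: "isCont (P a b) x" for a b
    using smooth_on_imp_continuous[OF smooth_on_frechet[OF smooth_on_frechet[OF assms(2)]]]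
      assms continuous_on_eq_continuous_at unfolding P_def by blast
  have "dist (P a b x) (P b a x) < \<epsilon>" if "\<epsilon> > 0" for \<epsilon>
  proof -
    obtain d where d: "d > 0" "\<And>y. dist y x < d \<Longrightarrow> dist (P a b y) (P a b x) < \<epsilon> / 2"
        "\<And>y. dist y x < d \<Longrightarrow> dist (P b a y) (P b a x) < \<epsilon> / 2"
    proof -
      have "\<exists>d>0. \<forall>y. dist y x < d \<longrightarrow> dist (P a b y) (P a b x) < \<epsilon> / 2"
        using cont[of a b] half_gt_zero[OF \<open>\<epsilon> > 0\<close>] unfolding continuous_at_eps_delta by blast
      then obtain d1 where "d1 > 0" "\<And>y. dist y x < d1 \<Longrightarrow> dist (P a b y) (P a b x) < \<epsilon> / 2"
        by blast
      moreover have "\<exists>d>0. \<forall>y. dist y x < d \<longrightarrow> dist (P b a y) (P b a x) < \<epsilon> / 2"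
        using cont[of b a] half_gt_zero[OF \<open>\<epsilon> > 0\<close>] unfolding continuous_at_eps_delta by blast
      then obtain d2 where "d2 > 0" "\<And>y. dist y x < d2 \<Longrightarrow> dist (P b a y) (P b a x) < \<epsilon> / 2"
        by blast
      ultimately show ?thesis using that[of "min d1 d2"] by auto
    qed
    define s where "s = min d e / (2 * (norm a + norm b + 1))"
    have s: "s > 0" using d e by (auto simp: s_def intro!: divide_pos_pos add_nonneg_pos)
    have "s * (norm a + norm b) < s * (2 * (norm a + norm b + 1))"
      using s by (intro mult_strict_left_mono) (auto simp: add_nonneg_pos)
    also have "\<dots> = min d e"
    proof -
      have "norm a + norm b + 1 \<noteq> 0"
        using norm_ge_zero[of a] norm_ge_zero[of b] by linarith
      then show ?thesis by (simp add: s_def)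
    qed
    finally have lt: "s * (norm a + norm b) < min d e" .
    have near: "dist (x + \<xi> *\<^sub>R a + \<eta> *\<^sub>R b) x < d" if "0 < \<xi>" "\<xi> < s" "0 < \<eta>" "\<eta> < s" for \<xi> \<eta>
    proof -
      have "norm (\<xi> *\<^sub>R a + \<eta> *\<^sub>R b) \<le> \<xi> * norm a + \<eta> * norm b"
        using norm_triangle_ineq[of "\<xi> *\<^sub>R a" "\<eta> *\<^sub>R b"] that by simp
      also have "\<dots> \<le> s * norm a + s * norm b"
        using that by (intro add_mono mult_right_mono) auto
      also have "\<dots> < d" using lt by (simp add: algebra_simps)
      finally show ?thesis by (simp add: dist_norm add.assoc)
    qed
    obtain \<xi> \<eta> where 1: "0 < \<xi>" "\<xi> < s" "0 < \<eta>" "\<eta> < s"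
      "g (x + s *\<^sub>R a + s *\<^sub>R b) - g (x + s *\<^sub>R a) - g (x + s *\<^sub>R b) + g x = s\<^sup>2 * P a b (x + \<xi> *\<^sub>R a + \<eta> *\<^sub>R b)"
      using second_difference_mean_value[OF sm s, of a b] lt unfolding P_def by auto
    obtain \<xi>' \<eta>' where 2: "0 < \<xi>'" "\<xi>' < s" "0 < \<eta>'" "\<eta>' < s"
      "g (x + s *\<^sub>R b + s *\<^sub>R a) - g (x + s *\<^sub>R b) - g (x + s *\<^sub>R a) + g x = s\<^sup>2 * P b a (x + \<xi>' *\<^sub>R b + \<eta>' *\<^sub>R a)"
      using second_difference_mean_value[OF sm s, of b a] lt unfolding P_def by (auto simp: add.commute)
    have "s\<^sup>2 * P a b (x + \<xi> *\<^sub>R a + \<eta> *\<^sub>R b) = s\<^sup>2 * P b a (x + \<xi>' *\<^sub>R b + \<eta>' *\<^sub>R a)"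
      using 1(5) 2(5) by (simp add: algebra_simps)
    then have "P a b (x + \<xi> *\<^sub>R a + \<eta> *\<^sub>R b) = P b a (x + \<eta>' *\<^sub>R a + \<xi>' *\<^sub>R b)"
      using s by (simp add: algebra_simps)
    then show ?thesis
      using d(2)[OF near[OF 1(1-4)]] d(3)[OF near[OF 2(3,4,1,2)]]
      unfolding dist_real_def by linarith
  qed
  from this[of "dist (P a b x) (P b a x)"] have "P a b x = P b a x"
    by force
  then show ?thesis by (simp add: P_def)
qed

lemma frechet_derivative_inner_left:
  assumes "f differentiable at x"
  shows "frechet_derivative (\<lambda>y. f y \<bullet> c) (at x) = (\<lambda>v. frechet_derivative f (at x) v \<bullet> c)"
  using frechet_derivative_at[OF has_derivative_inner_left[OF assms[unfolded frechet_derivative_works]]]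
  by simp

lemma frechet_derivative_commute:
  fixes g :: "'a::euclidean_space \<Rightarrow> 'b::euclidean_space"
  assumes "open U" "smooth_on U g" "x \<in> U"
  shows "frechet_derivative (\<lambda>y. frechet_derivative g (at y) a) (at x) b =
    frechet_derivative (\<lambda>y. frechet_derivative g (at y) b) (at x) a"
proof (rule euclidean_eqI)
  fix c :: 'b assume "c \<in> Basis"
  have *: "frechet_derivative (\<lambda>y. frechet_derivative (\<lambda>z. g z \<bullet> c) (at y) a) (at x) b =
      frechet_derivative (\<lambda>y. frechet_derivative g (at y) a) (at x) b \<bullet> c" for a b
  proof -
    have d: "(\<lambda>y. frechet_derivative g (at y) a) differentiable at x"
      using smooth_onD_diff[OF smooth_on_frechet[OF assms(2)] assms(3)] differentiable_def by blast
    have "((\<lambda>y. frechet_derivative g (at y) a \<bullet> c) has_derivative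
        (\<lambda>v. frechet_derivative (\<lambda>y. frechet_derivative g (at y) a) (at x) v \<bullet> c)) (at x)"
      by (rule has_derivative_inner_left[OF d[unfolded frechet_derivative_works]])
    then have "((\<lambda>y. frechet_derivative (\<lambda>z. g z \<bullet> c) (at y) a) has_derivative
        (\<lambda>v. frechet_derivative (\<lambda>y. frechet_derivative g (at y) a) (at x) v \<bullet> c)) (at x)"
    proof (rule has_derivative_transform_within_open[OF _ assms(1,3)])
      fix y assume "y \<in> U"
      then have "g differentiable at y"
        using smooth_onD_diff[OF assms(2)] differentiable_def by blast
      then show "frechet_derivative g (at y) a \<bullet> c = frechet_derivative (\<lambda>z. g z \<bullet> c) (at y) a"
        by (simp add: frechet_derivative_inner_left)
    qed
    then show ?thesis using frechet_derivative_at by metis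
  qed
  show "frechet_derivative (\<lambda>y. frechet_derivative g (at y) a) (at x) b \<bullet> c =
    frechet_derivative (\<lambda>y. frechet_derivative g (at y) b) (at x) a \<bullet> c"
    using frechet_derivative_commute_real[OF assms(1) smooth_on_inner_left[OF assms(1,2)] assms(3), of c a b]
    by (simp add: *)
qed

section \<open>Wirtinger inequalities on the circle\<close>

lemma tendsto_quotient_common_zero:
  fixes g s :: "real \<Rightarrow> real"
  assumes "(g has_real_derivative D) (at c)" "(s has_real_derivative E) (at c)"
    and "g c = 0" "s c = 0" "E \<noteq> 0"
  shows "((\<lambda>t. g t / s t) \<longlongrightarrow> D / E) (at c)"
proof -
  have 1: "((\<lambda>t. g t / (t - c)) \<longlongrightarrow> D) (at c)" and 2: "((\<lambda>t. s t / (t - c)) \<longlongrightarrow> E) (at c)"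
    using assms by (simp_all add: has_field_derivative_iff)
  have "((\<lambda>t. (g t / (t - c)) / (s t / (t - c))) \<longlongrightarrow> D / E) (at c)"
    by (rule tendsto_divide[OF 1 2 assms(5)])
  then show ?thesis
  proof (rule Lim_transform_eventually)
    show "\<forall>\<^sub>F t in at c. (g t / (t - c)) / (s t / (t - c)) = g t / s t"
      by (simp add: eventually_at_filter)
  qed
qed

text \<open>With \<open>\<psi> = k cot (k (t - a))\<close> one has
  \<open>g'\<^sup>2 - k\<^sup>2 g\<^sup>2 = (g' - \<psi> g)\<^sup>2 + (\<psi> g\<^sup>2)'\<close>, and the boundary terms vanish because the zeros of
  \<open>g\<close> cancel the poles of \<open>\<psi>\<close>.\<close>

lemma wirtinger_dirichlet:
  fixes g g' :: "real \<Rightarrow> real"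
  assumes der: "\<And>t. (g has_real_derivative g' t) (at t)" and cont: "continuous_on UNIV g'"
    and "k > 0" and L: "L = pi / k" and ga: "g a = 0" and gb: "g (a + L) = 0"
  shows "k\<^sup>2 * integral {a..a + L} (\<lambda>t. (g t)\<^sup>2) \<le> integral {a..a + L} (\<lambda>t. (g' t)\<^sup>2)"
proof -
  have L0: "L > 0" and kL: "k * L = pi" using assms by auto
  have contg: "continuous_on UNIV g"
    using der by (intro continuous_at_imp_continuous_on) (auto intro: DERIV_isCont)
  define s where "s t = sin (k * (t - a))" for t
  define C where "C t = cos (k * (t - a))" for t
  have ds: "(s has_real_derivative k * C t) (at t)" and dC: "(C has_real_derivative - k * s t) (at t)" for t
    unfolding s_def[abs_def] C_def[abs_def] by (auto intro!: derivative_eq_intros)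
  have isC: "isCont C t" "isCont s t" "isCont g t" for t
    using ds dC der by (auto intro: DERIV_isCont)
  define \<Phi> where "\<Phi> t = k * C t * g t * (g t / s t)" for t
  define \<psi> where "\<psi> t = (g' t)\<^sup>2 - k\<^sup>2 * (g t)\<^sup>2 - (g' t - k * C t / s t * g t)\<^sup>2" for t
  have pos: "s t \<noteq> 0" if "t \<in> {a<..<a + L}" for t
  proof -
    have "0 < k * (t - a)" "k * (t - a) < k * L"
      using that \<open>k > 0\<close> by (auto intro!: mult_strict_left_mono)
    then have "s t > 0" unfolding s_def kL by (rule sin_gt_zero)
    then show ?thesis by simp
  qed
  have sC: "(s t)\<^sup>2 + (C t)\<^sup>2 = 1" for t by (simp add: s_def C_def)
  have dPhi: "(\<Phi> has_vector_derivative \<psi> t) (at t)" if "t \<in> {a<..<a + L}" for t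
  proof -
    note nz = pos[OF that]
    have "(\<Phi> has_real_derivative
       (k * (- k * s t) * g t + k * C t * g' t) * (g t / s t)
        + k * C t * g t * ((g' t * s t - g t * (k * C t)) / (s t * s t))) (at t)"
      unfolding \<Phi>_def[abs_def] using nz
      by (auto intro!: derivative_eq_intros ds dC der simp: field_simps power2_eq_square)
    moreover have "(k * (- k * s t) * g t + k * C t * g' t) * (g t / s t)
        + k * C t * g t * ((g' t * s t - g t * (k * C t)) / (s t * s t)) = \<psi> t"
      using nz by (simp add: \<psi>_def field_simps power2_eq_square)
    ultimately show ?thesis by (simp add: has_real_derivative_iff_has_vector_derivative)
  qed
  have isPhi: "isCont \<Phi> c" if "g c = 0" "s c = 0" for c
  proof -
    have "C c \<noteq> 0" using sC[of c] that by auto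
    then have "((\<lambda>t. g t / s t) \<longlongrightarrow> g' c / (k * C c)) (at c)"
      using \<open>k > 0\<close> that by (intro tendsto_quotient_common_zero der ds) auto
    moreover have "((\<lambda>t. k * C t * g t) \<longlongrightarrow> k * C c * g c) (at c)"
      using isC by (intro tendsto_intros) (auto simp: isCont_def)
    ultimately have "(\<Phi> \<longlongrightarrow> k * C c * g c * (g' c / (k * C c))) (at c)"
      unfolding \<Phi>_def[abs_def] by (rule tendsto_mult[rotated])
    then show ?thesis by (simp add: isCont_def \<Phi>_def that)
  qed
  have "isCont \<Phi> t" if t: "t \<in> {a..a + L}" for t
  proof -
    consider "t = a" | "t = a + L" | "t \<in> {a<..<a + L}"
      using t by fastforce
    then show ?thesis
    proof cases
      case 1 then show ?thesis using isPhi[of a] ga by (simp add: s_def)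
    next
      case 2 then show ?thesis using isPhi[of "a + L"] gb by (simp add: s_def kL)
    next
      case 3
      then show ?thesis
        using dPhi has_vector_derivative_continuous by blast
    qed
  qed
  then have "continuous_on {a..a + L} \<Phi>" by (simp add: continuous_at_imp_continuous_on)
  then have "(\<psi> has_integral (\<Phi> (a + L) - \<Phi> a)) {a..a + L}"
    using L0 dPhi by (intro fundamental_theorem_of_calculus_interior) auto
  then have 1: "(\<psi> has_integral 0) {a..a + L}"
    by (simp add: \<Phi>_def ga gb)
  have int: "(\<lambda>t. (g t)\<^sup>2) integrable_on {a..a + L}" "(\<lambda>t. (g' t)\<^sup>2) integrable_on {a..a + L}"
    by (auto intro!: integrable_continuous_real continuous_intros
        intro: continuous_on_subset[OF cont] continuous_on_subset[OF contg])
  have 2: "((\<lambda>t. (g' t)\<^sup>2 - k\<^sup>2 * (g t)\<^sup>2) has_integral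
     (integral {a..a + L} (\<lambda>t. (g' t)\<^sup>2) - k\<^sup>2 * integral {a..a + L} (\<lambda>t. (g t)\<^sup>2))) {a..a + L}"
    using int by (intro has_integral_diff has_integral_mult_right integrable_integral)
  show ?thesis
    using has_integral_le[OF 1 2] by (simp add: \<psi>_def)
qed

lemma integral_shift_period:
  fixes h :: "real \<Rightarrow> real"
  assumes "continuous_on UNIV h" "\<And>t. h (t + L) = h t" "0 \<le> c" "c \<le> L"
  shows "integral {c..c + L} h = integral {0..L} h"
proof -
  have i: "h integrable_on {x..y}" for x y
    using assms(1) continuous_on_subset integrable_continuous_real by blast
  have "integral {0..c} h + integral {c..L} h = integral {0..L} h"
    using assms i by (intro Henstock_Kurzweil_Integration.integral_combine) auto
  moreover have "integral {c..L} h + integral {L..c + L} h = integral {c..c + L} h"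
    using assms i by (intro Henstock_Kurzweil_Integration.integral_combine) auto
  moreover have "integral {L..c + L} h = integral {0..c} h"
  proof -
    have "integral {0..c} (\<lambda>t. h (t + L)) = integral {L..c + L} h"
      using integral_shift_real_ivl[of L L "c + L" h] by simp
    then show ?thesis using assms(2) by simp
  qed
  ultimately show ?thesis by simp
qed

lemma integral_translate_period:
  fixes h :: "real \<Rightarrow> real"
  assumes "continuous_on UNIV h" "\<And>t. h (t + L) = h t" "0 \<le> c" "c \<le> L"
  shows "integral {0..L} (\<lambda>t. h (t + c)) = integral {0..L} h"
  using integral_shift_period[OF assms] integral_shift_real_ivl[of c c "c + L" h] by simp

text \<open>An antiperiodic function vanishes somewhere, hence also one antiperiod later, which gives the
  Dirichlet condition.\<close>

lemma wirtinger_antiperiodic: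
  fixes g g' :: "real \<Rightarrow> real"
  assumes der: "\<And>t. (g has_real_derivative g' t) (at t)" and cont: "continuous_on UNIV g'"
    and "L > 0" and anti: "\<And>t. g (t + L) = - g t" and anti': "\<And>t. g' (t + L) = - g' t"
  shows "(pi / L)\<^sup>2 * integral {0..L} (\<lambda>t. (g t)\<^sup>2) \<le> integral {0..L} (\<lambda>t. (g' t)\<^sup>2)"
proof -
  have contg: "continuous_on UNIV g"
    using der by (intro continuous_at_imp_continuous_on) (auto intro: DERIV_isCont)
  obtain c where c: "0 \<le> c" "c \<le> L" "g c = 0"
  proof -
    have gL: "g L = - g 0" using anti[of 0] by simp
    have cL: "continuous_on {0..L} g" using contg continuous_on_subset by blast
    show ?thesis
    proof (cases "g 0 \<le> 0")
      case True
      then show ?thesis using IVT'[of g 0 0 L] gL \<open>L > 0\<close> cL that by auto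
    next
      case False
      then show ?thesis using IVT2'[of g L 0 0] gL \<open>L > 0\<close> cL that by auto
    qed
  qed
  have "(pi / L)\<^sup>2 * integral {c..c + L} (\<lambda>t. (g t)\<^sup>2) \<le> integral {c..c + L} (\<lambda>t. (g' t)\<^sup>2)"
    using \<open>L > 0\<close> c anti[of c] by (intro wirtinger_dirichlet[OF der cont]) auto
  moreover have "integral {c..c + L} (\<lambda>t. (g t)\<^sup>2) = integral {0..L} (\<lambda>t. (g t)\<^sup>2)"
    using contg anti c by (intro integral_shift_period) (auto intro!: continuous_intros)
  moreover have "integral {c..c + L} (\<lambda>t. (g' t)\<^sup>2) = integral {0..L} (\<lambda>t. (g' t)\<^sup>2)"
    using cont anti' c by (intro integral_shift_period) (auto intro!: continuous_intros)
  ultimately show ?thesis by simp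
qed

text \<open>A periodic function takes equal values \<open>a\<close> at two points half a period apart; both halves of
  the period then satisfy the Dirichlet condition for \<open>g - a\<close>.\<close>

lemma wirtinger_periodic:
  fixes g g' :: "real \<Rightarrow> real"
  assumes der: "\<And>t. (g has_real_derivative g' t) (at t)" and cont: "continuous_on UNIV g'"
    and "L > 0" and per: "\<And>t. g (t + 2 * L) = g t" and per': "\<And>t. g' (t + 2 * L) = g' t"
  obtains a where "(pi / L)\<^sup>2 * integral {0..2 * L} (\<lambda>t. (g t - a)\<^sup>2) \<le> integral {0..2 * L} (\<lambda>t. (g' t)\<^sup>2)"
proof -
  have contg: "continuous_on UNIV g"
    using der by (intro continuous_at_imp_continuous_on) (auto intro: DERIV_isCont)
  obtain c where c: "0 \<le> c" "c \<le> L" "g (c + L) = g c"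
  proof -
    define h where "h t = g (t + L) - g t" for t
    have hL: "h L = - h 0" using per[of 0] by (simp add: h_def)
    have cL: "continuous_on {0..L} h" unfolding h_def
      by (auto intro!: continuous_intros continuous_on_compose2[OF contg] intro: continuous_on_subset[OF contg])
    have "\<exists>c. 0 \<le> c \<and> c \<le> L \<and> h c = 0"
    proof (cases "h 0 \<le> 0")
      case True
      then show ?thesis using IVT'[of h 0 0 L] hL \<open>L > 0\<close> cL by auto
    next
      case False
      then show ?thesis using IVT2'[of h L 0 0] hL \<open>L > 0\<close> cL by auto
    qed
    then show ?thesis using that by (auto simp: h_def)
  qed
  define u where "u t = g t - g c" for t
  have du: "(u has_real_derivative g' t) (at t)" for t
    unfolding u_def[abs_def] by (auto intro!: derivative_eq_intros der)
  have contu: "continuous_on UNIV u" unfolding u_def[abs_def] by (intro continuous_intros contg)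
  have 1: "(pi / L)\<^sup>2 * integral {c..c + L} (\<lambda>t. (u t)\<^sup>2) \<le> integral {c..c + L} (\<lambda>t. (g' t)\<^sup>2)"
    using \<open>L > 0\<close> c by (intro wirtinger_dirichlet[OF du cont]) (auto simp: u_def)
  have 2: "(pi / L)\<^sup>2 * integral {c + L..c + L + L} (\<lambda>t. (u t)\<^sup>2) \<le> integral {c + L..c + L + L} (\<lambda>t. (g' t)\<^sup>2)"
    using \<open>L > 0\<close> c per[of c] by (intro wirtinger_dirichlet[OF du cont]) (auto simp: u_def algebra_simps)
  have comb: "integral {c..c + L} h + integral {c + L..c + L + L} h = integral {0..2 * L} h"
    if "continuous_on UNIV h" "\<And>t. h (t + 2 * L) = h t" for h :: "real \<Rightarrow> real"
  proof -
    have "integral {c..c + L} h + integral {c + L..c + L + L} h = integral {c..c + L + L} h"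
      using \<open>L > 0\<close> continuous_on_subset[OF that(1)]
      by (intro Henstock_Kurzweil_Integration.integral_combine integrable_continuous_real) auto
    also have "\<dots> = integral {c..c + 2 * L} h" by (simp add: algebra_simps)
    also have "\<dots> = integral {0..2 * L} h"
      using c \<open>L > 0\<close> by (intro integral_shift_period that) auto
    finally show ?thesis .
  qed
  have "integral {c..c + L} (\<lambda>t. (u t)\<^sup>2) + integral {c + L..c + L + L} (\<lambda>t. (u t)\<^sup>2)
      = integral {0..2 * L} (\<lambda>t. (u t)\<^sup>2)"
    by (intro comb continuous_intros contu) (simp add: u_def per)
  moreover have "integral {c..c + L} (\<lambda>t. (g' t)\<^sup>2) + integral {c + L..c + L + L} (\<lambda>t. (g' t)\<^sup>2)
      = integral {0..2 * L} (\<lambda>t. (g' t)\<^sup>2)"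
    by (intro comb continuous_intros cont) (simp add: per')
  ultimately have "(pi / L)\<^sup>2 * integral {0..2 * L} (\<lambda>t. (u t)\<^sup>2) \<le> integral {0..2 * L} (\<lambda>t. (g' t)\<^sup>2)"
    using add_mono[OF 1 2] by (simp only: distrib_left[symmetric])
  then show ?thesis using that[of "g c"] unfolding u_def by blast
qed

text \<open>Both \<open>g\<close> and its translate are close in the mean to the constant \<open>a\<close> of the previous lemma. The
  period \<open>\<pi>\<close> makes the Wirtinger constant \<open>1/4\<close>, which compensates the factor \<open>4\<close> lost in the triangle
  inequality.\<close>

lemma integral_translation_difference_le:
  fixes g g' :: "real \<Rightarrow> real"
  assumes der: "\<And>t. (g has_real_derivative g' t) (at t)" and cont: "continuous_on UNIV g'"
    and per: "\<And>t. g (t + pi) = g t" and per': "\<And>t. g' (t + pi) = g' t"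
    and \<theta>: "0 \<le> \<theta>" "\<theta> \<le> pi"
  shows "integral {0..pi} (\<lambda>t. (g (t + \<theta>) - g t)\<^sup>2) \<le> integral {0..pi} (\<lambda>t. (g' t)\<^sup>2)"
proof -
  have contg: "continuous_on UNIV g"
    using der by (intro continuous_at_imp_continuous_on) (auto intro: DERIV_isCont)
  obtain a where a: "(pi / (pi / 2))\<^sup>2 * integral {0..2 * (pi / 2)} (\<lambda>t. (g t - a)\<^sup>2)
      \<le> integral {0..2 * (pi / 2)} (\<lambda>t. (g' t)\<^sup>2)"
    using wirtinger_periodic[OF der cont, of "pi / 2"] per per' by auto
  have cu: "continuous_on UNIV (\<lambda>t. (g t - a)\<^sup>2)" by (intro continuous_intros contg)
  have cs: "continuous_on UNIV (\<lambda>t. g (t + \<theta>))"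
    by (rule continuous_on_compose2[OF contg]) (auto intro!: continuous_intros)
  have i: "f integrable_on {0..pi}" if "continuous_on UNIV f" for f :: "real \<Rightarrow> real"
    using that continuous_on_subset integrable_continuous_real by blast
  have "integral {0..pi} (\<lambda>t. (g (t + \<theta>) - g t)\<^sup>2)
      \<le> integral {0..pi} (\<lambda>t. 2 * (g (t + \<theta>) - a)\<^sup>2 + 2 * (g t - a)\<^sup>2)"
  proof (intro integral_le i continuous_intros cs contg)
    fix t
    have "0 \<le> ((g (t + \<theta>) - a) + (g t - a))\<^sup>2" by simp
    then show "(g (t + \<theta>) - g t)\<^sup>2 \<le> 2 * (g (t + \<theta>) - a)\<^sup>2 + 2 * (g t - a)\<^sup>2"
      by (simp add: power2_eq_square algebra_simps)
  qed
  also have "\<dots> = 2 * integral {0..pi} (\<lambda>t. (g (t + \<theta>) - a)\<^sup>2) + 2 * integral {0..pi} (\<lambda>t. (g t - a)\<^sup>2)"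
    by (subst integral_add) (auto intro!: i continuous_intros cs contg)
  also have "integral {0..pi} (\<lambda>t. (g (t + \<theta>) - a)\<^sup>2) = integral {0..pi} (\<lambda>t. (g t - a)\<^sup>2)"
    using integral_translate_period[OF cu, of pi \<theta>] per \<theta> by simp
  finally show ?thesis using a by simp
qed

section \<open>Derivatives along a submanifold\<close>

lemma smooth_mapI: "open U \<Longrightarrow> M \<subseteq> U \<Longrightarrow> smooth_on U f \<Longrightarrow> smooth_map M f"
  unfolding smooth_map_def by blast

lemma smooth_map_imp_continuous:
  assumes "smooth_map M f" shows "continuous_on M f"
proof (rule continuous_on_eq_continuous_within[THEN iffD2], rule ballI)
  fix p assume "p \<in> M"
  then obtain U g where U: "open U" "p \<in> U" "smooth_on U g" "\<forall>x\<in>M \<inter> U. f x = g x"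
    using assms unfolding smooth_map_def by blast
  have "isCont g p"
    using smooth_on_imp_continuous[OF U(3)] U continuous_on_eq_continuous_at by blast
  then have "continuous (at p within M) g"
    using continuous_at_imp_continuous_at_within by blast
  moreover have "\<forall>\<^sub>F x in at p within M. g x = f x"
    using U by (auto simp: eventually_at_topological)
  ultimately show "continuous (at p within M) f"
    using U \<open>p \<in> M\<close> unfolding continuous_within
    by (metis IntI Lim_transform_eventually)
qed

text \<open>A map on \<open>M\<close> has no derivative of its own. It is differentiated along curves through local
  extensions \<open>g\<close> to the ambient space.\<close>

lemma has_vector_derivative_local:
  assumes g: "(g has_derivative g') (at (\<gamma> t))" and \<gamma>: "(\<gamma> has_vector_derivative v) (at t)"
    and U: "open U" "\<gamma> t \<in> U" "\<And>x. x \<in> M \<inter> U \<Longrightarrow> f x = g x"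
    and T: "open T" "t \<in> T" "\<gamma> ` T \<subseteq> M"
  shows "((\<lambda>s. f (\<gamma> s)) has_vector_derivative g' v) (at t)"
proof -
  have 1: "((\<lambda>s. g (\<gamma> s)) has_vector_derivative g' v) (at t)"
    using vector_derivative_diff_chain_within[of \<gamma> v t UNIV g g'] g \<gamma> has_derivative_at_withinI
    by (auto simp: o_def)
  obtain d where d: "d > 0" "\<And>s. dist s t < d \<Longrightarrow> g (\<gamma> s) = f (\<gamma> s)"
  proof -
    obtain e where e: "e > 0" "ball (\<gamma> t) e \<subseteq> U" using U openE by blast
    have "isCont \<gamma> t" using \<gamma> by (rule has_vector_derivative_continuous)
    then obtain d1 where d1: "d1 > 0" "\<And>s. dist s t < d1 \<Longrightarrow> dist (\<gamma> s) (\<gamma> t) < e"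
      using e(1) unfolding continuous_at_eps_delta by blast
    obtain d2 where d2: "d2 > 0" "ball t d2 \<subseteq> T" using T openE by blast
    show ?thesis
    proof (rule that)
      show "min d1 d2 > 0" using d1 d2 by simp
      fix s assume s: "dist s t < min d1 d2"
      then have "\<gamma> s \<in> U" using d1 e by (auto simp: subset_eq dist_commute)
      moreover have "\<gamma> s \<in> M" using s d2 T by (auto simp: subset_eq dist_commute)
      ultimately show "g (\<gamma> s) = f (\<gamma> s)" using U(3) by simp
    qed
  qed
  show ?thesis
    using has_vector_derivative_transform_within[OF 1 d(1) UNIV_I d(2)] .
qed

lemma has_vector_derivative_locally_const:
  assumes "(h has_vector_derivative d) (at t)" "open T" "t \<in> T" "\<And>s. s \<in> T \<Longrightarrow> h s = k"
  shows "d = 0"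
proof -
  have "((\<lambda>s. k) has_vector_derivative d) (at t)"
    by (rule has_vector_derivative_transform_within_open[OF assms(1-3)]) (rule assms(4))
  then show ?thesis
    using vector_derivative_unique_at has_vector_derivative_const by blast
qed

lemma curve_inD:
  assumes "curve_in M p v \<gamma>"
  obtains T where "open T" "0 \<in> T" "\<gamma> ` T \<subseteq> M" "\<gamma> 0 = p" "(\<gamma> has_vector_derivative v) (at 0)"
  using assms unfolding curve_in_def by (metis greaterThanLessThan_iff neg_less_0_iff_less open_greaterThanLessThan)

lemma tderiv_eqI:
  assumes "v \<in> tangent_space M p"
    and "\<And>\<gamma>. curve_in M p v \<gamma> \<Longrightarrow> ((f \<circ> \<gamma>) has_vector_derivative d) (at 0)"
  shows "tderiv M f p v = d"
  unfolding tderiv_def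
proof (rule the_equality)
  show "\<forall>\<gamma>. curve_in M p v \<gamma> \<longrightarrow> ((f \<circ> \<gamma>) has_vector_derivative d) (at 0)" using assms(2) by blast
  fix d' assume "\<forall>\<gamma>. curve_in M p v \<gamma> \<longrightarrow> ((f \<circ> \<gamma>) has_vector_derivative d') (at 0)"
  then show "d' = d"
    using assms vector_derivative_unique_at unfolding tangent_space_def by blast
qed

lemma tderiv_local:
  assumes "v \<in> tangent_space M p" and g: "(g has_derivative g') (at p)"
    and U: "open U" "p \<in> U" "\<And>x. x \<in> M \<inter> U \<Longrightarrow> f x = g x"
  shows "tderiv M f p v = g' v"
proof (rule tderiv_eqI[OF assms(1)])
  fix \<gamma> assume "curve_in M p v \<gamma>"
  then obtain T where "open T" "0 \<in> T" "\<gamma> ` T \<subseteq> M" "\<gamma> 0 = p" "(\<gamma> has_vector_derivative v) (at 0)"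
    by (rule curve_inD)
  then show "((f \<circ> \<gamma>) has_vector_derivative g' v) (at 0)"
    using has_vector_derivative_local[of g g' \<gamma> 0 v U M f T] g U by (auto simp: o_def)
qed

lemma smooth_map_local:
  assumes "smooth_map M f" "p \<in> M"
  obtains U g where "open U" "p \<in> U" "smooth_on U g" "\<And>x. x \<in> M \<inter> U \<Longrightarrow> f x = g x"
    "\<And>q v. q \<in> M \<inter> U \<Longrightarrow> v \<in> tangent_space M q \<Longrightarrow> tderiv M f q v = frechet_derivative g (at q) v"
proof -
  obtain U g where U: "open U" "p \<in> U" "smooth_on U g" "\<And>x. x \<in> M \<inter> U \<Longrightarrow> f x = g x"
    using assms unfolding smooth_map_def by metis
  show ?thesis
    by (rule that[OF U]) (use U tderiv_local[OF _ smooth_onD_diff[OF U(3)] U(1)] in auto)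
qed

lemma tderiv_chain:
  assumes "smooth_map M f" and T: "open T" "t \<in> T" "\<gamma> ` T \<subseteq> M"
    and \<gamma>: "(\<gamma> has_vector_derivative v) (at t)" and v: "v \<in> tangent_space M (\<gamma> t)"
  shows "((\<lambda>s. f (\<gamma> s)) has_vector_derivative tderiv M f (\<gamma> t) v) (at t)"
proof -
  have p: "\<gamma> t \<in> M" using T by blast
  obtain U g where U: "open U" "\<gamma> t \<in> U" "smooth_on U g" "\<And>x. x \<in> M \<inter> U \<Longrightarrow> f x = g x"
    "\<And>q v. q \<in> M \<inter> U \<Longrightarrow> v \<in> tangent_space M q \<Longrightarrow> tderiv M f q v = frechet_derivative g (at q) v"
    using smooth_map_local[OF assms(1) p] by metis
  show ?thesis
    using has_vector_derivative_local[OF smooth_onD_diff[OF U(3,2)] \<gamma> U(1,2,4) T] U(5) p U(2) v by auto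
qed

lemma tderiv_curve:
  assumes "smooth_map M f" "curve_in M p v \<gamma>"
  shows "((f \<circ> \<gamma>) has_vector_derivative tderiv M f p v) (at 0)"
proof -
  obtain T where "open T" "0 \<in> T" "\<gamma> ` T \<subseteq> M" "\<gamma> 0 = p" "(\<gamma> has_vector_derivative v) (at 0)"
    using assms(2) by (rule curve_inD)
  then show ?thesis
    using tderiv_chain[OF assms(1), of T 0 \<gamma> v] assms(2) by (auto simp: o_def tangent_space_def)
qed

lemma tderiv_sum:
  assumes "smooth_map M f" "p \<in> M" "subspace (tangent_space M p)" "\<And>i. i \<in> I \<Longrightarrow> v i \<in> tangent_space M p"
  shows "tderiv M f p (\<Sum>i\<in>I. a i *\<^sub>R v i) = (\<Sum>i\<in>I. a i *\<^sub>R tderiv M f p (v i))"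
proof -
  obtain U g where U: "open U" "p \<in> U" "smooth_on U g"
    "\<And>q v. q \<in> M \<inter> U \<Longrightarrow> v \<in> tangent_space M q \<Longrightarrow> tderiv M f q v = frechet_derivative g (at q) v"
    using smooth_map_local[OF assms(1,2)] by metis
  have l: "linear (frechet_derivative g (at p))"
    using smooth_onD_diff[OF U(3,2)] has_derivative_linear by blast
  have "(\<Sum>i\<in>I. a i *\<^sub>R v i) \<in> tangent_space M p"
    using assms by (auto intro!: subspace_sum subspace_mul)
  then show ?thesis
    using U(4)[of p] U(2) assms(2,4) by (simp add: linear_sum[OF l] linear_cmul[OF l])
qed

lemma normal_part_eqI:
  assumes "subspace (tangent_space M p)" "n \<in> normal_space M p" "w - n \<in> tangent_space M p"
  shows "normal_part M p w = n"
  unfolding normal_part_def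
proof (rule the_equality)
  fix m assume m: "m \<in> normal_space M p \<and> w - m \<in> tangent_space M p"
  have "(w - n) - (w - m) \<in> tangent_space M p"
    using assms m subspace_diff by blast
  moreover have "m - n \<in> normal_space M p"
    using assms m subspace_diff[OF subspace_orthogonal_comp] unfolding normal_space_def by blast
  ultimately have "orthogonal (m - n) (m - n)"
    unfolding normal_space_def orthogonal_comp_def by (auto simp: orthogonal_commute)
  then show "m = n" by (simp add: orthogonal_def)
qed (use assms in auto)

lemma orthonormal_expansion:
  fixes e :: "'i \<Rightarrow> 'a::euclidean_space"
  assumes "subspace T" "finite I" "card I = dim T" "\<And>i. i \<in> I \<Longrightarrow> e i \<in> T"
    and on: "\<And>i j. i \<in> I \<Longrightarrow> j \<in> I \<Longrightarrow> e i \<bullet> e j = (if i = j then 1 else 0)"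
    and "v \<in> T"
  shows "v = (\<Sum>i\<in>I. (v \<bullet> e i) *\<^sub>R e i)"
proof -
  let ?B = "e ` I"
  have inj: "inj_on e I"
    by (rule inj_onI) (metis on zero_neq_one)
  have "0 \<notin> ?B"
    using on by (metis imageE inner_zero_left zero_neq_one)
  moreover have "pairwise orthogonal ?B"
    using on by (auto simp: pairwise_def orthogonal_def)
  ultimately have "independent ?B"
    by (intro pairwise_orthogonal_independent)
  moreover have "card ?B = dim T" using inj assms by (simp add: card_image)
  ultimately have "T \<subseteq> span ?B"
    using assms card_eq_dim[of ?B T] by auto
  then have sp: "v \<in> span ?B" using assms by blast
  let ?z = "v - (\<Sum>i\<in>I. (v \<bullet> e i) *\<^sub>R e i)"
  have "orthogonal ?z y" if y: "y \<in> ?B" for y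
  proof -
    obtain j where j: "j \<in> I" "y = e j" using y by blast
    have "(\<Sum>i\<in>I. (v \<bullet> e i) *\<^sub>R e i) \<bullet> e j = (\<Sum>i\<in>I. if i = j then v \<bullet> e i else 0)"
      unfolding inner_sum_left using on j by (intro sum.cong) auto
    then show ?thesis using j assms by (simp add: orthogonal_def inner_diff_left)
  qed
  moreover have "?z \<in> span ?B"
    using sp by (intro span_diff span_sum span_mul) (auto intro: span_base)
  ultimately have "orthogonal ?z ?z" using orthogonal_to_span by blast
  then show ?thesis by (simp add: orthogonal_def)
qed

lemma orthonormal_parseval:
  fixes e :: "'i \<Rightarrow> 'a::euclidean_space"
  assumes "subspace T" "finite I" "card I = dim T" "\<And>i. i \<in> I \<Longrightarrow> e i \<in> T"
    and "\<And>i j. i \<in> I \<Longrightarrow> j \<in> I \<Longrightarrow> e i \<bullet> e j = (if i = j then 1 else 0)"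
    and "v \<in> T"
  shows "v \<bullet> w = (\<Sum>i\<in>I. (v \<bullet> e i) * (w \<bullet> e i))"
proof -
  have "v \<bullet> w = (\<Sum>i\<in>I. (v \<bullet> e i) *\<^sub>R e i) \<bullet> w"
    using orthonormal_expansion[OF assms] by (rule arg_cong)
  also have "\<dots> = (\<Sum>i\<in>I. (v \<bullet> e i) * (e i \<bullet> w))"
    by (simp only: inner_sum_left inner_scaleR_left)
  finally show ?thesis by (simp only: inner_commute[of w])
qed


section \<open>Spheres in a linear subspace\<close>

locale sphere_in_subspace =
  fixes V :: "'a::euclidean_space set" and c :: 'a and r :: real and M :: "'a set"
  assumes subspace_V: "subspace V" and c_in_V: "c \<in> V" and r_pos: "r > 0"
    and M_def: "M = sphere c r \<inter> V"
begin

lemma diff_in_V: "x - c \<in> V \<longleftrightarrow> x \<in> V"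
  using subspace_V c_in_V by (metis diff_add_cancel subspace_add subspace_diff)

lemma mem_M: "x \<in> M \<longleftrightarrow> x - c \<in> V \<and> norm (x - c) = r"
  by (auto simp: M_def diff_in_V dist_norm norm_minus_commute)

lemma inner_radius: "x \<in> M \<Longrightarrow> (x - c) \<bullet> (x - c) = r\<^sup>2"
  by (simp add: mem_M dot_square_norm)

lemma compact_M: "compact M"
  unfolding M_def by (intro compact_Int_closed compact_sphere closed_subspace subspace_V)

definition great_circle :: "'a \<Rightarrow> 'a \<Rightarrow> real \<Rightarrow> 'a" where
  "great_circle y w t = c + cos t *\<^sub>R y + sin t *\<^sub>R w"

lemma great_circle_in_M:
  assumes "y \<in> V" "w \<in> V" "y \<bullet> w = 0" "norm y = r" "norm w = r"
  shows "great_circle y w t \<in> M"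
proof -
  have "(norm (cos t *\<^sub>R y + sin t *\<^sub>R w))\<^sup>2 = (cos t)\<^sup>2 * (norm y)\<^sup>2 + (sin t)\<^sup>2 * (norm w)\<^sup>2"
    using assms(3) by (subst norm_add_Pythagorean) (auto simp: orthogonal_def power_mult_distrib)
  also have "\<dots> = r\<^sup>2 * ((cos t)\<^sup>2 + (sin t)\<^sup>2)"
    using assms by (simp only: distrib_left mult.commute)
  also have "\<dots> = r\<^sup>2" by (simp only: sin_cos_squared_add2 mult_1_right)
  finally have "norm (cos t *\<^sub>R y + sin t *\<^sub>R w) = r"
    using r_pos by (simp add: power2_eq_iff_nonneg)
  then show ?thesis
    using assms subspace_V by (auto simp: mem_M great_circle_def add.assoc intro!: subspace_add subspace_mul)
qed

text \<open>Differentiating \<open>\<parallel>\<gamma> - c\<parallel>\<^sup>2 = r\<^sup>2\<close> and \<open>\<langle>\<gamma>, z\<rangle> = 0\<close> for \<open>z\<close> orthogonal to \<open>V\<close> bounds the tangent space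
  from above; great circles, run through with the speed of \<open>v\<close>, realize all vectors \<open>v\<close>.\<close>

lemma tangent_space_M:
  assumes "p \<in> M"
  shows "tangent_space M p = {v \<in> V. v \<bullet> (p - c) = 0}"
proof (intro equalityI subsetI CollectI conjI)
  fix v assume "v \<in> tangent_space M p"
  then obtain \<gamma> where "curve_in M p v \<gamma>" unfolding tangent_space_def by blast
  then obtain T where T: "open T" "0 \<in> T" "\<gamma> ` T \<subseteq> M" "\<gamma> 0 = p" and d: "(\<gamma> has_vector_derivative v) (at 0)"
    by (rule curve_inD)
  show "v \<bullet> (p - c) = 0"
  proof -
    have "((\<lambda>x. (x - c) \<bullet> (x - c)) has_derivative (\<lambda>h. 2 * (h \<bullet> (p - c)))) (at (\<gamma> 0))"
      using T(4) by (auto intro!: derivative_eq_intros simp: inner_commute)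
    then have "((\<lambda>s. r\<^sup>2) has_vector_derivative 2 * (v \<bullet> (p - c))) (at 0)"
      using has_vector_derivative_local[OF _ d, of "\<lambda>x. (x - c) \<bullet> (x - c)" _ UNIV M "\<lambda>x. r\<^sup>2" T] T
      by (auto simp: inner_radius)
    then show ?thesis
      using vector_derivative_unique_at[OF _ has_vector_derivative_const] by fastforce
  qed
  show "v \<in> V"
  proof -
    have "v \<bullet> z = 0" if z: "z \<in> orthogonal_comp V" for z
    proof -
      have *: "x \<bullet> z = 0" if "x \<in> V" for x
        using z that by (auto simp: orthogonal_comp_def orthogonal_def)
      have "((\<lambda>x. x \<bullet> z) has_derivative (\<lambda>h. h \<bullet> z)) (at (\<gamma> 0))"
        by (auto intro!: derivative_eq_intros)
      then have "((\<lambda>s. 0) has_vector_derivative v \<bullet> z) (at 0)"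
        using has_vector_derivative_local[OF _ d, of "\<lambda>x. x \<bullet> z" _ UNIV M "\<lambda>x. 0" T] T *
        by (auto simp: M_def)
      then show ?thesis
        using vector_derivative_unique_at[OF _ has_vector_derivative_const] by fastforce
    qed
    then have "v \<in> orthogonal_comp (orthogonal_comp V)"
      by (auto simp: orthogonal_comp_def[of "orthogonal_comp V"] orthogonal_def inner_commute)
    then show ?thesis
      using orthogonal_comp_self[OF subspace_V] by simp
  qed
next
  fix v assume "v \<in> {v \<in> V. v \<bullet> (p - c) = 0}"
  then have v: "v \<in> V" "v \<bullet> (p - c) = 0" by auto
  show "v \<in> tangent_space M p"
  proof (cases "v = 0")
    case True
    have "curve_in M p v (\<lambda>t. p)"
      unfolding curve_in_def using assms True
      by (auto intro!: exI[of _ 1] smooth_on_const)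
    then show ?thesis unfolding tangent_space_def by blast
  next
    case False
    define k where "k = norm v / r"
    have k: "k > 0" using False r_pos by (simp add: k_def)
    define \<gamma> where "\<gamma> t = great_circle (p - c) (v /\<^sub>R k) (k * t)" for t
    have "\<gamma> t \<in> M" for t
      unfolding \<gamma>_def using assms v False k r_pos subspace_V
      by (intro great_circle_in_M) (auto simp: mem_M inner_commute k_def subspace_mul)
    moreover have "\<gamma> 0 = p" by (simp add: \<gamma>_def great_circle_def)
    moreover have "(\<gamma> has_vector_derivative v) (at 0)"
      unfolding \<gamma>_def[abs_def] great_circle_def using k
      by (auto intro!: derivative_eq_intros)
    moreover have "smooth_on {-1<..<1} \<gamma>"
      unfolding \<gamma>_def[abs_def] great_circle_def
      by (intro smooth_on_add smooth_on_const smooth_on_scaleR smooth_on_cos smooth_on_sin) auto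
    ultimately have "curve_in M p v \<gamma>"
      unfolding curve_in_def by (auto intro!: exI[of _ 1])
    then show ?thesis unfolding tangent_space_def by blast
  qed
qed

lemma subspace_tangent: "p \<in> M \<Longrightarrow> subspace (tangent_space M p)"
  using subspace_V by (auto simp: tangent_space_M subspace_def inner_left_distrib)

lemma normal_part_M:
  assumes "p \<in> M" "t \<in> V" "t \<bullet> (p - c) = 0" "z \<in> orthogonal_comp V"
    and "w = t + a *\<^sub>R (p - c) + z"
  shows "normal_part M p w = a *\<^sub>R (p - c) + z"
proof (rule normal_part_eqI[OF subspace_tangent[OF assms(1)]])
  show "a *\<^sub>R (p - c) + z \<in> normal_space M p"
    using assms unfolding normal_space_def tangent_space_M[OF assms(1)]
    by (auto simp: orthogonal_comp_def orthogonal_def inner_add_right inner_commute)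
  show "w - (a *\<^sub>R (p - c) + z) \<in> tangent_space M p"
    using assms by (auto simp: tangent_space_M)
qed

lemma normal_part_in_V:
  assumes "p \<in> M" "w \<in> V"
  shows "normal_part M p w = ((w \<bullet> (p - c)) / r\<^sup>2) *\<^sub>R (p - c)"
proof -
  let ?a = "(w \<bullet> (p - c)) / r\<^sup>2"
  have "normal_part M p w = ?a *\<^sub>R (p - c) + 0"
  proof (rule normal_part_M[OF assms(1), where t = "w - ?a *\<^sub>R (p - c)"])
    show "w - ?a *\<^sub>R (p - c) \<in> V"
      using assms subspace_V by (auto intro!: subspace_diff subspace_mul simp: mem_M)
    show "(w - ?a *\<^sub>R (p - c)) \<bullet> (p - c) = 0"
      using assms inner_radius r_pos by (simp add: inner_diff_left)
  qed (auto simp: orthogonal_comp_def orthogonal_def)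
  then show ?thesis by simp
qed

text \<open>The inner product of the derivative with a vector orthogonal to \<open>S\<close> is the derivative of the zero
  function.\<close>

lemma tderiv_in_subspace:
  assumes "smooth_map M f" "p \<in> M" "v \<in> tangent_space M p" "subspace S" "\<And>x. x \<in> M \<Longrightarrow> f x \<in> S"
  shows "tderiv M f p v \<in> S"
proof -
  obtain \<gamma> where \<gamma>: "curve_in M p v \<gamma>" using assms(3) unfolding tangent_space_def by blast
  obtain T where T: "open T" "0 \<in> T" "\<gamma> ` T \<subseteq> M" using curve_inD[OF \<gamma>] by metis
  have d: "((f \<circ> \<gamma>) has_vector_derivative tderiv M f p v) (at 0)"
    by (rule tderiv_curve[OF assms(1) \<gamma>])
  have "tderiv M f p v \<bullet> z = 0" if z: "z \<in> orthogonal_comp S" for z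
  proof -
    have "((\<lambda>s. (f \<circ> \<gamma>) s \<bullet> z) has_vector_derivative tderiv M f p v \<bullet> z) (at 0)"
      using bounded_linear.has_vector_derivative[OF bounded_linear_inner_left d] .
    moreover have "(f \<circ> \<gamma>) s \<bullet> z = 0" if "s \<in> T" for s
      using that T assms(5) z by (auto simp: orthogonal_comp_def orthogonal_def)
    ultimately show ?thesis
      using has_vector_derivative_locally_const[OF _ T(1,2)] by blast
  qed
  then have "tderiv M f p v \<in> orthogonal_comp (orthogonal_comp S)"
    by (auto simp: orthogonal_comp_def[of "orthogonal_comp S"] orthogonal_def inner_commute)
  then show ?thesis using orthogonal_comp_self[OF assms(4)] by simp
qed

text \<open>Differentiating \<open>\<langle>X, x - c\<rangle> = 0\<close> for a tangent field \<open>X\<close> computes the normal component of its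
  derivative; the field \<open>x \<mapsto> v - \<langle>v, x - c\<rangle> (x - c) / r\<^sup>2\<close> shows that each tangent vector extends to
  a tangent field.\<close>

lemma second_ff_M:
  assumes p: "p \<in> M" and u: "u \<in> tangent_space M p" and v: "v \<in> tangent_space M p"
  shows "second_ff M p u v = (- (u \<bullet> v) / r\<^sup>2) *\<^sub>R (p - c)"
proof -
  have key: "normal_part M p (tderiv M X p u) = (- (u \<bullet> v) / r\<^sup>2) *\<^sub>R (p - c)"
    if X: "tangent_field M X" and Xp: "X p = v" for X
  proof -
    have sX: "smooth_map M X" and tX: "\<And>x. x \<in> M \<Longrightarrow> X x \<in> V \<and> X x \<bullet> (x - c) = 0"
      using X by (auto simp: tangent_field_def tangent_space_M)
    have inV: "tderiv M X p u \<in> V"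
      using tX by (intro tderiv_in_subspace[OF sX p u subspace_V]) auto
    obtain \<gamma> where \<gamma>: "curve_in M p u \<gamma>" using u unfolding tangent_space_def by blast
    obtain T where T: "open T" "0 \<in> T" "\<gamma> ` T \<subseteq> M" and \<gamma>0: "\<gamma> 0 = p"
      and d\<gamma>: "(\<gamma> has_vector_derivative u) (at 0)" using curve_inD[OF \<gamma>] by metis
    have dX: "((X \<circ> \<gamma>) has_vector_derivative tderiv M X p u) (at 0)"
      by (rule tderiv_curve[OF sX \<gamma>])
    have "((\<lambda>s. (X \<circ> \<gamma>) s \<bullet> (\<gamma> s - c)) has_vector_derivative
        (X p \<bullet> u + tderiv M X p u \<bullet> (p - c))) (at 0)"
      using bounded_bilinear.has_vector_derivative[OF bounded_bilinear_inner dX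
          has_vector_derivative_diff[OF d\<gamma> has_vector_derivative_const[of c]]] \<gamma>0 by simp
    moreover have "(X \<circ> \<gamma>) s \<bullet> (\<gamma> s - c) = 0" if "s \<in> T" for s
      using that T tX by auto
    ultimately have "X p \<bullet> u + tderiv M X p u \<bullet> (p - c) = 0"
      using has_vector_derivative_locally_const[OF _ T(1,2)] by blast
    then have "tderiv M X p u \<bullet> (p - c) = - (u \<bullet> v)"
      using Xp by (simp add: inner_commute)
    then show ?thesis
      using normal_part_in_V[OF p inV] by simp
  qed
  define X where "X x = v - ((v \<bullet> (x - c)) * (1 / r\<^sup>2)) *\<^sub>R (x - c)" for x
  have v': "v \<in> V" "v \<bullet> (p - c) = 0" using v tangent_space_M[OF p] by auto
  have "smooth_on UNIV X"
    unfolding X_def[abs_def]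
    by (intro smooth_on_diff smooth_on_const smooth_on_scaleR smooth_on_mult smooth_on_inner smooth_on_id open_UNIV)
  then have "smooth_map M X" by (rule smooth_mapI[OF open_UNIV subset_UNIV])
  moreover have "X x \<in> tangent_space M x" if "x \<in> M" for x
    using that v' inner_radius[OF that] r_pos subspace_V
    by (auto simp: tangent_space_M X_def inner_diff_left mem_M intro!: subspace_diff subspace_mul)
  ultimately have X: "tangent_field M X" by (simp add: tangent_field_def)
  have Xp: "X p = v" by (simp add: X_def v')
  show ?thesis
    unfolding second_ff_def
  proof (rule the_equality)
    show "\<forall>X. tangent_field M X \<and> X p = v \<longrightarrow>
        (- (u \<bullet> v) / r\<^sup>2) *\<^sub>R (p - c) = normal_part M p (tderiv M X p u)"
      using key by auto
    fix b assume "\<forall>X. tangent_field M X \<and> X p = v \<longrightarrow> b = normal_part M p (tderiv M X p u)"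
    then show "b = (- (u \<bullet> v) / r\<^sup>2) *\<^sub>R (p - c)" using key X Xp by metis
  qed
qed

end

section \<open>Change of variables for nonnegative functions\<close>

lemma nn_integral_change_of_variables_finite:
  fixes \<tau> :: "real^'n::{finite,wellorder} \<Rightarrow> real^'n::_" and f :: "real^'n::_ \<Rightarrow> real"
  assumes T: "T \<in> sets borel" "\<tau> ` T \<in> sets borel" "bounded (\<tau> ` T)"
    and der: "\<And>x. x \<in> T \<Longrightarrow> (\<tau> has_derivative \<tau>' x) (at x within T)" and inj: "inj_on \<tau> T"
    and f: "f \<in> borel_measurable borel" "\<And>y. 0 \<le> f y" "\<And>y. f y \<le> C"
  shows "(\<integral>\<^sup>+x\<in>T. ennreal (\<bar>det (matrix (\<tau>' x))\<bar> * f (\<tau> x)) \<partial>lborel) = (\<integral>\<^sup>+y\<in>\<tau> ` T. ennreal (f y) \<partial>lborel)"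
proof -
  let ?h = "\<lambda>x. \<bar>det (matrix (\<tau>' x))\<bar> * f (\<tau> x)"
  have "(\<integral>\<^sup>+y. ennreal (indicator (\<tau> ` T) y * f y) \<partial>lborel) \<le> (\<integral>\<^sup>+y. ennreal C * indicator (\<tau> ` T) y \<partial>lborel)"
    by (intro nn_integral_mono) (auto simp: indicator_def f ennreal_leI)
  also have "\<dots> < \<infinity>"
    using T emeasure_bounded_finite[OF T(3)] by (simp add: nn_integral_cmult_indicator ennreal_mult_less_top)
  finally have fin: "(\<integral>\<^sup>+y. ennreal (indicator (\<tau> ` T) y * f y) \<partial>lborel) < \<infinity>" .
  have "(\<lambda>y. indicator (\<tau> ` T) y * f y) integrable_on UNIV"
    using T f by (intro nn_integral_integrable_on fin) auto
  moreover have "(\<lambda>y. indicator (\<tau> ` T) y * f y) = (\<lambda>y. if y \<in> \<tau> ` T then f y else 0)"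
    by (auto simp: indicator_def)
  ultimately have "f integrable_on \<tau> ` T" by (simp add: integrable_restrict_UNIV)
  then have abs: "f absolutely_integrable_on \<tau> ` T"
    using f by (subst absolutely_integrable_on_iff_nonneg) auto
  have "(\<lambda>x. ?h x) absolutely_integrable_on T \<and> integral T ?h = integral (\<tau> ` T) f"
    using has_absolute_integral_change_of_variables[OF _ der inj, of "\<lambda>y. vec (f y) :: real^1" "vec (integral (\<tau> ` T) f)"]
      T abs by (simp add: absolutely_integrable_on_1_iff integral_on_1_eq)
  then have h: "(?h has_integral integral (\<tau> ` T) f) T"
    using absolutely_integrable_on_def has_integral_iff set_lebesgue_integral_eq_integral(1) by blast
  have f': "(f has_integral integral (\<tau> ` T) f) (\<tau> ` T)"
    using abs absolutely_integrable_on_def integrable_integral by blast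
  have eq: "(\<integral>\<^sup>+x\<in>A. ennreal (g x) \<partial>lborel) = (\<integral>\<^sup>+x. ennreal (indicator A x * g x) \<partial>lborel)" for A and g :: "real^'n::_ \<Rightarrow> real"
    by (intro nn_integral_cong) (auto simp: indicator_def)
  show ?thesis
    unfolding eq using nn_integral_has_integral_lebesgue[OF _ h] nn_integral_has_integral_lebesgue[OF _ f'] f by simp
qed

text \<open>The image need not be bounded: exhaust it by balls.\<close>

lemma nn_integral_change_of_variables_bounded:
  fixes \<tau> :: "real^'n::{finite,wellorder} \<Rightarrow> real^'n::_" and f :: "real^'n::_ \<Rightarrow> real"
  assumes S: "S \<in> sets borel" "\<tau> ` S \<in> sets borel"
    and der: "\<And>x. x \<in> S \<Longrightarrow> (\<tau> has_derivative \<tau>' x) (at x within S)" and inj: "inj_on \<tau> S"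
    and f: "f \<in> borel_measurable borel" "\<And>y. 0 \<le> f y" "\<And>y. f y \<le> C"
    and meas: "(\<lambda>x. ennreal (\<bar>det (matrix (\<tau>' x))\<bar> * f (\<tau> x)) * indicator S x) \<in> borel_measurable borel"
  shows "(\<integral>\<^sup>+x\<in>S. ennreal (\<bar>det (matrix (\<tau>' x))\<bar> * f (\<tau> x)) \<partial>lborel) = (\<integral>\<^sup>+y\<in>\<tau> ` S. ennreal (f y) \<partial>lborel)"
proof -
  let ?h = "\<lambda>x. ennreal (\<bar>det (matrix (\<tau>' x))\<bar> * f (\<tau> x))"
  define B where "B n = S \<inter> \<tau> -` cball 0 (real n)" for n
  have "continuous_on S \<tau>"
    using der has_derivative_continuous continuous_on_eq_continuous_within by blast
  then have "\<tau> \<in> borel_measurable (restrict_space borel S)"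
    by (rule borel_measurable_continuous_on_restrict)
  then have "\<tau> -` cball 0 (real n) \<inter> space (restrict_space borel S) \<in> sets (restrict_space borel S)" for n
    by (rule measurable_sets) simp
  then have Bb: "B n \<in> sets borel" for n
    using S by (auto simp: space_restrict_space sets_restrict_space B_def Int_commute image_iff)
      (metis (full_types) Int_commute S(1) sets.Int)
  have tB: "\<tau> ` B n = \<tau> ` S \<inter> cball 0 (real n)" for n by (auto simp: B_def)
  have incB: "incseq B" by (auto simp: incseq_def B_def)
  have "\<exists>n. norm y \<le> real n" for y :: "real^'n::_" using real_arch_simple by blast
  then have UB: "(\<Union>n. B n) = S" by (auto simp: B_def)
  have step: "(\<integral>\<^sup>+x\<in>B n. ?h x \<partial>lborel) = (\<integral>\<^sup>+y\<in>\<tau> ` B n. ennreal (f y) \<partial>lborel)" for n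
  proof (rule nn_integral_change_of_variables_finite[OF Bb _ _ _ _ f])
    have sub: "B n \<subseteq> S" by (auto simp: B_def)
    show "\<tau> ` B n \<in> sets borel" "bounded (\<tau> ` B n)"
      unfolding tB using S by (auto intro: bounded_subset[OF bounded_cball])
    show "inj_on \<tau> (B n)" using inj sub by (rule inj_on_subset)
    show "(\<tau> has_derivative \<tau>' x) (at x within B n)" if "x \<in> B n" for x
      using has_derivative_subset[OF der sub] that sub by blast
  qed
  let ?N = "density lborel (\<lambda>x. ?h x * indicator S x)"
  let ?N' = "density lborel (\<lambda>y. ennreal (f y))"
  have N: "emeasure ?N A = (\<integral>\<^sup>+x\<in>A. ?h x \<partial>lborel)" if "A \<in> sets borel" "A \<subseteq> S" for A
    using that meas
    by (subst emeasure_density) (auto intro!: nn_integral_cong simp: indicator_def)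
  have N': "emeasure ?N' A = (\<integral>\<^sup>+y\<in>A. ennreal (f y) \<partial>lborel)" if "A \<in> sets borel" for A
    using that f by (subst emeasure_density) auto
  have "(\<integral>\<^sup>+x\<in>S. ?h x \<partial>lborel) = emeasure ?N (\<Union>n. B n)" using N[of S] S by (simp add: UB)
  also have "\<dots> = (SUP n. emeasure ?N (B n))"
    using Bb incB by (subst SUP_emeasure_incseq) auto
  also have "\<dots> = (SUP n. emeasure ?N' (\<tau> ` B n))"
  proof (intro SUP_cong refl)
    fix n
    have "B n \<subseteq> S" "\<tau> ` B n \<in> sets borel" unfolding tB using S by (auto simp: B_def)
    then show "emeasure ?N (B n) = emeasure ?N' (\<tau> ` B n)"
      using step[of n] N[OF Bb] N' by simp
  qed
  also have "\<dots> = emeasure ?N' (\<Union>n. \<tau> ` B n)"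
    unfolding tB using S by (intro SUP_emeasure_incseq) (auto simp: incseq_def)
  also have "(\<Union>n. \<tau> ` B n) = \<tau> ` S" using UB by blast
  finally show ?thesis using N'[OF S(2)] by simp
qed


section \<open>The three-sphere: quaternionic structure and stereographic charts\<close>

text \<open>The maps \<open>Q 1\<close>, \<open>Q 2\<close>, \<open>Q 3\<close> make the four-dimensional space \<open>V\<close> a copy of the quaternions;
  \<open>x \<mapsto> Q i (x - c)\<close> are three orthogonal Killing fields that frame the sphere.\<close>

locale quaternionic_sphere = sphere_in_subspace +
  fixes Q :: "3 \<Rightarrow> 'a \<Rightarrow> 'a"
  assumes dim_V: "dim V = 4"
    and Q_linear: "linear (Q i)"
    and Q_in_V: "x \<in> V \<Longrightarrow> Q i x \<in> V"
    and Q_orthogonal: "x \<in> V \<Longrightarrow> Q i x \<bullet> x = 0"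
    and Q_clifford: "x \<in> V \<Longrightarrow> Q i (Q j x) + Q j (Q i x) = (if i = j then - 2 else 0) *\<^sub>R x"
    and Q_product: "x \<in> V \<Longrightarrow> Q 2 (Q 3 x) = Q 1 x"
begin

lemma Q_add: "Q i (x + y) = Q i x + Q i y" and Q_scaleR: "Q i (a *\<^sub>R x) = a *\<^sub>R Q i x"
  by (simp_all add: linear_add[OF Q_linear] linear_cmul[OF Q_linear])

lemma bounded_linear_Q: "bounded_linear (Q i)"
  using Q_linear linear_conv_bounded_linear by blast

lemma Q_skew: "x \<in> V \<Longrightarrow> y \<in> V \<Longrightarrow> Q i x \<bullet> y = - (x \<bullet> Q i y)"
  using Q_orthogonal[of "x + y" i] Q_orthogonal[of x i] Q_orthogonal[of y i] subspace_add[OF subspace_V]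
  by (auto simp: Q_add inner_add inner_commute)

lemma Q_inner: "x \<in> V \<Longrightarrow> Q i x \<bullet> Q j x = (if i = j then x \<bullet> x else 0)"
proof -
  assume x: "x \<in> V"
  have "Q i x \<bullet> Q j x + Q j x \<bullet> Q i x = - (x \<bullet> (Q i (Q j x) + Q j (Q i x)))"
    using x Q_in_V by (simp add: Q_skew inner_add_right)
  then show ?thesis
    unfolding Q_clifford[OF x] by (auto simp: inner_commute split: if_splits)
qed

lemma Q_norm: "x \<in> V \<Longrightarrow> norm (Q i x) = norm x"
  by (simp add: norm_eq_sqrt_inner Q_inner)

lemma Q_square: "x \<in> V \<Longrightarrow> Q i (Q i x) = - x"
proof -
  assume "x \<in> V"
  then have "(2::real) *\<^sub>R Q i (Q i x) = (2::real) *\<^sub>R (- x)"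
    using Q_clifford[of x i i] by (simp add: scaleR_2)
  then show ?thesis by (simp only: real_vector.scale_cancel_left) simp
qed

text \<open>An orthonormal basis of \<open>V\<close>, with one vector singled out: \<open>n\<close> will be a pole or a unit normal of
  the sphere.\<close>

definition frame :: "'a \<Rightarrow> (3 \<Rightarrow> 'a) \<Rightarrow> bool" where
  "frame n e \<longleftrightarrow> n \<in> V \<and> n \<bullet> n = 1 \<and> (\<forall>i. e i \<in> V \<and> e i \<bullet> n = 0) \<and>
     (\<forall>i j. e i \<bullet> e j = (if i = j then 1 else 0))"

lemma frame_Q: "n \<in> V \<Longrightarrow> norm n = 1 \<Longrightarrow> frame n (\<lambda>i. Q i n)"
  by (auto simp: frame_def Q_in_V Q_orthogonal Q_inner norm_eq_1)

lemma frame_uminus: "frame n e \<Longrightarrow> frame (- n) e"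
  using subspace_neg[OF subspace_V] by (auto simp: frame_def)

lemma frame_full:
  assumes "frame n e"
  shows "finite (UNIV :: 3 option set)" "card (UNIV :: 3 option set) = dim V"
    "\<And>i. i \<in> UNIV \<Longrightarrow> case_option n e i \<in> V"
    "\<And>i j. i \<in> UNIV \<Longrightarrow> j \<in> UNIV \<Longrightarrow> case_option n e i \<bullet> case_option n e j = (if i = j then 1 else 0)"
  using assms by (auto simp: frame_def dim_V inner_commute split: option.split)

lemma sum_option: "(\<Sum>i\<in>UNIV. f (i :: 3 option)) = f None + (\<Sum>i\<in>UNIV. f (Some i) :: 'b::comm_monoid_add)"
proof -
  have "(\<Sum>i\<in>UNIV. f i) = (\<Sum>i\<in>insert None (range Some). f i)"
    by (rule sum.cong[OF UNIV_option_conv refl])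
  also have "\<dots> = f None + (\<Sum>i\<in>range Some. f i)"
    by (rule sum.insert) auto
  also have "(\<Sum>i\<in>range Some. f i) = (\<Sum>i\<in>UNIV. f (Some i))"
    by (simp add: sum.reindex o_def)
  finally show ?thesis .
qed

lemma frame_expansion:
  assumes "frame n e" "v \<in> V"
  shows "v = (v \<bullet> n) *\<^sub>R n + (\<Sum>i\<in>UNIV. (v \<bullet> e i) *\<^sub>R e i)"
  by (rule orthonormal_expansion[OF subspace_V frame_full[OF assms(1)] assms(2), unfolded sum_option option.case])

lemma frame_parseval:
  assumes "frame n e" "v \<in> V"
  shows "v \<bullet> w = (v \<bullet> n) * (w \<bullet> n) + (\<Sum>i\<in>UNIV. (v \<bullet> e i) * (w \<bullet> e i))"
  by (rule orthonormal_parseval[OF subspace_V frame_full[OF assms(1)] assms(2), unfolded sum_option option.case])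

lemma exists_frame: obtains n e where "frame n e"
proof -
  obtain x where "x \<in> V" "x \<noteq> 0"
    using dim_V dim_eq_0[of V] by auto
  then have "frame (x /\<^sub>R norm x) (\<lambda>i. Q i (x /\<^sub>R norm x))"
    by (intro frame_Q subspace_mul[OF subspace_V]) auto
  then show ?thesis by (rule that)
qed

subsection \<open>Mean curvature\<close>

lemma dim_tangent: "p \<in> M \<Longrightarrow> dim (tangent_space M p) = 3"
proof -
  assume p: "p \<in> M"
  have eq: "tangent_space M p = {y \<in> V. \<forall>x \<in> span {p - c}. orthogonal x y}"
    unfolding tangent_space_M[OF p] span_singleton by (auto simp: orthogonal_def inner_commute)
  have "p - c \<noteq> 0" using p r_pos by (auto simp: mem_M)
  then have "dim (span {p - c}) = 1" by (simp add: dim_singleton)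
  moreover have "span {p - c} \<subseteq> V"
    using p subspace_V by (simp add: mem_M span_minimal)
  ultimately show ?thesis
    using dim_subspace_orthogonal_to_vectors[OF subspace_span subspace_V, of "{p - c}"] eq dim_V by simp
qed

lemma orthonormal_frame_M:
  assumes "p \<in> M" "orthonormal_frame M p es" "v \<in> tangent_space M p"
  shows "v = (\<Sum>i<3. (v \<bullet> es ! i) *\<^sub>R es ! i)" "v \<bullet> w = (\<Sum>i<3. (v \<bullet> es ! i) * (w \<bullet> es ! i))"
proof -
  have 1: "card {..<3::nat} = dim (tangent_space M p)" "\<And>i. i \<in> {..<3} \<Longrightarrow> es ! i \<in> tangent_space M p"
    "\<And>i j. i \<in> {..<3} \<Longrightarrow> j \<in> {..<3} \<Longrightarrow> es ! i \<bullet> es ! j = (if i = j then 1 else 0)"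
    using assms(2) by (auto simp: dim_tangent[OF assms(1)] orthonormal_frame_def subset_eq)
  show "v = (\<Sum>i<3. (v \<bullet> es ! i) *\<^sub>R es ! i)"
    by (rule orthonormal_expansion[OF subspace_tangent[OF assms(1)] finite_lessThan 1 assms(3)])
  show "v \<bullet> w = (\<Sum>i<3. (v \<bullet> es ! i) * (w \<bullet> es ! i))"
    by (rule orthonormal_parseval[OF subspace_tangent[OF assms(1)] finite_lessThan 1 assms(3)])
qed

lemma Q_tangent: "p \<in> M \<Longrightarrow> Q i (p - c) \<in> tangent_space M p"
  by (simp add: tangent_space_M mem_M Q_in_V Q_orthogonal)

lemma radius_frame: "p \<in> M \<Longrightarrow> frame ((p - c) /\<^sub>R r) (\<lambda>i. Q i (p - c) /\<^sub>R r)"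
  using frame_Q[of "(p - c) /\<^sub>R r"] r_pos subspace_mul[OF subspace_V]
  by (auto simp: mem_M Q_scaleR)

lemma mean_curvature_M:
  assumes p: "p \<in> M"
  shows "mean_curvature M p = (- 1 / r\<^sup>2) *\<^sub>R (p - c)"
proof -
  have on: "(1/3) *\<^sub>R (\<Sum>i<3. second_ff M p (es ! i) (es ! i)) = (- 1 / r\<^sup>2) *\<^sub>R (p - c)"
    if "orthonormal_frame M p es" for es
  proof -
    have "second_ff M p (es ! i) (es ! i) = (- 1 / r\<^sup>2) *\<^sub>R (p - c)" if "i < 3" for i
      using that \<open>orthonormal_frame M p es\<close> by (subst second_ff_M[OF p]) (auto simp: orthonormal_frame_def subset_eq)
    then have "(\<Sum>i<3. second_ff M p (es ! i) (es ! i)) = (\<Sum>i<3::nat. (- 1 / r\<^sup>2) *\<^sub>R (p - c))"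
      by (intro sum.cong) auto
    also have "\<dots> = 3 *\<^sub>R ((- 1 / r\<^sup>2) *\<^sub>R (p - c))"
      by (simp add: scaleR_conv_of_real del: scaleR_scaleR) (simp add: sum_constant_scaleR)
    finally show ?thesis by simp
  qed
  let ?es = "map (\<lambda>i. Q i (p - c) /\<^sub>R r) [1, 2, 3]"
  have ex: "orthonormal_frame M p ?es"
  proof -
    have "frame ((p - c) /\<^sub>R r) (\<lambda>i. Q i (p - c) /\<^sub>R r)" by (rule radius_frame[OF p])
    then have "(Q i (p - c) /\<^sub>R r) \<bullet> (Q j (p - c) /\<^sub>R r) = (if i = j then 1 else 0)" for i j
      unfolding frame_def by blast
    moreover have "Q i (p - c) /\<^sub>R r \<in> tangent_space M p" for i
      using subspace_mul[OF subspace_tangent[OF p] Q_tangent[OF p]] .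
    ultimately show ?thesis
      unfolding orthonormal_frame_def by (auto simp: less_Suc_eq numeral_3_eq_3 simp del: inner_scaleR_left inner_scaleR_right)
  qed
  show ?thesis
    unfolding mean_curvature_def
  proof (rule the_equality)
    fix h assume "\<forall>es. orthonormal_frame M p es \<longrightarrow> h = (1 / 3) *\<^sub>R (\<Sum>i<3. second_ff M p (es ! i) (es ! i))"
    then show "h = (- 1 / r\<^sup>2) *\<^sub>R (p - c)" using ex on by metis
  qed (use on in auto)
qed

lemma norm_mean_curvature: "p \<in> M \<Longrightarrow> norm (mean_curvature M p) = 1 / r"
  using r_pos by (simp add: mean_curvature_M mem_M power2_eq_square)

lemma unit_mean_curvature_M: "p \<in> M \<Longrightarrow> unit_mean_curvature M p = (- 1 / r) *\<^sub>R (p - c)"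
  unfolding unit_mean_curvature_def using r_pos
  by (simp add: norm_mean_curvature) (simp add: mean_curvature_M power2_eq_square)

lemma nonzero_mean_curvature_M: "nonzero_mean_curvature M"
  unfolding nonzero_mean_curvature_def using norm_mean_curvature r_pos by force

lemma parallel_mean_curvature_M: "parallel_mean_curvature M"
  unfolding parallel_mean_curvature_def
proof (intro ballI)
  fix p v assume p: "p \<in> M" and v: "v \<in> tangent_space M p"
  have "((\<lambda>x. (- 1 / r\<^sup>2) *\<^sub>R (x - c)) has_derivative (\<lambda>h. (- 1 / r\<^sup>2) *\<^sub>R h)) (at p)"
    by (auto intro!: derivative_eq_intros)
  then have "tderiv M (mean_curvature M) p v = (- 1 / r\<^sup>2) *\<^sub>R v"
    using p by (intro tderiv_local[OF v _ open_UNIV]) (auto simp: mean_curvature_M)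
  then show "normal_connection M (mean_curvature M) p v = 0"
    unfolding normal_connection_def
    using p v subspace_V
    by (subst normal_part_in_V) (auto simp: tangent_space_M intro: subspace_mul subspace_neg)
qed

end

section \<open>The Riemannian measure of the sphere\<close>

lemma gram_density_eq_det:
  fixes \<psi> :: "real^3 \<Rightarrow> 'a::euclidean_space" and B :: "real^3 \<Rightarrow> real^3"
  assumes "linear B"
    and "\<And>h h'. frechet_derivative \<psi> (at x) h \<bullet> frechet_derivative \<psi> (at x) h' = B h \<bullet> B h'"
  shows "gram_density \<psi> x = \<bar>det (matrix B)\<bar>"
proof -
  have "(\<chi> i j. frechet_derivative \<psi> (at x) (axis i 1) \<bullet> frechet_derivative \<psi> (at x) (axis j 1)) =
      transpose (matrix B) ** matrix B"
    unfolding assms(2) by (simp add: vec_eq_iff transpose_def matrix_matrix_mult_def matrix_def inner_vec_def)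
  then show ?thesis
    by (simp add: gram_density_def det_mul det_transpose)
qed

lemma det_matrix_scaleR_comp:
  assumes "linear (B :: real^3 \<Rightarrow> real^3)"
  shows "det (matrix (\<lambda>h. s *\<^sub>R B h)) = s ^ 3 * det (matrix B)"
proof -
  have "matrix (\<lambda>h. s *\<^sub>R B h) = matrix ((*\<^sub>R) s) ** matrix B"
    using matrix_compose[OF assms, of "(*\<^sub>R) s"] by (simp add: o_def linear_scaleR)
  moreover have "det (matrix ((*\<^sub>R) s) :: real^3^3) = s ^ 3"
    using det_matrix_scaleR[where 'n = 3] by simp
  ultimately show ?thesis by (simp add: det_mul)
qed

lemma continuous_on_gram_density:
  assumes "smooth_on U (\<psi> :: real^3 \<Rightarrow> 'a::euclidean_space)"
  shows "continuous_on U (gram_density \<psi>)"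
  unfolding gram_density_def[abs_def] det_3
  by (auto intro!: continuous_intros smooth_on_imp_continuous[OF smooth_on_frechet[OF assms]])

context quaternionic_sphere
begin

text \<open>The inverse stereographic projection from the pole \<open>c + r n\<close>, in the coordinates of \<open>n\<^sup>\<bottom>\<close> given by
  \<open>e\<close>; \<open>r * conf y\<close> is its conformal factor at \<open>y\<close>.\<close>

definition conf :: "real^3 \<Rightarrow> real" where "conf y = 2 / (1 + y \<bullet> y)"

definition vec_in :: "(3 \<Rightarrow> 'a) \<Rightarrow> real^3 \<Rightarrow> 'a" where "vec_in e y = (\<Sum>i\<in>UNIV. y $ i *\<^sub>R e i)"

definition stereo :: "'a \<Rightarrow> (3 \<Rightarrow> 'a) \<Rightarrow> real^3 \<Rightarrow> 'a" where
  "stereo n e y = c + r *\<^sub>R (n + conf y *\<^sub>R (vec_in e y - n))"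

definition unstereo :: "'a \<Rightarrow> (3 \<Rightarrow> 'a) \<Rightarrow> 'a \<Rightarrow> real^3" where
  "unstereo n e x = inverse (r - (x - c) \<bullet> n) *\<^sub>R (\<chi> i. (x - c) \<bullet> e i)"

lemma conf_pos: "conf y > 0" and conf_eq: "conf y * (1 + y \<bullet> y) = 2" and conf_le: "conf y \<le> 2"
proof -
  have p: "1 + y \<bullet> y > 0" using inner_ge_zero[of y] by linarith
  then have nz: "1 + y \<bullet> y \<noteq> 0" by simp
  show "conf y > 0" using p by (auto simp: conf_def)
  show "conf y * (1 + y \<bullet> y) = 2"
    unfolding conf_def times_divide_eq_left by (rule nonzero_mult_div_cancel_right[OF nz])
  show "conf y \<le> 2" using p by (simp add: conf_def divide_le_eq)
qed

lemma linear_vec_in: "linear (vec_in e)"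
  unfolding vec_in_def[abs_def]
  by (rule linearI) (simp_all add: scaleR_left_distrib sum.distrib scaleR_sum_right)

lemma bounded_linear_vec_in: "bounded_linear (vec_in e)"
  using linear_vec_in linear_conv_bounded_linear by blast

lemma vec_in_frame:
  assumes "frame n e"
  shows "vec_in e y \<in> V" "vec_in e y \<bullet> n = 0" "vec_in e y \<bullet> e i = y $ i" "vec_in e y \<bullet> vec_in e z = y \<bullet> z"
proof -
  show "vec_in e y \<in> V"
    using assms subspace_V by (auto simp: vec_in_def frame_def intro!: subspace_sum subspace_mul)
  show "vec_in e y \<bullet> n = 0"
    using assms by (simp add: vec_in_def frame_def inner_sum_left)
  show ei: "vec_in e y \<bullet> e i = y $ i" for y i
    using assms by (simp add: vec_in_def frame_def inner_sum_left if_distrib[of "(*) _"] cong: if_cong)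
  have "vec_in e y \<bullet> vec_in e z = (\<Sum>i\<in>UNIV. z $ i * (vec_in e y \<bullet> e i))"
    unfolding vec_in_def[of e z] by (simp add: inner_sum_right)
  then show "vec_in e y \<bullet> vec_in e z = y \<bullet> z"
    by (simp add: ei inner_vec_def mult.commute)
qed

lemma stereo_inner:
  assumes "frame n e"
  shows "(stereo n e y - c) \<bullet> n = r * (1 - conf y)" "(stereo n e y - c) \<bullet> e i = r * conf y * y $ i"
proof -
  have "n \<bullet> n = 1" "n \<bullet> e i = 0" using assms by (auto simp: frame_def inner_commute)
  then show "(stereo n e y - c) \<bullet> n = r * (1 - conf y)" "(stereo n e y - c) \<bullet> e i = r * conf y * y $ i"
    using vec_in_frame[OF assms]
    by (simp_all add: stereo_def inner_add_left inner_diff_left algebra_simps)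
qed

lemma stereo_in_M: "frame n e \<Longrightarrow> stereo n e y \<in> M"
proof -
  assume f: "frame n e"
  have n: "n \<in> V" "n \<bullet> n = 1" using f by (auto simp: frame_def)
  have y: "vec_in e y \<bullet> n = 0" "n \<bullet> vec_in e y = 0" using vec_in_frame[OF f] by (auto simp: inner_commute)
  let ?w = "n + conf y *\<^sub>R (vec_in e y - n)"
  have inV: "?w \<in> V"
    using n vec_in_frame(1)[OF f] subspace_V by (intro subspace_add subspace_mul subspace_diff) auto
  have "?w \<bullet> ?w = 1 - 2 * conf y + conf y * (conf y * (1 + y \<bullet> y))"
    using n y vec_in_frame(4)[OF f, of y y]
    by (simp add: inner_add inner_diff algebra_simps)
  also have "\<dots> = 1" by (simp add: conf_eq)
  finally have "norm ?w = 1" by (simp add: norm_eq_1)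
  then show ?thesis
    using inV r_pos subspace_V by (simp add: mem_M stereo_def subspace_mul)
qed

lemma stereo_ne_pole: "frame n e \<Longrightarrow> stereo n e y \<noteq> c + r *\<^sub>R n"
  using stereo_inner(1)[of n e y] conf_pos[of y] r_pos by (auto simp: frame_def)

lemma unstereo_stereo: "frame n e \<Longrightarrow> unstereo n e (stereo n e y) = y"
proof -
  assume f: "frame n e"
  have "r - (stereo n e y - c) \<bullet> n = r * conf y"
    using stereo_inner[OF f] by (simp add: algebra_simps)
  then show ?thesis
    using conf_pos[of y] r_pos by (simp add: unstereo_def stereo_inner[OF f] vec_eq_iff field_simps)
qed

lemma away_from_pole:
  assumes "frame n e" "x \<in> M" "x \<noteq> c + r *\<^sub>R n"
  shows "(x - c) \<bullet> n < r"
proof -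
  have n: "n \<bullet> n = 1" using assms by (auto simp: frame_def)
  define d where "d = x - c"
  have "d - r *\<^sub>R n \<noteq> 0"
    using assms(3) by (auto simp: d_def algebra_simps)
  then have "0 < (d - r *\<^sub>R n) \<bullet> (d - r *\<^sub>R n)" by simp
  also have "\<dots> = 2 * r * (r - d \<bullet> n)"
    using inner_radius[OF assms(2)] n
    by (simp add: d_def[symmetric] inner_diff inner_commute[of n d] power2_eq_square algebra_simps)
  finally show ?thesis using r_pos by (simp add: zero_less_mult_iff d_def)
qed

lemma stereo_unstereo:
  assumes f: "frame n e" and x: "x \<in> M" and np: "x \<noteq> c + r *\<^sub>R n"
  shows "stereo n e (unstereo n e x) = x"
proof -
  define a where "a = (x - c) \<bullet> n"
  define b where "b i = (x - c) \<bullet> e i" for i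
  define w where "w = (\<Sum>i\<in>UNIV. b i *\<^sub>R e i)"
  define y where "y = unstereo n e x"
  have ar: "r - a > 0" using away_from_pole[OF assms] by (simp add: a_def)
  have x': "x - c = a *\<^sub>R n + w"
    using frame_expansion[OF f, of "x - c"] x unfolding mem_M a_def b_def w_def by blast
  have "r\<^sup>2 = a * a + (\<Sum>i\<in>UNIV. b i * b i)"
    using frame_parseval[OF f, of "x - c" "x - c"] x inner_radius[OF x] unfolding mem_M a_def b_def by metis
  then have bb: "(\<Sum>i\<in>UNIV. b i * b i) = (r - a) * (r + a)"
    by (simp add: power2_eq_square algebra_simps)
  have yi: "y $ i = b i / (r - a)" for i
    by (simp add: y_def unstereo_def a_def b_def divide_inverse_commute)
  have "y \<bullet> y = (\<Sum>i\<in>UNIV. b i * b i) / (r - a)\<^sup>2"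
    by (simp add: inner_vec_def yi sum_divide_distrib power2_eq_square)
  then have "y \<bullet> y = (r + a) / (r - a)"
    using ar by (simp add: bb power2_eq_square)
  then have "1 + y \<bullet> y = 2 * r / (r - a)"
    using ar by (simp add: field_simps)
  then have "conf y = 2 / (2 * r / (r - a))" by (simp add: conf_def)
  also have "\<dots> = (r - a) / r" using ar r_pos by (simp add: field_simps)
  finally have cf: "conf y = (r - a) / r" .
  have vy: "vec_in e y = (1 / (r - a)) *\<^sub>R w"
    by (simp add: vec_in_def w_def yi scaleR_sum_right divide_inverse_commute)
  have "stereo n e y = c + r *\<^sub>R n + (r - a) *\<^sub>R (vec_in e y - n)"
    using r_pos by (simp add: stereo_def cf scaleR_add_right)
  also have "\<dots> = c + (a *\<^sub>R n + w)"
    using ar by (simp add: vy scaleR_diff_right scaleR_diff_left)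
  also have "\<dots> = x" using x' by (simp add: algebra_simps)
  finally show ?thesis by (simp add: y_def)
qed

lemma range_stereo: "frame n e \<Longrightarrow> range (stereo n e) = M - {c + r *\<^sub>R n}"
proof (intro equalityI subsetI)
  assume f: "frame n e"
  show "x \<in> M - {c + r *\<^sub>R n}" if "x \<in> range (stereo n e)" for x
    using that stereo_in_M[OF f] stereo_ne_pole[OF f] by auto
  show "x \<in> range (stereo n e)" if "x \<in> M - {c + r *\<^sub>R n}" for x
    using that stereo_unstereo[OF f, of x, symmetric] by (intro range_eqI) auto
qed

lemma has_derivative_conf: "(conf has_derivative (\<lambda>h. - ((conf y)\<^sup>2 * (y \<bullet> h)))) (at y)"
proof -
  have nz: "1 + y \<bullet> y \<noteq> 0" using conf_eq[of y] by auto
  have "((\<lambda>y. 2 * inverse (1 + y \<bullet> y)) has_derivative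
      (\<lambda>h. 2 * (- (inverse (1 + y \<bullet> y) * (2 * (y \<bullet> h)) * inverse (1 + y \<bullet> y))))) (at y)"
    using nz by (auto intro!: derivative_eq_intros simp: inner_commute)
  then show ?thesis
    by (simp add: conf_def[abs_def] divide_inverse power2_eq_square mult_ac)
qed

definition stereo_deriv :: "'a \<Rightarrow> (3 \<Rightarrow> 'a) \<Rightarrow> real^3 \<Rightarrow> real^3 \<Rightarrow> 'a" where
  "stereo_deriv n e y h = r *\<^sub>R (conf y *\<^sub>R vec_in e h - ((conf y)\<^sup>2 * (y \<bullet> h)) *\<^sub>R (vec_in e y - n))"

lemma has_derivative_stereo: "(stereo n e has_derivative stereo_deriv n e y) (at y)"
proof -
  have "((\<lambda>y. c + r *\<^sub>R (n + conf y *\<^sub>R (vec_in e y - n))) has_derivative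
     (\<lambda>h. r *\<^sub>R (conf y *\<^sub>R vec_in e h + (- ((conf y)\<^sup>2 * (y \<bullet> h))) *\<^sub>R (vec_in e y - n)))) (at y)"
    by (auto intro!: derivative_eq_intros has_derivative_conf
        bounded_linear_imp_has_derivative[OF bounded_linear_vec_in])
  then show ?thesis
    by (simp add: stereo_def[abs_def] stereo_deriv_def[abs_def])
qed

text \<open>The terms that contain \<open>y \<bullet> h\<close> cancel by \<open>conf_eq\<close>. Thus stereographic projection is conformal, and
  its density depends on \<open>y\<close> but not on the frame.\<close>

lemma stereo_deriv_inner:
  assumes f: "frame n e"
  shows "stereo_deriv n e y h \<bullet> stereo_deriv n e y h' = ((r * conf y) *\<^sub>R h) \<bullet> ((r * conf y) *\<^sub>R h')"
proof -
  have n: "n \<bullet> n = 1" "n \<bullet> vec_in e z = 0" for z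
    using f vec_in_frame(2)[OF f] by (auto simp: frame_def inner_commute)
  let ?k = "conf y"
  have "(?k *\<^sub>R vec_in e h - (?k\<^sup>2 * (y \<bullet> h)) *\<^sub>R (vec_in e y - n)) \<bullet> (?k *\<^sub>R vec_in e h' - (?k\<^sup>2 * (y \<bullet> h')) *\<^sub>R (vec_in e y - n))
    = ?k\<^sup>2 * (h \<bullet> h') - 2 * (?k * ?k\<^sup>2 * (y \<bullet> h) * (y \<bullet> h')) + ?k\<^sup>2 * (y \<bullet> h) * (y \<bullet> h') * (?k * (?k * (1 + y \<bullet> y)))"
    using n vec_in_frame(2,4)[OF f]
    by (simp add: inner_diff inner_commute[of h y] inner_commute[of h' y] power2_eq_square algebra_simps)
  also have "\<dots> = ?k\<^sup>2 * (h \<bullet> h')"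
    by (simp add: conf_eq)
  finally show ?thesis
    by (simp add: stereo_deriv_def power2_eq_square)
qed

lemma smooth_stereo: "smooth_on UNIV (stereo n e)"
proof -
  have nz: "1 + y \<bullet> y \<noteq> 0" for y :: "real^3" using conf_eq[of y] by auto
  have "smooth_on UNIV conf"
    unfolding conf_def[abs_def] divide_inverse
    by (intro smooth_on_mult smooth_on_const smooth_on_inverse smooth_on_add smooth_on_inner smooth_on_id nz) auto
  then show ?thesis
    unfolding stereo_def[abs_def]
    by (intro smooth_on_add smooth_on_const smooth_on_scaleR smooth_on_diff smooth_on_id
        smooth_on_compose_linear[OF bounded_linear_vec_in]) auto
qed

lemma differentiable_unstereo:
  assumes "(x - c) \<bullet> n \<noteq> r"
  shows "unstereo n e differentiable (at x)"
proof -
  have l: "linear (\<lambda>h. (\<chi> i. h \<bullet> e i) :: real^3)"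
    by (rule linearI) (auto simp: vec_eq_iff inner_add_left)
  have "((\<lambda>x. x - c) has_derivative (\<lambda>h. h)) (at x)"
    by (auto intro!: derivative_eq_intros)
  from has_derivative_compose[OF this linear_imp_has_derivative[OF l]]
  have "(\<lambda>x. (\<chi> i. (x - c) \<bullet> e i) :: real^3) differentiable (at x)"
    by (rule differentiableI)
  moreover have "(\<lambda>x. inverse (r - (x - c) \<bullet> n)) differentiable (at x)"
    using assms by (auto intro!: derivative_intros simp: differentiable_def intro!: exI derivative_eq_intros)
  ultimately show ?thesis
    unfolding unstereo_def[abs_def] by (rule differentiable_scaleR[rotated])
qed

lemma continuous_on_unstereo: "frame n e \<Longrightarrow> continuous_on (M - {c + r *\<^sub>R n}) (unstereo n e)"
  using away_from_pole differentiable_unstereo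
  by (intro continuous_at_imp_continuous_on ballI differentiable_imp_continuous_within) fastforce

lemma frechet_stereo: "frechet_derivative (stereo n e) (at y) = stereo_deriv n e y"
  using frechet_derivative_at[OF has_derivative_stereo] by simp

lemma local_param_stereo:
  assumes f: "frame n e"
  shows "local_param M UNIV (stereo n e)"
  unfolding local_param_def
proof (intro conjI ballI)
  show "openin (top_of_set M) (range (stereo n e))"
    unfolding range_stereo[OF f] by (metis Diff_eq open_Compl closed_singleton openin_open_Int)
  have "homeomorphism UNIV (range (stereo n e)) (stereo n e) (unstereo n e)"
  proof (rule homeomorphismI)
    show "continuous_on (range (stereo n e)) (unstereo n e)"
      unfolding range_stereo[OF f] by (rule continuous_on_unstereo[OF f])
  qed (auto simp: smooth_on_imp_continuous[OF smooth_stereo] unstereo_stereo[OF f])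
  then show "\<exists>\<phi>. homeomorphism UNIV (range (stereo n e)) (stereo n e) \<phi>"
    by (intro exI[of _ "unstereo n e"])
  show "inj (frechet_derivative (stereo n e) (at y))" for y
  proof -
    have l: "linear (stereo_deriv n e y)"
      using has_derivative_stereo has_derivative_linear by blast
    have "h = 0" if "stereo_deriv n e y h = 0" for h
      using stereo_deriv_inner[OF f, of y h h] that r_pos conf_pos[of y] by auto
    then show ?thesis
      unfolding frechet_stereo using linear_injective_0[OF l] by blast
  qed
qed (auto simp: smooth_stereo)

lemma closed_submanifold3_M: "closed_submanifold3 M"
  unfolding closed_submanifold3_def submanifold3_def
proof (intro conjI ballI)
  fix p assume p: "p \<in> M"
  let ?n = "- ((p - c) /\<^sub>R r)"
  have f: "frame ?n (\<lambda>i. Q i (p - c) /\<^sub>R r)" using radius_frame[OF p] by (rule frame_uminus)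
  have nz: "p - c \<noteq> 0" using p r_pos by (auto simp: mem_M)
  have "p \<noteq> c + r *\<^sub>R ?n"
  proof
    assume "p = c + r *\<^sub>R ?n"
    then have "p - c = - (p - c)" using r_pos by (metis add_diff_cancel_left' divideR_right less_irrefl scaleR_minus_right)
    then have "2 *\<^sub>R (p - c) = 0" by (metis add.right_inverse scaleR_2)
    then show False using nz by simp
  qed
  then have "p \<in> range (stereo ?n (\<lambda>i. Q i (p - c) /\<^sub>R r))"
    using range_stereo[OF f] p by blast
  then show "\<exists>U \<psi>. local_param M U \<psi> \<and> p \<in> \<psi> ` U"
    using local_param_stereo[OF f] by blast
qed (rule compact_M)

end

lemma local_paramD:
  assumes "local_param M U \<psi>"
  shows "open U" "smooth_on U \<psi>" "inj_on \<psi> U" "x \<in> U \<Longrightarrow> \<psi> x \<in> M"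
proof -
  obtain \<phi> where \<phi>: "homeomorphism U (\<psi> ` U) \<psi> \<phi>" using assms unfolding local_param_def by blast
  show "inj_on \<psi> U" using homeomorphism_apply1[OF \<phi>] by (rule inj_on_inverseI)
  show "open U" "smooth_on U \<psi>" using assms by (simp_all add: local_param_def)
  have "openin (top_of_set M) (\<psi> ` U)" using assms by (simp add: local_param_def)
  then show "x \<in> U \<Longrightarrow> \<psi> x \<in> M" using openin_imp_subset by blast
qed

context quaternionic_sphere
begin

lemma closed_M: "closed M"
  using compact_M by (rule compact_imp_closed)

lemma sets_borel_M: "A \<in> sets (restrict_space borel M) \<longleftrightarrow> A \<in> sets borel \<and> A \<subseteq> M"
  using closed_M by (subst sets_restrict_space_iff) (auto intro: borel_closed)

lemma continuous_on_stereo: "continuous_on S (stereo n e)"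
  using continuous_on_subset[OF smooth_on_imp_continuous[OF smooth_stereo]] by auto

lemma measurable_stereo: "frame n e \<Longrightarrow> stereo n e \<in> borel \<rightarrow>\<^sub>M restrict_space borel M"
  using stereo_in_M by (intro measurable_restrict_space2 borel_measurable_continuous_onI continuous_on_stereo) auto

lemma vimage_stereo_borel: "frame n e \<Longrightarrow> A \<in> sets (restrict_space borel M) \<Longrightarrow> stereo n e -` A \<in> sets borel"
  using measurable_sets[OF measurable_stereo] by fastforce

definition density_stereo :: "real^3 \<Rightarrow> real" where "density_stereo y = (r * conf y) ^ 3"

lemma density_stereo_nonneg: "0 \<le> density_stereo y"
  and density_stereo_le: "density_stereo y \<le> (r * 2) ^ 3"
proof -
  have "0 \<le> r * conf y" "r * conf y \<le> r * 2"
    using conf_pos[of y] conf_le[of y] r_pos by auto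
  then show "0 \<le> density_stereo y"
    unfolding density_stereo_def by (intro zero_le_power)
  show "density_stereo y \<le> (r * 2) ^ 3"
    unfolding density_stereo_def by (rule power_mono) fact+
qed

lemma continuous_on_density_stereo: "continuous_on S density_stereo"
proof -
  have "1 + y \<bullet> y \<noteq> 0" for y :: "real^3" using conf_eq[of y] by auto
  then show ?thesis
    unfolding density_stereo_def[abs_def] conf_def by (intro continuous_intros) auto
qed

lemma borel_measurable_density_stereo: "density_stereo \<in> borel_measurable borel"
  by (rule borel_measurable_continuous_onI[OF continuous_on_density_stereo])

text \<open>Away from the pole, a parametrization \<open>\<psi>\<close> is the stereographic one composed with the
  transition map \<open>unstereo \<circ> \<psi>\<close> between open sets of \<open>\<real>\<^sup>3\<close>, and the chain rule relates the two
  densities by the Jacobian determinant.\<close>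

lemma gram_density_transition:
  assumes f: "frame n e" and \<psi>: "local_param M U \<psi>" and x: "x \<in> U" "\<psi> x \<noteq> c + r *\<^sub>R n"
  defines "\<tau> \<equiv> unstereo n e \<circ> \<psi>"
  shows "(\<tau> has_derivative frechet_derivative \<tau> (at x)) (at x)"
    and "gram_density \<psi> x = \<bar>det (matrix (frechet_derivative \<tau> (at x)))\<bar> * density_stereo (\<tau> x)"
proof -
  note U = local_paramD(1,2)[OF \<psi>] and in_M = local_paramD(4)[OF \<psi>]
  have d\<psi>: "(\<psi> has_derivative frechet_derivative \<psi> (at x)) (at x)"
    by (rule smooth_onD_diff[OF U(2) x(1)])
  have "unstereo n e differentiable (at (\<psi> x))"
    using away_from_pole[OF f in_M[OF x(1)] x(2)] by (intro differentiable_unstereo) auto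
  then have "\<tau> differentiable (at x)"
    unfolding \<tau>_def using d\<psi> by (intro differentiable_chain_at) (auto simp: differentiable_def)
  then show d\<tau>: "(\<tau> has_derivative frechet_derivative \<tau> (at x)) (at x)"
    by (simp add: frechet_derivative_works)
  define B where "B = frechet_derivative \<tau> (at x)"
  have lB: "linear B" using d\<tau> has_derivative_linear B_def by blast
  obtain d where d: "d > 0" "\<And>y. dist y x < d \<Longrightarrow> y \<in> U \<and> \<psi> y \<noteq> c + r *\<^sub>R n"
  proof -
    have "open (U \<inter> \<psi> -` (- {c + r *\<^sub>R n}))"
      using continuous_open_preimage[OF smooth_on_imp_continuous[OF U(2)] U(1)] by auto
    moreover have "x \<in> U \<inter> \<psi> -` (- {c + r *\<^sub>R n})" using x by auto
    ultimately show ?thesis using that unfolding open_dist by blast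
  qed
  have "((stereo n e \<circ> \<tau>) has_derivative (stereo_deriv n e (\<tau> x) \<circ> B)) (at x)"
    unfolding B_def by (rule diff_chain_at[OF d\<tau> has_derivative_stereo])
  then have "(\<psi> has_derivative (stereo_deriv n e (\<tau> x) \<circ> B)) (at x)"
    by (rule has_derivative_transform_within[OF _ d(1)])
      (use d(2) in_M stereo_unstereo[OF f] in \<open>auto simp: \<tau>_def\<close>)
  then have "frechet_derivative \<psi> (at x) = stereo_deriv n e (\<tau> x) \<circ> B"
    using frechet_derivative_at by metis
  then have "gram_density \<psi> x = \<bar>det (matrix (\<lambda>h. (r * conf (\<tau> x)) *\<^sub>R B h))\<bar>"
    using lB by (intro gram_density_eq_det) (simp_all add: stereo_deriv_inner[OF f] linear_compose_scale_right)
  also have "\<dots> = \<bar>det (matrix B)\<bar> * density_stereo (\<tau> x)"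
    using conf_pos[of "\<tau> x"] r_pos
    by (simp add: det_matrix_scaleR_comp[OF lB] abs_mult density_stereo_def)
  finally show "gram_density \<psi> x = \<bar>det (matrix (frechet_derivative \<tau> (at x)))\<bar> * density_stereo (\<tau> x)"
    by (simp add: B_def)
qed

text \<open>The preimage of the pole under \<open>\<psi>\<close> has at most one point and does not contribute.\<close>

lemma nn_integral_chart:
  assumes f: "frame n e" and \<psi>: "local_param M U \<psi>"
    and A: "A \<in> sets (restrict_space borel M)" "A \<subseteq> \<psi> ` U"
  shows "(\<integral>\<^sup>+x\<in>U \<inter> \<psi> -` A. ennreal (gram_density \<psi> x) \<partial>lborel)
    = (\<integral>\<^sup>+y\<in>stereo n e -` A. ennreal (density_stereo y) \<partial>lborel)"
proof -
  note U = local_paramD(1,2)[OF \<psi>] and inj\<psi> = local_paramD(3)[OF \<psi>] and in_M = local_paramD(4)[OF \<psi>]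
  have A': "A \<in> sets borel" using A sets_borel_M by blast
  define \<tau> where "\<tau> = unstereo n e \<circ> \<psi>"
  define S where "S = U \<inter> \<psi> -` (A - {c + r *\<^sub>R n})"
  have m: "U \<inter> \<psi> -` X \<in> sets borel" if "X \<in> sets borel" for X
  proof -
    have "\<psi> -` X \<inter> space (restrict_space borel U) \<in> sets (restrict_space borel U)"
      using borel_measurable_continuous_on_restrict[OF smooth_on_imp_continuous[OF U(2)]] that
      by (rule measurable_sets)
    then show ?thesis
      using U by (auto simp: space_restrict_space sets_restrict_space_iff Int_commute)
  qed
  have Sb: "S \<in> sets borel" unfolding S_def using A' by (intro m) auto
  have SU: "x \<in> U" "\<psi> x \<noteq> c + r *\<^sub>R n" if "x \<in> S" for x using that by (auto simp: S_def)
  have st: "stereo n e (\<tau> x) = \<psi> x" if "x \<in> S" for x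
    using stereo_unstereo[OF f] in_M SU[OF that] by (simp add: \<tau>_def)
  have image: "\<tau> ` S = stereo n e -` A"
  proof (intro equalityI subsetI)
    fix y assume "y \<in> stereo n e -` A"
    then have "stereo n e y \<in> \<psi> ` U" using A(2) by blast
    then obtain x where x: "x \<in> U" "\<psi> x = stereo n e y" by force
    then have "x \<in> S" using \<open>y \<in> stereo n e -` A\<close> stereo_ne_pole[OF f, of y] by (auto simp: S_def)
    moreover have "y = \<tau> x" using x unstereo_stereo[OF f] by (simp add: \<tau>_def)
    ultimately show "y \<in> \<tau> ` S" by blast
  next
    fix y assume "y \<in> \<tau> ` S"
    then obtain x where "x \<in> S" "y = \<tau> x" by blast
    then have "stereo n e y = \<psi> x" "\<psi> x \<in> A" using st by (auto simp: S_def)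
    then show "y \<in> stereo n e -` A" by simp
  qed
  have inj: "inj_on \<tau> S"
    using st inj\<psi> SU by (intro inj_onI) (metis inj_onD)
  note gd = gram_density_transition[OF f \<psi>, folded \<tau>_def]
  let ?h = "\<lambda>x. \<bar>det (matrix (frechet_derivative \<tau> (at x)))\<bar> * density_stereo (\<tau> x)"
  have meas: "(\<lambda>x. ennreal (?h x) * indicator S x) \<in> borel_measurable borel"
  proof -
    have "(\<lambda>x. indicator U x *\<^sub>R gram_density \<psi> x) \<in> borel_measurable borel"
      using U continuous_on_gram_density[OF U(2)]
      by (intro borel_measurable_continuous_on_indicator) auto
    then have "(\<lambda>x. ennreal (indicator U x *\<^sub>R gram_density \<psi> x) * indicator S x) \<in> borel_measurable borel"
      using Sb by measurable
    moreover have "ennreal (indicator U x *\<^sub>R gram_density \<psi> x) * indicator S x = ennreal (?h x) * indicator S x" for x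
      using gd(2)[of x] SU[of x] by (auto simp: indicator_def)
    ultimately show ?thesis by simp
  qed
  have "(\<integral>\<^sup>+x\<in>U \<inter> \<psi> -` A. ennreal (gram_density \<psi> x) \<partial>lborel) = (\<integral>\<^sup>+x\<in>S. ennreal (?h x) \<partial>lborel)"
  proof (rule nn_integral_cong_AE)
    have "\<exists>a. U \<inter> \<psi> -` {c + r *\<^sub>R n} \<subseteq> {a}"
    proof (cases "\<exists>a\<in>U. \<psi> a = c + r *\<^sub>R n")
      case True
      then obtain a where a: "a \<in> U" "\<psi> a = c + r *\<^sub>R n" by blast
      have "x = a" if "x \<in> U" "\<psi> x = c + r *\<^sub>R n" for x
        using inj_onD[OF inj\<psi>, of x a] that a by simp
      then have "U \<inter> \<psi> -` {c + r *\<^sub>R n} \<subseteq> {a}" by auto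
      then show ?thesis by (rule exI)
    qed auto
    then obtain a where a: "U \<inter> \<psi> -` {c + r *\<^sub>R n} \<subseteq> {a}" by blast
    have "AE x in lborel. x \<noteq> a" by (rule AE_lborel_singleton)
    then show "AE x in lborel. ennreal (gram_density \<psi> x) * indicator (U \<inter> \<psi> -` A) x = ennreal (?h x) * indicator S x"
    proof eventually_elim
      case (elim x)
      then have "x \<in> S \<longleftrightarrow> x \<in> U \<inter> \<psi> -` A" using a by (auto simp: S_def)
      then show ?case using gd(2)[of x] SU[of x] by (auto simp: indicator_def)
    qed
  qed
  also have "\<dots> = (\<integral>\<^sup>+y\<in>\<tau> ` S. ennreal (density_stereo y) \<partial>lborel)"
  proof (rule nn_integral_change_of_variables_bounded[OF Sb _ _ inj _ density_stereo_nonneg density_stereo_le meas])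
    show "\<tau> ` S \<in> sets borel" unfolding image by (rule vimage_stereo_borel[OF f A(1)])
    show "(\<tau> has_derivative frechet_derivative \<tau> (at x)) (at x within S)" if "x \<in> S" for x
      using gd(1)[of x] SU[OF that] has_derivative_at_withinI by blast
  qed (rule borel_measurable_density_stereo)
  finally show ?thesis unfolding image .
qed

definition chart_measure :: "'a \<Rightarrow> (3 \<Rightarrow> 'a) \<Rightarrow> 'a measure" where
  "chart_measure n e = distr (density lborel (\<lambda>y. ennreal (density_stereo y))) (restrict_space borel M) (stereo n e)"

lemma sets_chart_measure: "sets (chart_measure n e) = sets (restrict_space borel M)"
  by (simp add: chart_measure_def)

lemma emeasure_chart_measure:
  assumes f: "frame n e" and A: "A \<in> sets (restrict_space borel M)"
  shows "emeasure (chart_measure n e) A = (\<integral>\<^sup>+y\<in>stereo n e -` A. ennreal (density_stereo y) \<partial>lborel)"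
proof -
  have d: "(\<lambda>y. ennreal (density_stereo y)) \<in> borel_measurable lborel"
    using borel_measurable_density_stereo by simp
  have "emeasure (chart_measure n e) A = emeasure (density lborel (\<lambda>y. ennreal (density_stereo y))) (stereo n e -` A)"
    unfolding chart_measure_def using measurable_stereo[OF f] A by (subst emeasure_distr) auto
  also have "\<dots> = (\<integral>\<^sup>+y\<in>stereo n e -` A. ennreal (density_stereo y) \<partial>lborel)"
    using vimage_stereo_borel[OF f A] by (intro emeasure_density[OF d]) auto
  finally show ?thesis .
qed

text \<open>The property by which \<open>riemannian_measure M\<close> is selected.\<close>

definition area_measure :: "'a measure \<Rightarrow> bool" where
  "area_measure \<mu> \<longleftrightarrow> sets \<mu> = sets (restrict_space borel M) \<and>
     (\<forall>U \<psi> A. local_param M U \<psi> \<and> A \<in> sets \<mu> \<and> A \<subseteq> \<psi> ` U \<longrightarrow>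
        emeasure \<mu> A = (\<integral>\<^sup>+ x \<in> U \<inter> \<psi> -` A. ennreal (gram_density \<psi> x) \<partial>lborel))"

lemma area_measure_chart: "frame n e \<Longrightarrow> area_measure (chart_measure n e)"
  unfolding area_measure_def sets_chart_measure
  using emeasure_chart_measure nn_integral_chart by auto

text \<open>One chart determines an area measure off the pole, the chart at the antipodal pole determines
  it at the pole.\<close>

lemma area_measure_unique:
  assumes "area_measure \<mu>" "area_measure \<mu>'"
  shows "\<mu> = \<mu>'"
proof (rule measure_eqI)
  show sets: "sets \<mu> = sets \<mu>'" using assms by (simp add: area_measure_def)
  have eq: "emeasure \<mu> A = emeasure \<mu>' A" if "A \<in> sets \<mu>" "frame n e" "A \<subseteq> range (stereo n e)" for A n e
    using assms that local_param_stereo[OF that(2)] unfolding area_measure_def by metis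
  obtain n e where f: "frame n e" by (rule exists_frame)
  let ?N = "c + r *\<^sub>R n"
  fix A assume A: "A \<in> sets \<mu>"
  then have AM: "A \<in> sets borel" "A \<subseteq> M" using assms sets_borel_M by (auto simp: area_measure_def)
  have s: "A - {?N} \<in> sets \<mu>" "A \<inter> {?N} \<in> sets \<mu>"
    using AM assms(1) sets_borel_M by (auto simp: area_measure_def)
  have "n \<noteq> 0" using f by (auto simp: frame_def)
  have "?N \<noteq> c + r *\<^sub>R (- n)"
  proof
    assume "?N = c + r *\<^sub>R (- n)"
    then have "(2 * r) *\<^sub>R n = 0" by (simp add: eq_neg_iff_add_eq_0 scaleR_add_left[symmetric])
    then show False using r_pos \<open>n \<noteq> 0\<close> by simp
  qed
  then have "A \<inter> {?N} \<subseteq> range (stereo (- n) e)"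
    unfolding range_stereo[OF frame_uminus[OF f]] using AM by auto
  moreover have "A - {?N} \<subseteq> range (stereo n e)"
    unfolding range_stereo[OF f] using AM by auto
  moreover have "emeasure \<mu> A = emeasure \<mu> (A - {?N}) + emeasure \<mu> (A \<inter> {?N})"
    "emeasure \<mu>' A = emeasure \<mu>' (A - {?N}) + emeasure \<mu>' (A \<inter> {?N})"
    using s sets by (subst plus_emeasure; force intro!: arg_cong[where f = "emeasure _"])+
  ultimately show "emeasure \<mu> A = emeasure \<mu>' A"
    using eq[OF s(1) f] eq[OF s(2) frame_uminus[OF f]] by simp
qed

lemma riemannian_measure_eq_chart: "frame n e \<Longrightarrow> riemannian_measure M = chart_measure n e"
proof -
  assume "frame n e"
  then have a: "area_measure (chart_measure n e)" by (rule area_measure_chart)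
  have "(THE \<mu>. area_measure \<mu>) = chart_measure n e"
    by (rule the_equality[where P = area_measure, OF a area_measure_unique[OF _ a]])
  then show ?thesis unfolding riemannian_measure_def area_measure_def .
qed

abbreviation \<mu> :: "'a measure" where "\<mu> \<equiv> riemannian_measure M"

lemma sets_\<mu>: "sets \<mu> = sets (restrict_space borel M)"
proof -
  obtain n e where f: "frame n e" by (rule exists_frame)
  show ?thesis unfolding riemannian_measure_eq_chart[OF f] by (rule sets_chart_measure)
qed

lemma space_\<mu>: "space \<mu> = M"
  using sets_eq_imp_space_eq[OF sets_\<mu>] by (simp add: space_restrict_space)

text \<open>Each of the two hemispheres is the image of the unit ball in one of two opposite charts.\<close>

lemma finite_measure_\<mu>: "finite_measure \<mu>"
proof (rule finite_measureI)
  obtain n e where f: "frame n e" by (rule exists_frame)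
  define H where "H n = {x \<in> M. (x - c) \<bullet> n \<le> 0}" for n
  have Hs: "H n \<in> sets \<mu>" for n
  proof -
    have "closed (M \<inter> {x. (x - c) \<bullet> n \<le> 0})"
      by (intro closed_Int closed_M closed_Collect_le continuous_intros)
    then show ?thesis unfolding sets_\<mu> sets_borel_M H_def by (auto simp: Collect_conj_eq borel_closed)
  qed
  have half: "emeasure \<mu> (H n) < \<infinity>" if f: "frame n e" for n e
  proof -
    have sub: "stereo n e -` H n \<subseteq> cball 0 1"
    proof
      fix y assume "y \<in> stereo n e -` H n"
      then have "conf y \<ge> 1"
        using stereo_inner(1)[OF f, of y] r_pos by (simp add: H_def mult_le_0_iff)
      then have "1 * (1 + y \<bullet> y) \<le> conf y * (1 + y \<bullet> y)"
        by (intro mult_right_mono) auto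
      then have "y \<bullet> y \<le> 1" by (simp add: conf_eq)
      then show "y \<in> cball 0 1" by (simp add: norm_eq_sqrt_inner)
    qed
    have "emeasure \<mu> (H n) \<le> (\<integral>\<^sup>+y. ennreal ((r * 2) ^ 3) * indicator (cball 0 1) y \<partial>(lborel :: (real^3) measure))"
      unfolding riemannian_measure_eq_chart[OF f] emeasure_chart_measure[OF f Hs[unfolded sets_\<mu>]]
      by (intro nn_integral_mono mult_mono ennreal_leI density_stereo_le)
        (use sub in \<open>auto simp: indicator_def\<close>)
    also have "\<dots> < \<infinity>"
      using emeasure_bounded_finite[of "cball 0 1 :: (real^3) set"]
      by (simp add: nn_integral_cmult_indicator ennreal_mult_less_top)
    finally show ?thesis .
  qed
  have "space \<mu> \<subseteq> H n \<union> H (- n)" by (auto simp: space_\<mu> H_def)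
  then have "emeasure \<mu> (space \<mu>) \<le> emeasure \<mu> (H n \<union> H (- n))" using Hs by (intro emeasure_mono) auto
  also have "\<dots> \<le> emeasure \<mu> (H n) + emeasure \<mu> (H (- n))" using Hs by (intro emeasure_subadditive)
  also have "\<dots> < \<infinity>" using half[OF f] half[OF frame_uminus[OF f]] by simp
  finally show "emeasure \<mu> (space \<mu>) \<noteq> \<infinity>" by simp
qed

text \<open>A linear isometry of \<open>V\<close> carries stereographic charts to stereographic charts, and all of them
  have the same density.\<close>

lemma distr_isometry:
  assumes L: "linear L" and LV: "\<And>x. x \<in> V \<Longrightarrow> L x \<in> V" and iso: "\<And>x. x \<in> V \<Longrightarrow> norm (L x) = norm x"
  shows "(\<lambda>x. c + L (x - c)) \<in> \<mu> \<rightarrow>\<^sub>M \<mu>" and "distr \<mu> \<mu> (\<lambda>x. c + L (x - c)) = \<mu>"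
proof -
  let ?R = "\<lambda>x. c + L (x - c)"
  have RM: "?R x \<in> M" if "x \<in> M" for x
  proof -
    have x: "x - c \<in> V" "norm (x - c) = r" using that by (auto simp: mem_M)
    show ?thesis unfolding mem_M add_diff_cancel_left' using LV[OF x(1)] iso[OF x(1)] x(2) by simp
  qed
  have bL: "bounded_linear L" using L linear_conv_bounded_linear by blast
  have "continuous_on M ?R"
    by (intro continuous_on_add continuous_on_const bounded_linear.continuous_on[OF bL]
        continuous_on_diff continuous_on_id)
  then show meas: "?R \<in> \<mu> \<rightarrow>\<^sub>M \<mu>"
    unfolding measurable_cong_sets[OF sets_\<mu> sets_\<mu>]
    using RM by (intro measurable_restrict_space2 borel_measurable_continuous_on_restrict) (auto simp: space_restrict_space)
  obtain n e where f: "frame n e" by (rule exists_frame)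
  have inner: "L x \<bullet> L y = x \<bullet> y" if "x \<in> V" "y \<in> V" for x y
  proof -
    have "norm (L x + L y) = norm (x + y)" "norm (L x) = norm x" "norm (L y) = norm y"
      using that iso subspace_add[OF subspace_V] by (auto simp: linear_add[OF L, symmetric])
    then show ?thesis unfolding dot_norm by simp
  qed
  have f': "frame (L n) (\<lambda>i. L (e i))"
    using f inner LV by (auto simp: frame_def)
  have st: "?R (stereo n e y) = stereo (L n) (\<lambda>i. L (e i)) y" for y
    by (simp add: stereo_def vec_in_def linear_add[OF L] linear_diff[OF L] linear_cmul[OF L] linear_sum[OF L])
  have "distr \<mu> \<mu> ?R = distr (chart_measure n e) (restrict_space borel M) ?R"
    using riemannian_measure_eq_chart[OF f] sets_\<mu> by (intro distr_cong) auto
  also have "\<dots> = chart_measure (L n) (\<lambda>i. L (e i))"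
    unfolding chart_measure_def using measurable_stereo[OF f] meas
    by (subst distr_distr) (auto simp: o_def st measurable_cong_sets[OF sets_\<mu> sets_\<mu>])
  also have "\<dots> = \<mu>" by (simp add: riemannian_measure_eq_chart[OF f'])
  finally show "distr \<mu> \<mu> ?R = \<mu>" .
qed

lemma integral_isometry:
  fixes \<phi> :: "'a \<Rightarrow> real"
  assumes "linear L" "\<And>x. x \<in> V \<Longrightarrow> L x \<in> V" "\<And>x. x \<in> V \<Longrightarrow> norm (L x) = norm x"
    and "\<phi> \<in> borel_measurable \<mu>"
  shows "(\<integral>x. \<phi> (c + L (x - c)) \<partial>\<mu>) = (\<integral>x. \<phi> x \<partial>\<mu>)"
  using integral_distr[OF distr_isometry(1)[OF assms(1-3)] assms(4)] distr_isometry(2)[OF assms(1-3)] by simp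

lemma continuous_on_M_measurable:
  "continuous_on M \<phi> \<Longrightarrow> (\<phi> :: 'a \<Rightarrow> 'b::euclidean_space) \<in> borel_measurable \<mu>"
  unfolding measurable_cong_sets[OF sets_\<mu> refl] by (rule borel_measurable_continuous_on_restrict)

lemma continuous_on_M_integrable:
  assumes "continuous_on M \<phi>"
  shows "integrable \<mu> (\<phi> :: 'a \<Rightarrow> 'b::euclidean_space)"
proof -
  interpret finite_measure \<mu> by (rule finite_measure_\<mu>)
  obtain B where "\<And>x. x \<in> M \<Longrightarrow> norm (\<phi> x) \<le> B"
    using compact_imp_bounded[OF compact_continuous_image[OF assms compact_M]]
    by (auto simp: bounded_iff)
  then show ?thesis
    by (intro integrable_const_bound[where B = B] continuous_on_M_measurable assms AE_I2) (auto simp: space_\<mu>)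
qed

end

section \<open>Averaging over great circles\<close>

lemma measurable_pair_restrict_borel:
  fixes f :: "'a::euclidean_space \<times> 'b::euclidean_space \<Rightarrow> real"
  assumes m1: "sets m1 = sets (restrict_space borel A)" and m2: "sets m2 = sets (restrict_space borel B)"
    and f: "continuous_on (A \<times> B) f"
  shows "f \<in> borel_measurable (m1 \<Otimes>\<^sub>M m2)"
proof -
  have s: "space m1 = A" "space m2 = B"
    using sets_eq_imp_space_eq[OF m1] sets_eq_imp_space_eq[OF m2] by (auto simp: space_restrict_space)
  have i1: "(\<lambda>x. x) \<in> borel_measurable m1" and i2: "(\<lambda>x. x) \<in> borel_measurable m2"
    unfolding measurable_cong_sets[OF m1 refl] measurable_cong_sets[OF m2 refl]
    by (intro borel_measurable_continuous_on_restrict continuous_on_id)+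
  have "(\<lambda>z. (fst z, snd z)) \<in> m1 \<Otimes>\<^sub>M m2 \<rightarrow>\<^sub>M borel"
    using measurable_compose[OF measurable_fst i1] measurable_compose[OF measurable_snd i2]
    by (intro borel_measurable_Pair)
  then have "(\<lambda>z. (fst z, snd z)) \<in> m1 \<Otimes>\<^sub>M m2 \<rightarrow>\<^sub>M restrict_space borel (A \<times> B)"
    by (intro measurable_restrict_space2) (auto simp: space_pair_measure s)
  from measurable_compose[OF this borel_measurable_continuous_on_restrict[OF f]]
  show ?thesis by simp
qed

lemma Fubini_compact:
  fixes f :: "'a::euclidean_space \<Rightarrow> 'b::euclidean_space \<Rightarrow> real"
  assumes m1: "sets m1 = sets (restrict_space borel A)" "finite_measure m1" "compact A"
    and m2: "sets m2 = sets (restrict_space borel B)" "finite_measure m2" "compact B"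
    and f: "continuous_on (A \<times> B) (\<lambda>(x, y). f x y)"
  shows "(\<integral>x. \<integral>y. f x y \<partial>m2 \<partial>m1) = (\<integral>y. \<integral>x. f x y \<partial>m1 \<partial>m2)"
    and "integrable m2 (\<lambda>y. \<integral>x. f x y \<partial>m1)"
proof -
  interpret m1: finite_measure m1 by fact
  interpret m2: finite_measure m2 by fact
  interpret p: pair_sigma_finite m1 m2 ..
  have s: "space m1 = A" "space m2 = B"
    using sets_eq_imp_space_eq[OF m1(1)] sets_eq_imp_space_eq[OF m2(1)] by (auto simp: space_restrict_space)
  obtain C where C: "\<And>z. z \<in> A \<times> B \<Longrightarrow> norm (case z of (x, y) \<Rightarrow> f x y) \<le> C"
    using compact_imp_bounded[OF compact_continuous_image[OF f compact_Times[OF m1(3) m2(3)]]]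
    by (auto simp: bounded_iff)
  have fin: "finite_measure (m1 \<Otimes>\<^sub>M m2)"
    by (rule finite_measure_pair_measure) fact+
  have i: "integrable (m1 \<Otimes>\<^sub>M m2) (\<lambda>(x, y). f x y)"
    by (rule finite_measure.integrable_const_bound[OF fin _ measurable_pair_restrict_borel[OF m1(1) m2(1) f], where B = C])
      (use C in \<open>auto intro!: AE_I2 simp: space_pair_measure s\<close>)
  show "(\<integral>x. \<integral>y. f x y \<partial>m2 \<partial>m1) = (\<integral>y. \<integral>x. f x y \<partial>m1 \<partial>m2)"
    using p.Fubini_integral[OF i] by simp
  show "integrable m2 (\<lambda>y. \<integral>x. f x y \<partial>m1)"
    using p.integrable_snd[OF i] .
qed

context quaternionic_sphere
begin

text \<open>Each orthogonal complex structure \<open>J\<close> of \<open>V\<close> generates a flow \<open>rot J\<close> by isometries whose orbits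
  are great circles. Besides the \<open>Q i\<close>, their unit combinations are needed.\<close>

definition complex_structure :: "('a \<Rightarrow> 'a) \<Rightarrow> bool" where
  "complex_structure J \<longleftrightarrow> linear J \<and>
     (\<forall>x\<in>V. J x \<in> V \<and> J x \<bullet> x = 0 \<and> norm (J x) = norm x \<and> J (J x) = - x)"

lemma complex_structureD:
  assumes "complex_structure J"
  shows "linear J" "x \<in> V \<Longrightarrow> J x \<in> V" "x \<in> V \<Longrightarrow> J x \<bullet> x = 0" "x \<in> V \<Longrightarrow> norm (J x) = norm x"
    "x \<in> V \<Longrightarrow> J (J x) = - x"
  using assms by (auto simp: complex_structure_def)

lemma complex_structure_Q: "complex_structure (Q i)"
  by (auto simp: complex_structure_def Q_linear Q_in_V Q_orthogonal Q_norm Q_square)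

lemma complex_structure_combination:
  assumes "(\<Sum>i\<in>UNIV. (u i)\<^sup>2) = 1"
  shows "complex_structure (\<lambda>x. \<Sum>i\<in>UNIV. u i *\<^sub>R Q i x)"
  unfolding complex_structure_def
proof (intro conjI ballI)
  show "linear (\<lambda>x. \<Sum>i\<in>UNIV. u i *\<^sub>R Q i x)"
    by (intro linear_compose_sum linear_compose_scale_right Q_linear ballI)
  fix x assume x: "x \<in> V"
  show "(\<Sum>i\<in>UNIV. u i *\<^sub>R Q i x) \<in> V"
    using x subspace_V by (intro subspace_sum subspace_mul Q_in_V)
  show "(\<Sum>i\<in>UNIV. u i *\<^sub>R Q i x) \<bullet> x = 0"
    using x by (simp add: inner_sum_left Q_orthogonal)
  have "(\<Sum>i\<in>UNIV. u i *\<^sub>R Q i x) \<bullet> (\<Sum>j\<in>UNIV. u j *\<^sub>R Q j x)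
      = (\<Sum>i\<in>UNIV. \<Sum>j\<in>UNIV. if j = i then u i * u j * (x \<bullet> x) else 0)"
    unfolding inner_sum_left inner_sum_right using x
    by (intro sum.cong refl) (auto simp: Q_inner)
  also have "\<dots> = (\<Sum>i\<in>UNIV. (u i)\<^sup>2) * (x \<bullet> x)"
    by (simp add: sum_distrib_right power2_eq_square)
  finally show "norm (\<Sum>i\<in>UNIV. u i *\<^sub>R Q i x) = norm x"
    using assms by (simp add: norm_eq_sqrt_inner)
  let ?S = "\<Sum>i\<in>UNIV. \<Sum>j\<in>UNIV. (u i * u j) *\<^sub>R Q i (Q j x)"
  have S: "(\<Sum>i\<in>UNIV. u i *\<^sub>R Q i (\<Sum>j\<in>UNIV. u j *\<^sub>R Q j x)) = ?S"
    by (simp add: linear_sum[OF Q_linear] Q_scaleR scaleR_sum_right)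
  have "?S + ?S = ?S + (\<Sum>i\<in>UNIV. \<Sum>j\<in>UNIV. (u j * u i) *\<^sub>R Q j (Q i x))"
    using sum.swap[of "\<lambda>i j. (u i * u j) *\<^sub>R Q i (Q j x)" UNIV UNIV] by simp
  also have "\<dots> = (\<Sum>i\<in>UNIV. \<Sum>j\<in>UNIV. (u i * u j) *\<^sub>R (Q i (Q j x) + Q j (Q i x)))"
    by (simp add: sum.distrib scaleR_add_right mult.commute)
  also have "\<dots> = (\<Sum>i\<in>UNIV. \<Sum>j\<in>UNIV. if j = i then (- 2 * (u i)\<^sup>2) *\<^sub>R x else 0)"
    unfolding Q_clifford[OF x] by (intro sum.cong refl) (auto simp: power2_eq_square)
  also have "\<dots> = (- 2 * (\<Sum>i\<in>UNIV. (u i)\<^sup>2)) *\<^sub>R x"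
    by (simp add: scaleR_sum_left sum_distrib_left)
  finally have "2 *\<^sub>R ?S = 2 *\<^sub>R (- x)" using assms by (simp add: scaleR_2)
  then show "(\<Sum>i\<in>UNIV. u i *\<^sub>R Q i (\<Sum>j\<in>UNIV. u j *\<^sub>R Q j x)) = - x"
    unfolding S by (simp only: real_vector.scale_cancel_left) simp
qed

definition rot :: "('a \<Rightarrow> 'a) \<Rightarrow> real \<Rightarrow> 'a \<Rightarrow> 'a" where
  "rot J t x = c + (cos t *\<^sub>R (x - c) + sin t *\<^sub>R J (x - c))"

abbreviation antipode :: "'a \<Rightarrow> 'a" where "antipode x \<equiv> c - (x - c)"

lemma rot_0: "rot J 0 x = x" and rot_pi: "rot J pi x = antipode x" and rot_2pi: "rot J (2 * pi) x = x"
  by (simp_all add: rot_def)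

lemma rot_isometry:
  assumes J: "complex_structure J"
  shows "linear (\<lambda>y. cos t *\<^sub>R y + sin t *\<^sub>R J y)"
    "y \<in> V \<Longrightarrow> cos t *\<^sub>R y + sin t *\<^sub>R J y \<in> V"
    "y \<in> V \<Longrightarrow> norm (cos t *\<^sub>R y + sin t *\<^sub>R J y) = norm y"
proof -
  show "linear (\<lambda>y. cos t *\<^sub>R y + sin t *\<^sub>R J y)"
    by (intro linear_compose_add linear_compose_scale_right complex_structureD[OF J] linear_ident)
  assume y: "y \<in> V"
  then show "cos t *\<^sub>R y + sin t *\<^sub>R J y \<in> V"
    using complex_structureD(2)[OF J] subspace_V by (intro subspace_add subspace_mul)
  have "y \<bullet> J y = 0" using complex_structureD(3)[OF J y] by (simp add: inner_commute)
  then have "(norm (cos t *\<^sub>R y + sin t *\<^sub>R J y))\<^sup>2 = (cos t)\<^sup>2 * (norm y)\<^sup>2 + (sin t)\<^sup>2 * (norm y)\<^sup>2"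
    using complex_structureD(4)[OF J y]
    by (subst norm_add_Pythagorean) (auto simp: orthogonal_def power_mult_distrib)
  also have "\<dots> = (norm y)\<^sup>2"
    by (simp only: distrib_right[symmetric] sin_cos_squared_add2 mult_1_left)
  finally show "norm (cos t *\<^sub>R y + sin t *\<^sub>R J y) = norm y"
    by (simp add: power2_eq_iff_nonneg)
qed

lemma rot_in_M: "complex_structure J \<Longrightarrow> x \<in> M \<Longrightarrow> rot J t x \<in> M"
  unfolding rot_def mem_M add_diff_cancel_left' using rot_isometry(2,3) by metis

lemma antipode_in_M: "x \<in> M \<Longrightarrow> antipode x \<in> M"
  using rot_in_M[OF complex_structure_Q[of 1], of x pi] rot_pi by metis

lemma rot_add:
  assumes J: "complex_structure J" and x: "x \<in> M"
  shows "rot J s (rot J t x) = rot J (s + t) x"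
proof -
  have y: "x - c \<in> V" using x by (simp add: mem_M)
  note J' = complex_structureD[OF J]
  have *: "cos s *\<^sub>R (cos t *\<^sub>R a + sin t *\<^sub>R b) + sin s *\<^sub>R (cos t *\<^sub>R b + sin t *\<^sub>R - a)
      = (cos s * cos t - sin s * sin t) *\<^sub>R a + (sin s * cos t + cos s * sin t) *\<^sub>R b" for a b :: 'a
    by (simp add: algebra_simps)
  show ?thesis
    unfolding rot_def add_diff_cancel_left' linear_add[OF J'(1)] linear_cmul[OF J'(1)] J'(5)[OF y] cos_add sin_add
    unfolding *[of "x - c" "J (x - c)"] ..
qed

lemma antipode_rot: "complex_structure J \<Longrightarrow> x \<in> M \<Longrightarrow> antipode (rot J t x) = rot J (t + pi) x"
  using rot_add[of J x pi t] rot_pi[of J "rot J t x"] by (simp add: add.commute)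

lemma rot_tangent: "complex_structure J \<Longrightarrow> x \<in> M \<Longrightarrow> J (x - c) \<in> tangent_space M x"
  using complex_structureD by (auto simp: tangent_space_M mem_M)

lemma has_vector_derivative_rot:
  assumes J: "complex_structure J" and x: "x \<in> M"
  shows "((\<lambda>t. rot J t x) has_vector_derivative J (rot J t x - c)) (at t)"
proof -
  have y: "x - c \<in> V" using x by (simp add: mem_M)
  note J' = complex_structureD[OF J]
  have "J (rot J t x - c) = (- sin t) *\<^sub>R (x - c) + cos t *\<^sub>R J (x - c)"
    unfolding rot_def add_diff_cancel_left' linear_add[OF J'(1)] linear_cmul[OF J'(1)] J'(5)[OF y]
    by (simp del: minus_diff_eq)
  then show ?thesis
    unfolding rot_def by (auto intro!: derivative_eq_intros)
qed

lemma continuous_on_rot: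
  assumes J: "complex_structure J"
  shows "continuous_on S (\<lambda>(x, t). rot J t x)"
proof -
  have bL: "bounded_linear J" using complex_structureD(1)[OF J] linear_conv_bounded_linear by blast
  have "continuous_on S (\<lambda>z. rot J (snd z) (fst z))"
    unfolding rot_def by (intro continuous_intros bounded_linear.continuous_on[OF bL])
  then show ?thesis by (simp add: case_prod_beta')
qed

text \<open>The Killing field \<open>x \<mapsto> J (x - c)\<close> generates \<open>rot J\<close>.\<close>

definition killing_deriv :: "('a \<Rightarrow> 'a) \<Rightarrow> ('a \<Rightarrow> 'b::euclidean_space) \<Rightarrow> 'a \<Rightarrow> 'b" where
  "killing_deriv J f x = tderiv M f x (J (x - c))"

lemma has_vector_derivative_along_rot:
  assumes "complex_structure J" "smooth_map M f" "x \<in> M"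
  shows "((\<lambda>t. f (rot J t x)) has_vector_derivative killing_deriv J f (rot J t x)) (at t)"
  unfolding killing_deriv_def
  using assms rot_in_M by (intro tderiv_chain[OF _ open_UNIV] has_vector_derivative_rot rot_tangent) auto

text \<open>For a local extension \<open>g\<close> of \<open>f\<close>, the derivative of \<open>g\<close> in the direction \<open>J (x - c)\<close> extends
  \<open>killing_deriv J f\<close>.\<close>

lemma smooth_map_killing_deriv:
  fixes f :: "'a \<Rightarrow> 'b::euclidean_space"
  assumes J: "complex_structure J" and f: "smooth_map M f"
  shows "smooth_map M (killing_deriv J f)"
  unfolding smooth_map_def
proof
  fix p assume p: "p \<in> M"
  obtain U g where U: "open U" "p \<in> U" "smooth_on U g" "\<And>x. x \<in> M \<inter> U \<Longrightarrow> f x = g x"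
    "\<And>q v. q \<in> M \<inter> U \<Longrightarrow> v \<in> tangent_space M q \<Longrightarrow> tderiv M f q v = frechet_derivative g (at q) v"
    using smooth_map_local[OF f p] by metis
  have bL: "bounded_linear J" using complex_structureD(1)[OF J] linear_conv_bounded_linear by blast
  let ?h = "\<lambda>x. \<Sum>b\<in>Basis. (J (x - c) \<bullet> b) *\<^sub>R frechet_derivative g (at x) b"
  have "smooth_on U ?h"
    by (intro smooth_on_sum smooth_on_scaleR smooth_on_inner_left smooth_on_compose_linear[OF bL]
        smooth_on_diff smooth_on_id smooth_on_const smooth_on_frechet U)
  moreover have "killing_deriv J f x = ?h x" if "x \<in> M \<inter> U" for x
  proof -
    have l: "linear (frechet_derivative g (at x))"
      using smooth_onD_diff[OF U(3)] that has_derivative_linear by blast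
    have "killing_deriv J f x = frechet_derivative g (at x) (\<Sum>b\<in>Basis. (J (x - c) \<bullet> b) *\<^sub>R b)"
      using U(5)[OF that rot_tangent[OF J]] that by (simp add: killing_deriv_def euclidean_representation)
    then show ?thesis by (simp only: linear_sum[OF l] linear_cmul[OF l])
  qed
  ultimately show "\<exists>U g. open U \<and> p \<in> U \<and> smooth_on U g \<and> (\<forall>x\<in>M \<inter> U. killing_deriv J f x = g x)"
    using U by blast
qed

lemma continuous_on_killing_deriv:
  "complex_structure J \<Longrightarrow> smooth_map M f \<Longrightarrow> continuous_on M (killing_deriv J f)"
  by (intro smooth_map_imp_continuous smooth_map_killing_deriv)

lemma integral_rot:
  fixes \<phi> :: "'a \<Rightarrow> real"
  assumes J: "complex_structure J" and "\<phi> \<in> borel_measurable \<mu>"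
  shows "(\<integral>x. \<phi> (rot J t x) \<partial>\<mu>) = (\<integral>x. \<phi> x \<partial>\<mu>)"
  unfolding rot_def using integral_isometry[OF rot_isometry[OF J, where t = t] assms(2)] by simp

lemma continuous_on_antipode: "continuous_on M \<phi> \<Longrightarrow> continuous_on M (\<lambda>x. \<phi> (antipode x))"
  by (rule continuous_on_compose2[where t = M and g = \<phi>]) (auto intro!: continuous_intros antipode_in_M)

lemma integral_antipode:
  fixes \<phi> :: "'a \<Rightarrow> real"
  assumes "continuous_on M \<phi>"
  shows "(\<integral>x. \<phi> (antipode x) \<partial>\<mu>) = (\<integral>x. \<phi> x \<partial>\<mu>)"
  using integral_rot[OF complex_structure_Q continuous_on_M_measurable[OF assms], where t = pi] by (simp add: rot_pi)

lemma continuous_along_rot: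
  fixes \<phi> :: "'a \<Rightarrow> 'b::topological_space"
  assumes J: "complex_structure J" and \<phi>: "continuous_on M \<phi>" and x: "x \<in> M"
  shows "continuous_on S (\<lambda>t. \<phi> (rot J t x))"
proof -
  have "continuous_on S (\<lambda>t. rot J t x)"
    using has_vector_derivative_rot[OF J x]
    by (meson continuous_at_imp_continuous_on has_vector_derivative_continuous)
  then show ?thesis
    using rot_in_M[OF J x] by (intro continuous_on_compose2[OF \<phi>]) auto
qed

text \<open>The rotations preserve the measure, so averaging over their orbits does not change an
  integral: an inequality on each great circle of the Hopf fibration of \<open>J\<close> gives one on the sphere.\<close>

lemma integral_nonneg_circles:
  fixes \<phi> :: "'a \<Rightarrow> real"
  assumes J: "complex_structure J" and \<phi>: "continuous_on M \<phi>" and T: "T > 0"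
    and circle: "\<And>x. x \<in> M \<Longrightarrow> 0 \<le> integral {0..T} (\<lambda>t. \<phi> (rot J t x))"
  shows "0 \<le> (\<integral>x. \<phi> x \<partial>\<mu>)"
proof -
  let ?m = "restrict_space lborel {0..T}"
  have sm: "sets ?m = sets (restrict_space borel {0..T})"
    by (simp cong: sets_restrict_space_cong)
  have fm: "finite_measure ?m"
    using T by (intro finite_measureI) (auto simp: emeasure_restrict_space space_restrict_space)
  have c: "continuous_on (M \<times> {0..T}) (\<lambda>(x, t). \<phi> (rot J t x))"
    using continuous_on_compose2[OF \<phi> continuous_on_rot[OF J], of "M \<times> {0..T}"] rot_in_M[OF J]
    by (force simp: case_prod_beta')
  have I: "(\<integral>t. h t \<partial>?m) = integral {0..T} h" if "continuous_on {0..T} h" for h :: "real \<Rightarrow> real"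
  proof -
    have "set_integrable lborel {0..T} h"
      using that by (intro borel_integrable_atLeastAtMost') auto
    then show ?thesis
      using set_borel_integral_eq_integral(2)[of "{0..T}" h]
      by (simp add: integral_restrict_space set_lebesgue_integral_def)
  qed
  have "0 \<le> (\<integral>x. \<integral>t. \<phi> (rot J t x) \<partial>?m \<partial>\<mu>)"
  proof (rule integral_nonneg_AE, rule AE_I2)
    fix x assume "x \<in> space \<mu>"
    then have x: "x \<in> M" by (simp add: space_\<mu>)
    show "0 \<le> (\<integral>t. \<phi> (rot J t x) \<partial>?m)"
      using circle[OF x] continuous_along_rot[OF J \<phi> x] by (simp add: I)
  qed
  also have "\<dots> = (\<integral>t. \<integral>x. \<phi> (rot J t x) \<partial>\<mu> \<partial>?m)"
    by (rule Fubini_compact(1)[OF sets_\<mu> finite_measure_\<mu> compact_M sm fm compact_Icc c])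
  also have "\<dots> = (\<integral>t. (\<integral>x. \<phi> x \<partial>\<mu>) \<partial>?m)"
    by (simp only: integral_rot[OF J continuous_on_M_measurable[OF \<phi>]])
  also have "\<dots> = T * (\<integral>x. \<phi> x \<partial>\<mu>)"
    using T by (subst I) auto
  finally show ?thesis using T by (simp add: zero_le_mult_iff)
qed

lemma integral_square_mono_circles:
  fixes a b :: "'a \<Rightarrow> real"
  assumes J: "complex_structure J" and a: "continuous_on M a" and b: "continuous_on M b" and T: "T > 0"
    and circle: "\<And>x. x \<in> M \<Longrightarrow>
      integral {0..T} (\<lambda>t. (a (rot J t x))\<^sup>2) \<le> integral {0..T} (\<lambda>t. (b (rot J t x))\<^sup>2)"
  shows "(\<integral>x. (a x)\<^sup>2 \<partial>\<mu>) \<le> (\<integral>x. (b x)\<^sup>2 \<partial>\<mu>)"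
proof -
  have "0 \<le> (\<integral>x. (b x)\<^sup>2 - (a x)\<^sup>2 \<partial>\<mu>)"
  proof (rule integral_nonneg_circles[OF J _ T])
    show "continuous_on M (\<lambda>x. (b x)\<^sup>2 - (a x)\<^sup>2)" by (intro continuous_intros a b)
    fix x assume x: "x \<in> M"
    have "integral {0..T} (\<lambda>t. (b (rot J t x))\<^sup>2 - (a (rot J t x))\<^sup>2)
        = integral {0..T} (\<lambda>t. (b (rot J t x))\<^sup>2) - integral {0..T} (\<lambda>t. (a (rot J t x))\<^sup>2)"
      by (intro integral_diff integrable_continuous_real continuous_intros
          continuous_along_rot[OF J a x] continuous_along_rot[OF J b x])
    then show "0 \<le> integral {0..T} (\<lambda>t. (b (rot J t x))\<^sup>2 - (a (rot J t x))\<^sup>2)"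
      using circle[OF x] by simp
  qed
  also have "\<dots> = (\<integral>x. (b x)\<^sup>2 \<partial>\<mu>) - (\<integral>x. (a x)\<^sup>2 \<partial>\<mu>)"
    by (intro Bochner_Integration.integral_diff continuous_on_M_integrable continuous_intros a b)
  finally show ?thesis by simp
qed

text \<open>The integral of the derivative over each closed orbit is zero. This is the source of all
  integrations by parts.\<close>

lemma integral_killing_deriv:
  fixes \<phi> :: "'a \<Rightarrow> real"
  assumes J: "complex_structure J" and \<phi>: "smooth_map M \<phi>"
  shows "(\<integral>x. killing_deriv J \<phi> x \<partial>\<mu>) = 0"
proof -
  have int: "integral {0..2 * pi} (\<lambda>t. killing_deriv J \<phi> (rot J t x)) = 0" if x: "x \<in> M" for x
    using fundamental_theorem_of_calculus[of 0 "2 * pi" "\<lambda>t. \<phi> (rot J t x)" "\<lambda>t. killing_deriv J \<phi> (rot J t x)"]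
      has_vector_derivative_at_within[OF has_vector_derivative_along_rot[OF J \<phi> x]] rot_0 rot_2pi
    by (simp add: integral_unique)
  have "0 \<le> (\<integral>x. killing_deriv J \<phi> x \<partial>\<mu>)"
    by (rule integral_nonneg_circles[OF J, where T = "2 * pi"]) (auto simp: int continuous_on_killing_deriv J \<phi>)
  moreover have "0 \<le> (\<integral>x. - killing_deriv J \<phi> x \<partial>\<mu>)"
    by (rule integral_nonneg_circles[OF J, where T = "2 * pi"])
      (auto simp: int continuous_on_killing_deriv J \<phi> intro!: continuous_intros)
  ultimately show ?thesis by simp
qed

end

section \<open>The sharp Poincare inequality on the three-sphere\<close>

context quaternionic_sphere
begin

lemma antipode_rot_commute:
  assumes J: "complex_structure J" and x: "x \<in> M"
  shows "antipode (rot J t x) = rot J t (antipode x)" "rot J (t + pi) x = rot J t (antipode x)"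
    "rot J (t + pi) (antipode x) = rot J t x"
proof -
  have 1: "rot J (t + pi) z = rot J t (antipode z)" if "z \<in> M" for z
    using rot_add[OF J that, of t pi] by (simp only: rot_pi)
  show "rot J (t + pi) x = rot J t (antipode x)" by (rule 1[OF x])
  show "antipode (rot J t x) = rot J t (antipode x)"
    unfolding antipode_rot[OF J x] by (rule 1[OF x])
  show "rot J (t + pi) (antipode x) = rot J t x"
    unfolding 1[OF antipode_in_M[OF x]] by simp
qed

lemma has_real_derivative_along_rot:
  fixes f :: "'a \<Rightarrow> real"
  assumes "complex_structure J" "smooth_map M f" "x \<in> M"
  shows "((\<lambda>t. f (rot J t x)) has_real_derivative killing_deriv J f (rot J t x)) (at t)"
  using has_vector_derivative_along_rot[OF assms] by (simp add: has_real_derivative_iff_has_vector_derivative)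

text \<open>The odd part of a function is antiperiodic on every great circle, with antiperiod \<open>\<pi>\<close>.\<close>

lemma poincare_odd:
  fixes f :: "'a \<Rightarrow> real"
  assumes J: "complex_structure J" and f: "smooth_map M f"
  shows "(\<integral>x. (f x - f (antipode x))\<^sup>2 \<partial>\<mu>) \<le> (\<integral>x. (killing_deriv J f x - killing_deriv J f (antipode x))\<^sup>2 \<partial>\<mu>)"
proof -
  let ?D = "killing_deriv J f"
  note cf = smooth_map_imp_continuous[OF f] and cD = continuous_on_killing_deriv[OF J f]
  show ?thesis
  proof (rule integral_square_mono_circles[OF J _ _ pi_gt_zero])
    show "continuous_on M (\<lambda>x. f x - f (antipode x))" "continuous_on M (\<lambda>x. ?D x - ?D (antipode x))"
      by (intro continuous_intros cf cD continuous_on_antipode[OF cf] continuous_on_antipode[OF cD])+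
    fix x assume x: "x \<in> M"
    note x' = antipode_in_M[OF x]
    define g where "g t = f (rot J t x) - f (rot J t (antipode x))" for t
    define g' where "g' t = ?D (rot J t x) - ?D (rot J t (antipode x))" for t
    have der: "(g has_real_derivative g' t) (at t)" for t
      unfolding g_def[abs_def] g'_def
      by (intro DERIV_diff has_real_derivative_along_rot[OF J f] x x')
    have cont: "continuous_on UNIV g'"
      unfolding g'_def[abs_def] by (intro continuous_on_diff continuous_along_rot[OF J cD] x x')
    have "(pi / pi)\<^sup>2 * integral {0..pi} (\<lambda>t. (g t)\<^sup>2) \<le> integral {0..pi} (\<lambda>t. (g' t)\<^sup>2)"
      by (rule wirtinger_antiperiodic[OF der cont]) (simp_all add: g_def g'_def antipode_rot_commute[OF J x])
    then show "integral {0..pi} (\<lambda>t. (f (rot J t x) - f (antipode (rot J t x)))\<^sup>2)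
        \<le> integral {0..pi} (\<lambda>t. (?D (rot J t x) - ?D (antipode (rot J t x)))\<^sup>2)"
      unfolding antipode_rot_commute(1)[OF J x] g_def g'_def by simp
  qed
qed

text \<open>An even function has period \<open>\<pi>\<close> on every great circle.\<close>

lemma translation_even:
  fixes f :: "'a \<Rightarrow> real"
  assumes J: "complex_structure J" and f: "smooth_map M f" and \<theta>: "0 \<le> \<theta>" "\<theta> \<le> pi"
  defines "F \<equiv> \<lambda>x. f x + f (antipode x)"
  shows "(\<integral>x. (F (rot J \<theta> x) - F x)\<^sup>2 \<partial>\<mu>) \<le> (\<integral>x. (killing_deriv J f x + killing_deriv J f (antipode x))\<^sup>2 \<partial>\<mu>)"
proof -
  let ?D = "killing_deriv J f"
  note cf = smooth_map_imp_continuous[OF f] and cD = continuous_on_killing_deriv[OF J f]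
  have cF: "continuous_on M F" unfolding F_def by (intro continuous_intros cf continuous_on_antipode[OF cf])
  have "continuous_on M (\<lambda>x. rot J \<theta> x)"
    using continuous_on_compose2[OF continuous_on_rot[OF J, of UNIV], of M "\<lambda>x. (x, \<theta>)"]
    by (simp add: continuous_intros)
  then have cFr: "continuous_on M (\<lambda>x. F (rot J \<theta> x))"
    using rot_in_M[OF J] by (intro continuous_on_compose2[OF cF]) auto
  show ?thesis
  proof (rule integral_square_mono_circles[OF J _ _ pi_gt_zero])
    show "continuous_on M (\<lambda>x. F (rot J \<theta> x) - F x)" "continuous_on M (\<lambda>x. ?D x + ?D (antipode x))"
      by (intro continuous_intros cF cFr cD continuous_on_antipode[OF cD])+
    fix x assume x: "x \<in> M"
    note x' = antipode_in_M[OF x]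
    define g where "g t = f (rot J t x) + f (rot J t (antipode x))" for t
    define g' where "g' t = ?D (rot J t x) + ?D (rot J t (antipode x))" for t
    have der: "(g has_real_derivative g' t) (at t)" for t
      unfolding g_def[abs_def] g'_def
      by (intro DERIV_add has_real_derivative_along_rot[OF J f] x x')
    have cont: "continuous_on UNIV g'"
      unfolding g'_def[abs_def] by (intro continuous_on_add continuous_along_rot[OF J cD] x x')
    have "integral {0..pi} (\<lambda>t. (g (t + \<theta>) - g t)\<^sup>2) \<le> integral {0..pi} (\<lambda>t. (g' t)\<^sup>2)"
      by (rule integral_translation_difference_le[OF der cont _ _ \<theta>])
        (simp_all add: g_def g'_def antipode_rot_commute[OF J x])
    moreover have "F (rot J \<theta> (rot J t x)) = g (t + \<theta>)" for t
      unfolding F_def rot_add[OF J x] g_def antipode_rot_commute(1)[OF J x] by (simp add: add.commute)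
    moreover have "F (rot J t x) = g t" for t
      unfolding F_def g_def antipode_rot_commute(1)[OF J x] ..
    ultimately show "integral {0..pi} (\<lambda>t. (F (rot J \<theta> (rot J t x)) - F (rot J t x))\<^sup>2)
        \<le> integral {0..pi} (\<lambda>t. (?D (rot J t x) + ?D (antipode (rot J t x)))\<^sup>2)"
      unfolding g'_def antipode_rot_commute(1)[OF J x] by simp
  qed
qed

lemma frame_map_isometry:
  assumes f: "frame n e" and f': "frame n' e'"
  defines "L \<equiv> \<lambda>z. (z \<bullet> n) *\<^sub>R n' + (\<Sum>i\<in>UNIV. (z \<bullet> e i) *\<^sub>R e' i)"
  shows "linear L" "L z \<in> V" "z \<in> V \<Longrightarrow> norm (L z) = norm z"
proof -
  show "linear L"
    unfolding L_def by (rule linearI)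
      (simp_all add: inner_add_left scaleR_add_left scaleR_add_right sum.distrib scaleR_sum_right)
  show LV: "L z \<in> V" for z
    unfolding L_def using f' subspace_V
    by (intro subspace_add subspace_mul subspace_sum) (auto simp: frame_def)
  have n: "L z \<bullet> n' = z \<bullet> n" for z
    using f' by (simp add: L_def frame_def inner_add_left inner_sum_left)
  have e: "L z \<bullet> e' i = z \<bullet> e i" for z i
  proof -
    have "n' \<bullet> e' i = 0" "\<And>j. e' j \<bullet> e' i = (if j = i then 1 else 0)"
      using f' by (auto simp: frame_def inner_commute[of n' "e' i"])
    then have "L z \<bullet> e' i = (\<Sum>j\<in>UNIV. if j = i then z \<bullet> e j else 0)"
      unfolding L_def inner_add_left inner_sum_left inner_scaleR_left by (simp add: if_distrib[of "(*) _"] cong: if_cong)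
    then show ?thesis by simp
  qed
  assume "z \<in> V"
  then have "L z \<bullet> L z = z \<bullet> z"
    using frame_parseval[OF f' LV, of z "L z"] frame_parseval[OF f, of z z] by (simp add: n e)
  then show "norm (L z) = norm z" by (simp add: norm_eq_sqrt_inner)
qed

lemma reflection_isometry:
  fixes d :: 'a
  assumes d: "d \<in> V" "d \<noteq> 0"
  defines "L \<equiv> \<lambda>z. z - (2 * (z \<bullet> d) / (d \<bullet> d)) *\<^sub>R d"
  shows "linear L" "z \<in> V \<Longrightarrow> L z \<in> V" "norm (L z) = norm z"
proof -
  show "linear L"
    unfolding L_def by (rule linearI) (simp_all add: inner_add_left add_divide_distrib algebra_simps)
  show "z \<in> V \<Longrightarrow> L z \<in> V"
    unfolding L_def using d subspace_V by (intro subspace_diff subspace_mul)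
  let ?a = "2 * (z \<bullet> d) / (d \<bullet> d)"
  have "?a * (d \<bullet> d) = 2 * (z \<bullet> d)" using d by simp
  then have "L z \<bullet> L z = z \<bullet> z - 2 * ?a * (z \<bullet> d) + ?a * (2 * (z \<bullet> d))"
    unfolding L_def inner_diff_left inner_diff_right inner_scaleR_left inner_scaleR_right
    by (simp only: inner_commute[of d z]) argo
  then show "norm (L z) = norm z" by (simp add: norm_eq_sqrt_inner)
qed

text \<open>After the choice of a base point \<open>p\<close>, a point \<open>q\<close> of the sphere is a unit quaternion with
  real part \<open>re_part p q\<close> and imaginary parts \<open>im_part p i q\<close>; \<open>mult_by p q x\<close> is the product
  of \<open>x\<close> with it. The vector \<open>im_dir p i q\<close> is its imaginary direction, with the value zero at the
  two real points.\<close>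

definition re_part :: "'a \<Rightarrow> 'a \<Rightarrow> real" where "re_part p q = (q - c) \<bullet> (p - c) / r\<^sup>2"

definition im_part :: "'a \<Rightarrow> 3 \<Rightarrow> 'a \<Rightarrow> real" where "im_part p i q = (q - c) \<bullet> Q i (p - c) / r\<^sup>2"

definition im_norm :: "'a \<Rightarrow> 'a \<Rightarrow> real" where "im_norm p q = sqrt (\<Sum>i\<in>UNIV. (im_part p i q)\<^sup>2)"

definition im_dir :: "'a \<Rightarrow> 3 \<Rightarrow> 'a \<Rightarrow> real" where "im_dir p i q = im_part p i q / im_norm p q"

definition mult_by :: "'a \<Rightarrow> 'a \<Rightarrow> 'a \<Rightarrow> 'a" where
  "mult_by p q x = c + (re_part p q *\<^sub>R (x - c) + (\<Sum>i\<in>UNIV. im_part p i q *\<^sub>R Q i (x - c)))"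

lemma unit_quaternion:
  assumes "p \<in> M" "q \<in> M"
  shows "(re_part p q)\<^sup>2 + (im_norm p q)\<^sup>2 = 1"
proof -
  have *: "(inverse r * a)\<^sup>2 = r\<^sup>2 * (a / r\<^sup>2)\<^sup>2" for a
    using r_pos by (simp add: power2_eq_square field_simps)
  have "(q - c) \<bullet> (q - c) = ((q - c) \<bullet> ((p - c) /\<^sub>R r))\<^sup>2 + (\<Sum>i\<in>UNIV. ((q - c) \<bullet> (Q i (p - c) /\<^sub>R r))\<^sup>2)"
    unfolding power2_eq_square
    by (rule frame_parseval[OF radius_frame[OF assms(1)]]) (use assms in \<open>simp add: mem_M\<close>)
  also have "((q - c) \<bullet> ((p - c) /\<^sub>R r))\<^sup>2 = r\<^sup>2 * (re_part p q)\<^sup>2"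
    unfolding re_part_def inner_scaleR_right by (rule *)
  also have "(\<Sum>i\<in>UNIV. ((q - c) \<bullet> (Q i (p - c) /\<^sub>R r))\<^sup>2) = r\<^sup>2 * (im_norm p q)\<^sup>2"
    unfolding im_norm_def im_part_def inner_scaleR_right * sum_distrib_left[symmetric]
    by (subst real_sqrt_pow2) (simp_all add: sum_nonneg)
  finally have "r\<^sup>2 * 1 = r\<^sup>2 * ((re_part p q)\<^sup>2 + (im_norm p q)\<^sup>2)"
    using inner_radius[OF assms(2)] by (simp add: distrib_left)
  then show ?thesis using r_pos by (simp only: mult_cancel_left) auto
qed

lemma mult_by_eq_isometry:
  assumes "p \<in> M"
  shows "mult_by p q x = c + (((q - c) \<bullet> ((p - c) /\<^sub>R r)) *\<^sub>R ((x - c) /\<^sub>R r)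
    + (\<Sum>i\<in>UNIV. ((q - c) \<bullet> (Q i (p - c) /\<^sub>R r)) *\<^sub>R (Q i (x - c) /\<^sub>R r)))"
  unfolding mult_by_def re_part_def im_part_def
  by (simp add: power2_eq_square divide_inverse mult_ac)

lemma mult_by_in_M:
  assumes "p \<in> M" "q \<in> M" "x \<in> M" shows "mult_by p q x \<in> M"
  unfolding mult_by_eq_isometry[OF assms(1)] mem_M add_diff_cancel_left'
  using frame_map_isometry(2,3)[OF radius_frame[OF assms(1)] radius_frame[OF assms(3)]] assms
  by (simp only: mem_M simp_thms)

lemma integral_mult_by:
  fixes \<phi> :: "'a \<Rightarrow> real"
  assumes "p \<in> M" "x \<in> M" "continuous_on M \<phi>"
  shows "(\<integral>q. \<phi> (mult_by p q x) \<partial>\<mu>) = (\<integral>q. \<phi> q \<partial>\<mu>)"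
  unfolding mult_by_eq_isometry[OF assms(1)]
  by (rule integral_isometry[OF frame_map_isometry[OF radius_frame[OF assms(1)] radius_frame[OF assms(2)]]])
    (use assms(3) in \<open>auto intro: continuous_on_M_measurable\<close>)

text \<open>Write \<open>q = cos \<theta> + sin \<theta> u\<close> with an imaginary unit \<open>u\<close>.\<close>

lemma mult_by_eq_rot:
  assumes p: "p \<in> M" and q: "q \<in> M"
  obtains \<theta> where "0 \<le> \<theta>" "\<theta> \<le> pi" "re_part p q = cos \<theta>" "im_norm p q = sin \<theta>"
    "\<And>x. im_norm p q \<noteq> 0 \<Longrightarrow> mult_by p q x = rot (\<lambda>y. \<Sum>i\<in>UNIV. im_dir p i q *\<^sub>R Q i y) \<theta> x"
proof -
  have 1: "(re_part p q)\<^sup>2 + (im_norm p q)\<^sup>2 = 1" by (rule unit_quaternion[OF p q])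
  have pos: "0 \<le> im_norm p q" by (simp add: im_norm_def sum_nonneg)
  obtain \<theta> where \<theta>: "0 \<le> \<theta>" "\<theta> \<le> pi" "re_part p q = cos \<theta>" "im_norm p q = sin \<theta>"
    using sincos_total_pi[OF pos 1] by blast
  have "mult_by p q x = rot (\<lambda>y. \<Sum>i\<in>UNIV. im_dir p i q *\<^sub>R Q i y) \<theta> x" if "im_norm p q \<noteq> 0" for x
    using that unfolding mult_by_def rot_def \<theta>(3) \<theta>(4)[symmetric]
    by (simp add: im_dir_def scaleR_sum_right)
  with \<theta> show ?thesis by (rule that)
qed

lemma im_dir_norm:
  "im_norm p q \<noteq> 0 \<Longrightarrow> (\<Sum>i\<in>UNIV. (im_dir p i q)\<^sup>2) = 1" "(\<Sum>i\<in>UNIV. (im_dir p i q)\<^sup>2) \<le> 1"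
proof -
  have s: "(im_norm p q)\<^sup>2 = (\<Sum>i\<in>UNIV. (im_part p i q)\<^sup>2)"
    unfolding im_norm_def by (rule real_sqrt_pow2) (simp add: sum_nonneg)
  have "(\<Sum>i\<in>UNIV. (im_dir p i q)\<^sup>2) = (im_norm p q)\<^sup>2 / (im_norm p q)\<^sup>2"
    unfolding im_dir_def power_divide sum_divide_distrib[symmetric] s[symmetric] ..
  then show "im_norm p q \<noteq> 0 \<Longrightarrow> (\<Sum>i\<in>UNIV. (im_dir p i q)\<^sup>2) = 1" "(\<Sum>i\<in>UNIV. (im_dir p i q)\<^sup>2) \<le> 1"
    by (auto simp: divide_self_if)
qed

lemma im_dir_measurable: "im_dir p i \<in> borel_measurable \<mu>"
proof -
  have c: "continuous_on M (im_part p i)" for i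
    unfolding im_part_def[abs_def] using r_pos by (intro continuous_intros) auto
  have 1: "im_part p i \<in> borel_measurable \<mu>" for i
    by (rule continuous_on_M_measurable[OF c])
  have 2: "im_norm p \<in> borel_measurable \<mu>"
    unfolding im_norm_def[abs_def] by (intro continuous_on_M_measurable continuous_intros c)
  show ?thesis unfolding im_dir_def[abs_def] by (intro borel_measurable_divide 1 2)
qed

lemma im_dir_product_integrable: "integrable \<mu> (\<lambda>q. im_dir p i q * im_dir p j q)"
proof (rule finite_measure.integrable_const_bound[OF finite_measure_\<mu>, where B = 1])
  have "\<bar>im_dir p i q\<bar> \<le> 1" for i q
  proof -
    have "(im_dir p i q)\<^sup>2 \<le> (\<Sum>i\<in>UNIV. (im_dir p i q)\<^sup>2)" by (rule member_le_sum) auto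
    then show ?thesis using im_dir_norm(2)[of p q] abs_square_le_1 by fastforce
  qed
  then show "AE q in \<mu>. norm (im_dir p i q * im_dir p j q) \<le> 1"
    by (simp add: abs_mult mult_le_one)
  show "(\<lambda>q. im_dir p i q * im_dir p j q) \<in> borel_measurable \<mu>"
    by (intro borel_measurable_times im_dir_measurable)
qed

text \<open>The imaginary direction is isotropic: the reflection in \<open>Q i (p - c)\<close> changes the sign of one
  component, the reflection in \<open>Q i (p - c) - Q j (p - c)\<close> exchanges two components.\<close>

lemma integral_im_dir:
  assumes p: "p \<in> M"
  shows "i \<noteq> j \<Longrightarrow> (\<integral>q. im_dir p i q * im_dir p j q \<partial>\<mu>) = 0"
    and "3 * (\<integral>q. im_dir p i q * im_dir p i q \<partial>\<mu>) \<le> measure \<mu> M"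
proof -
  have pV: "p - c \<in> V" and pr: "(p - c) \<bullet> (p - c) = r\<^sup>2" using p inner_radius by (auto simp: mem_M)
  have QQ: "Q i (p - c) \<bullet> Q j (p - c) = (if i = j then r\<^sup>2 else 0)" for i j
    by (simp add: Q_inner[OF pV] pr)
  have r0: "r \<noteq> 0" using r_pos by simp
  have flip: "(\<integral>q. im_dir p i q * im_dir p j q \<partial>\<mu>) = 0" if "i \<noteq> j" for i j
  proof -
    let ?d = "Q i (p - c)"
    let ?R = "\<lambda>q. c + ((q - c) - (2 * ((q - c) \<bullet> ?d) / (?d \<bullet> ?d)) *\<^sub>R ?d)"
    have d: "?d \<in> V" "?d \<noteq> 0" using Q_in_V[OF pV] QQ[of i i] r0 by auto
    have w: "im_part p k (?R q) = (if k = i then - im_part p k q else im_part p k q)" for k q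
      unfolding im_part_def add_diff_cancel_left' inner_diff_left[of "q - c"] inner_scaleR_left QQ
      using r0 by (auto simp: field_simps)
    have s: "im_norm p (?R q) = im_norm p q" for q
      unfolding im_norm_def w by (intro arg_cong[where f = sqrt] sum.cong) auto
    have "(\<integral>q. im_dir p i q * im_dir p j q \<partial>\<mu>) = (\<integral>q. im_dir p i (?R q) * im_dir p j (?R q) \<partial>\<mu>)"
      by (rule integral_isometry[symmetric, OF reflection_isometry[OF d]])
        (auto intro!: borel_measurable_times im_dir_measurable)
    also have "\<dots> = (\<integral>q. - (im_dir p i q * im_dir p j q) \<partial>\<mu>)"
      unfolding im_dir_def s w using that by simp
    finally show ?thesis by simp
  qed
  then show "i \<noteq> j \<Longrightarrow> (\<integral>q. im_dir p i q * im_dir p j q \<partial>\<mu>) = 0" .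
  have swap: "(\<integral>q. im_dir p i q * im_dir p i q \<partial>\<mu>) = (\<integral>q. im_dir p j q * im_dir p j q \<partial>\<mu>)" if "i \<noteq> j" for i j
  proof -
    let ?d = "Q i (p - c) - Q j (p - c)"
    let ?R = "\<lambda>q. c + ((q - c) - (2 * ((q - c) \<bullet> ?d) / (?d \<bullet> ?d)) *\<^sub>R ?d)"
    have dd: "?d \<bullet> ?d = 2 * r\<^sup>2" using that by (simp add: inner_diff_left inner_diff_right QQ)
    then have d: "?d \<in> V" "?d \<noteq> 0" using Q_in_V[OF pV] subspace_V r0 by (auto intro: subspace_diff)
    have w: "im_part p k (?R q) = (if k = i then im_part p j q else if k = j then im_part p i q else im_part p k q)" for k q
      unfolding im_part_def add_diff_cancel_left' inner_diff_left[of "q - c"] inner_scaleR_left dd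
        inner_diff_left[of "Q i (p - c)"] inner_diff_right[of _ "Q i (p - c)"] QQ
      using r0 that by (auto simp: field_simps)
    have s: "im_norm p (?R q) = im_norm p q" for q
      unfolding im_norm_def w using that exhaust_3[of i] exhaust_3[of j] by (auto simp: sum_3)
    have "(\<integral>q. im_dir p i q * im_dir p i q \<partial>\<mu>) = (\<integral>q. im_dir p i (?R q) * im_dir p i (?R q) \<partial>\<mu>)"
      by (rule integral_isometry[symmetric, OF reflection_isometry[OF d]])
        (auto intro!: borel_measurable_times im_dir_measurable)
    also have "\<dots> = (\<integral>q. im_dir p j q * im_dir p j q \<partial>\<mu>)"
      unfolding im_dir_def s w by simp
    finally show ?thesis .
  qed
  have "(\<Sum>k\<in>UNIV. \<integral>q. im_dir p k q * im_dir p k q \<partial>\<mu>) = (\<integral>q. (\<Sum>k\<in>UNIV. im_dir p k q * im_dir p k q) \<partial>\<mu>)"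
    by (rule Bochner_Integration.integral_sum[symmetric]) (rule im_dir_product_integrable)
  also have "\<dots> \<le> (\<integral>q. 1 \<partial>\<mu>)"
    by (intro integral_mono Bochner_Integration.integrable_sum im_dir_product_integrable
        finite_measure.integrable_const[OF finite_measure_\<mu>])
      (use im_dir_norm(2) in \<open>simp add: power2_eq_square\<close>)
  also have "\<dots> = measure \<mu> M" by (simp add: space_\<mu>)
  also have "(\<Sum>k\<in>UNIV. \<integral>q. im_dir p k q * im_dir p k q \<partial>\<mu>) = (\<Sum>k\<in>(UNIV :: 3 set). \<integral>q. im_dir p i q * im_dir p i q \<partial>\<mu>)"
    using swap by (intro sum.cong refl) metis
  finally show "3 * (\<integral>q. im_dir p i q * im_dir p i q \<partial>\<mu>) \<le> measure \<mu> M" by simp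
qed


lemma M_nonempty: obtains p where "p \<in> M"
proof -
  obtain n e where "frame n e" by (rule exists_frame)
  then show ?thesis using stereo_in_M that by blast
qed

lemma integral_null_sphere:
  fixes h :: "'a \<Rightarrow> real"
  assumes "measure \<mu> M = 0" shows "(\<integral>x. h x \<partial>\<mu>) = 0"
proof -
  interpret finite_measure \<mu> by (rule finite_measure_\<mu>)
  have "emeasure \<mu> M = 0" using assms by (simp add: emeasure_eq_measure)
  then have "M \<in> null_sets \<mu>" using sets.top[of \<mu>] by (auto simp: space_\<mu>)
  then have "AE x in \<mu>. h x = 0" by (rule AE_I'[where N = M]) (auto simp: space_\<mu>)
  then show ?thesis by (rule integral_eq_zero_AE)
qed

text \<open>For a mean-zero even function, the mean square of \<open>F (x q) - F x\<close> over all \<open>x\<close> and \<open>q\<close> is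
  twice that of \<open>F\<close>. The rotation that takes \<open>x\<close> to \<open>x q\<close> runs along the direction of the imaginary
  part of \<open>q\<close>, and these directions are isotropic.\<close>

lemma poincare_even:
  fixes f :: "'a \<Rightarrow> real"
  assumes f: "smooth_map M f" and mean: "(\<integral>x. f x \<partial>\<mu>) = 0"
  shows "6 * (\<integral>x. (f x + f (antipode x))\<^sup>2 \<partial>\<mu>)
    \<le> (\<Sum>i\<in>UNIV. \<integral>x. (killing_deriv (Q i) f x + killing_deriv (Q i) f (antipode x))\<^sup>2 \<partial>\<mu>)"
proof -
  obtain p where p: "p \<in> M" by (rule M_nonempty)
  define F where "F x = f x + f (antipode x)" for x
  define H where "H i x = killing_deriv (Q i) f x + killing_deriv (Q i) f (antipode x)" for i x
  define A where "A i j = (\<integral>x. H i x * H j x \<partial>\<mu>)" for i j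
  define G where "G q = (\<integral>x. F x * F (mult_by p q x) \<partial>\<mu>)" for q
  define E where "E = (\<integral>x. (F x)\<^sup>2 \<partial>\<mu>)"
  define m where "m = measure \<mu> M"
  note cf = smooth_map_imp_continuous[OF f]
  have cF: "continuous_on M F"
    unfolding F_def[abs_def] by (intro continuous_intros cf continuous_on_antipode[OF cf])
  have cH: "continuous_on M (H i)" for i
    unfolding H_def[abs_def]
    by (intro continuous_intros continuous_on_killing_deriv[OF complex_structure_Q f]
        continuous_on_antipode[OF continuous_on_killing_deriv[OF complex_structure_Q f]])
  have meanF: "(\<integral>x. F x \<partial>\<mu>) = 0"
    unfolding F_def[abs_def] using integral_antipode[OF cf] mean
    by (subst Bochner_Integration.integral_add)
      (auto intro!: continuous_on_M_integrable cf continuous_on_antipode[OF cf])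
  have F_antipode: "F (antipode x) = F x" for x by (simp add: F_def)
  have cm: "continuous_on (M \<times> M) (\<lambda>z. mult_by p (snd z) (fst z))"
    unfolding mult_by_def re_part_def im_part_def using r_pos
    by (intro continuous_intros bounded_linear.continuous_on[OF bounded_linear_Q]) auto
  have cFm: "continuous_on (M \<times> M) (\<lambda>z. F (mult_by p (snd z) (fst z)))"
    by (rule continuous_on_compose2[OF cF cm]) (auto intro: mult_by_in_M[OF p])
  have "continuous_on (M \<times> M) (\<lambda>z. F (fst z) * F (mult_by p (snd z) (fst z)))"
    by (intro continuous_on_mult cFm continuous_on_compose2[OF cF continuous_on_fst]) (auto intro: continuous_on_id)
  then have cprod: "continuous_on (M \<times> M) (\<lambda>(x, q). F x * F (mult_by p q x))"
    by (simp add: case_prod_beta')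
  note Fubini = Fubini_compact[OF sets_\<mu> finite_measure_\<mu> compact_M sets_\<mu> finite_measure_\<mu> compact_M cprod, folded G_def]
  \<comment> \<open>For fixed \<open>x\<close>, the map \<open>q \<mapsto> x q\<close> is an isometry of the sphere, and \<open>F\<close> has mean zero.\<close>
  have intG: "(\<integral>q. G q \<partial>\<mu>) = 0"
  proof -
    have "(\<integral>x. \<integral>q. F x * F (mult_by p q x) \<partial>\<mu> \<partial>\<mu>) = (\<integral>x. 0 \<partial>\<mu>)"
      by (intro Bochner_Integration.integral_cong refl)
        (simp add: space_\<mu> integral_mult_by[OF p _ cF] meanF)
    then show ?thesis using Fubini(1) by simp
  qed
  have key: "2 * E - 2 * G q \<le> (\<Sum>i\<in>UNIV. \<Sum>j\<in>UNIV. im_dir p i q * im_dir p j q * A i j)" if q: "q \<in> M" for q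
  proof (cases "im_norm p q = 0")
    \<comment> \<open>Here \<open>q\<close> is \<open>1\<close> or \<open>- 1\<close>, and \<open>F\<close> is even: both sides are zero.\<close>
    case True
    then have "(re_part p q)\<^sup>2 = 1" using unit_quaternion[OF p q] by simp
    then have re: "re_part p q = 1 \<or> re_part p q = - 1" by (simp add: power2_eq_1_iff)
    have "(\<Sum>i\<in>UNIV. (im_part p i q)\<^sup>2) = 0" using True by (simp add: im_norm_def)
    then have "im_part p i q = 0" for i by (simp add: sum_nonneg_eq_0_iff)
    then have "mult_by p q x = x \<or> mult_by p q x = antipode x" for x
      using re by (auto simp: mult_by_def)
    then have "F (mult_by p q x) = F x" for x using F_antipode by metis
    then have "G q = E" by (simp add: G_def E_def power2_eq_square)
    then show ?thesis using True by (simp add: im_dir_def)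
  next
    case False
    obtain \<theta> where \<theta>: "0 \<le> \<theta>" "\<theta> \<le> pi"
      and mult: "\<And>x. mult_by p q x = rot (\<lambda>y. \<Sum>i\<in>UNIV. im_dir p i q *\<^sub>R Q i y) \<theta> x"
    proof -
      obtain \<theta> where "0 \<le> \<theta>" "\<theta> \<le> pi"
        "\<And>x. im_norm p q \<noteq> 0 \<Longrightarrow> mult_by p q x = rot (\<lambda>y. \<Sum>i\<in>UNIV. im_dir p i q *\<^sub>R Q i y) \<theta> x"
        by (rule mult_by_eq_rot[OF p q]) blast
      then show ?thesis using that[of \<theta>] False by simp
    qed
    define J where "J y = (\<Sum>i\<in>UNIV. im_dir p i q *\<^sub>R Q i y)" for y
    have J: "complex_structure J"
      unfolding J_def[abs_def] by (rule complex_structure_combination[OF im_dir_norm(1)[OF False]])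
    have mult': "mult_by p q x = rot J \<theta> x" for x unfolding mult J_def[abs_def] ..
    have DJ: "killing_deriv J f x = (\<Sum>i\<in>UNIV. im_dir p i q * killing_deriv (Q i) f x)" if "x \<in> M" for x
      unfolding killing_deriv_def J_def
      by (subst tderiv_sum[OF f that subspace_tangent[OF that] Q_tangent[OF that]]) simp
    have cFr: "continuous_on M (\<lambda>x. F (rot J \<theta> x))"
      unfolding mult'[symmetric]
      using continuous_on_compose2[OF cFm, of M "\<lambda>x. (x, q)"] q
      by (simp add: continuous_intros image_subset_iff)
    have "(\<integral>x. (F (rot J \<theta> x) - F x)\<^sup>2 \<partial>\<mu>) = (\<integral>x. (F (rot J \<theta> x))\<^sup>2 + (F x)\<^sup>2 - 2 * (F x * F (rot J \<theta> x)) \<partial>\<mu>)"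
      by (intro Bochner_Integration.integral_cong refl) (simp add: power2_diff mult.commute)
    also have "\<dots> = (\<integral>x. (F (rot J \<theta> x))\<^sup>2 \<partial>\<mu>) + E - 2 * G q"
      unfolding E_def G_def mult'
      by (subst Bochner_Integration.integral_diff Bochner_Integration.integral_add;
          (intro continuous_on_M_integrable continuous_intros cF cFr)?)+ simp
    also have "(\<integral>x. (F (rot J \<theta> x))\<^sup>2 \<partial>\<mu>) = E"
      unfolding E_def using integral_rot[OF J, of "\<lambda>x. (F x)\<^sup>2"]
      by (auto intro!: continuous_on_M_measurable continuous_intros cF)
    finally have "2 * E - 2 * G q = (\<integral>x. (F (rot J \<theta> x) - F x)\<^sup>2 \<partial>\<mu>)" by simp
    also have "\<dots> \<le> (\<integral>x. (killing_deriv J f x + killing_deriv J f (antipode x))\<^sup>2 \<partial>\<mu>)"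
      unfolding F_def by (rule translation_even[OF J f \<theta>])
    also have "\<dots> = (\<integral>x. (\<Sum>i\<in>UNIV. \<Sum>j\<in>UNIV. im_dir p i q * im_dir p j q * (H i x * H j x)) \<partial>\<mu>)"
    proof (intro Bochner_Integration.integral_cong refl)
      fix x assume "x \<in> space \<mu>"
      then have x: "x \<in> M" by (simp add: space_\<mu>)
      have "killing_deriv J f x + killing_deriv J f (antipode x) = (\<Sum>i\<in>UNIV. im_dir p i q * H i x)"
        by (simp add: DJ[OF x] DJ[OF antipode_in_M[OF x]] H_def sum.distrib distrib_left)
      then show "(killing_deriv J f x + killing_deriv J f (antipode x))\<^sup>2
          = (\<Sum>i\<in>UNIV. \<Sum>j\<in>UNIV. im_dir p i q * im_dir p j q * (H i x * H j x))"
        by (simp add: power2_eq_square sum_product mult_ac)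
    qed
    also have "\<dots> = (\<Sum>i\<in>UNIV. \<Sum>j\<in>UNIV. im_dir p i q * im_dir p j q * A i j)"
      unfolding A_def
      by (subst Bochner_Integration.integral_sum,
          intro Bochner_Integration.integrable_sum continuous_on_M_integrable continuous_intros cH,
          subst Bochner_Integration.integral_sum,
          intro continuous_on_M_integrable continuous_intros cH, simp)
    finally show ?thesis .
  qed
  have iR: "integrable \<mu> (\<lambda>q. \<Sum>i\<in>UNIV. \<Sum>j\<in>UNIV. im_dir p i q * im_dir p j q * A i j)"
    by (intro Bochner_Integration.integrable_sum integrable_mult_left im_dir_product_integrable)
  have iL: "integrable \<mu> (\<lambda>q. 2 * E - 2 * G q)"
    by (intro Bochner_Integration.integrable_diff integrable_mult_right Fubini(2)
        finite_measure.integrable_const[OF finite_measure_\<mu>])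
  have "(\<integral>q. 2 * E - 2 * G q \<partial>\<mu>) \<le> (\<integral>q. (\<Sum>i\<in>UNIV. \<Sum>j\<in>UNIV. im_dir p i q * im_dir p j q * A i j) \<partial>\<mu>)"
    by (rule integral_mono[OF iL iR]) (auto simp: space_\<mu> intro: key)
  also have "(\<integral>q. 2 * E - 2 * G q \<partial>\<mu>) = m * (2 * E)"
    using Fubini(2) finite_measure.integrable_const[OF finite_measure_\<mu>, of "2 * E"]
    by (subst Bochner_Integration.integral_diff) (auto simp: intG space_\<mu> m_def)
  also have "(\<integral>q. (\<Sum>i\<in>UNIV. \<Sum>j\<in>UNIV. im_dir p i q * im_dir p j q * A i j) \<partial>\<mu>)
      = (\<Sum>i\<in>UNIV. \<Sum>j\<in>UNIV. (\<integral>q. im_dir p i q * im_dir p j q \<partial>\<mu>) * A i j)"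
    by (subst Bochner_Integration.integral_sum,
        intro Bochner_Integration.integrable_sum integrable_mult_left im_dir_product_integrable,
        subst Bochner_Integration.integral_sum,
        intro integrable_mult_left im_dir_product_integrable, simp)
  also have "\<dots> = (\<Sum>i\<in>UNIV. \<Sum>j\<in>UNIV. if j = i then (\<integral>q. im_dir p i q * im_dir p i q \<partial>\<mu>) * A i i else 0)"
    by (intro sum.cong refl) (auto simp: integral_im_dir(1)[OF p])
  also have "\<dots> = (\<Sum>i\<in>UNIV. (\<integral>q. im_dir p i q * im_dir p i q \<partial>\<mu>) * A i i)"
    by simp
  also have "\<dots> \<le> (\<Sum>i\<in>UNIV. (m / 3) * A i i)"
  proof (intro sum_mono mult_right_mono)
    show "0 \<le> A i i" for i unfolding A_def by (rule integral_nonneg_AE) simp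
    show "(\<integral>q. im_dir p i q * im_dir p i q \<partial>\<mu>) \<le> m / 3" for i
      using integral_im_dir(2)[OF p, of i] by (simp add: m_def)
  qed
  finally have main: "m * (6 * E) \<le> m * (\<Sum>i\<in>UNIV. A i i)"
    by (simp add: sum_distrib_left sum_divide_distrib[symmetric])
  have "6 * E \<le> (\<Sum>i\<in>UNIV. A i i)"
  proof (cases "m = 0")
    \<comment> \<open>If \<open>m\<close> were zero, both sides would be integrals with respect to the zero measure.\<close>
    case True
    then show ?thesis by (simp add: E_def A_def integral_null_sphere m_def)
  next
    case False
    then have "m > 0" by (simp add: m_def zero_less_measure_iff less_le)
    then show ?thesis using main by simp
  qed
  then show ?thesis
    by (simp add: E_def A_def F_def H_def power2_eq_square)
qed

text \<open>By the parallelogram law, the odd and the even parts contribute separately to both sides.\<close>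

theorem poincare_inequality:
  fixes f :: "'a \<Rightarrow> real"
  assumes f: "smooth_map M f" and mean: "(\<integral>x. f x \<partial>\<mu>) = 0"
  shows "3 * (\<integral>x. (f x)\<^sup>2 \<partial>\<mu>) \<le> (\<Sum>i\<in>UNIV. \<integral>x. (killing_deriv (Q i) f x)\<^sup>2 \<partial>\<mu>)"
proof -
  have parallelogram: "(\<integral>x. (g x - g (antipode x))\<^sup>2 \<partial>\<mu>) + (\<integral>x. (g x + g (antipode x))\<^sup>2 \<partial>\<mu>) = 4 * (\<integral>x. (g x)\<^sup>2 \<partial>\<mu>)"
    if g: "continuous_on M g" for g :: "'a \<Rightarrow> real"
  proof -
    note ga = continuous_on_antipode[OF g]
    have "(\<integral>x. (g x - g (antipode x))\<^sup>2 \<partial>\<mu>) + (\<integral>x. (g x + g (antipode x))\<^sup>2 \<partial>\<mu>)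
        = (\<integral>x. (g x - g (antipode x))\<^sup>2 + (g x + g (antipode x))\<^sup>2 \<partial>\<mu>)"
      by (intro Bochner_Integration.integral_add[symmetric] continuous_on_M_integrable continuous_intros g ga)
    also have "\<dots> = (\<integral>x. 2 * (g x)\<^sup>2 + 2 * (g (antipode x))\<^sup>2 \<partial>\<mu>)"
      by (intro Bochner_Integration.integral_cong refl) (simp add: power2_diff power2_sum)
    also have "\<dots> = (\<integral>x. 2 * (g x)\<^sup>2 \<partial>\<mu>) + (\<integral>x. 2 * (g (antipode x))\<^sup>2 \<partial>\<mu>)"
      by (intro Bochner_Integration.integral_add continuous_on_M_integrable continuous_intros g ga)
    also have "\<dots> = 4 * (\<integral>x. (g x)\<^sup>2 \<partial>\<mu>)"
      using integral_antipode[of "\<lambda>x. (g x)\<^sup>2"] g by (simp add: continuous_intros)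
    finally show ?thesis .
  qed
  let ?D = "\<lambda>i. killing_deriv (Q i) f"
  have odd: "3 * (\<integral>x. (f x - f (antipode x))\<^sup>2 \<partial>\<mu>) \<le> (\<Sum>i\<in>UNIV. \<integral>x. (?D i x - ?D i (antipode x))\<^sup>2 \<partial>\<mu>)"
    using poincare_odd[OF complex_structure_Q f, of 1] poincare_odd[OF complex_structure_Q f, of 2]
      poincare_odd[OF complex_structure_Q f, of 3] unfolding sum_3 by linarith
  have "0 \<le> (\<integral>x. (f x + f (antipode x))\<^sup>2 \<partial>\<mu>)" by (rule integral_nonneg_AE) simp
  then have "3 * (4 * (\<integral>x. (f x)\<^sup>2 \<partial>\<mu>)) \<le> (\<Sum>i\<in>UNIV. \<integral>x. (?D i x - ?D i (antipode x))\<^sup>2 \<partial>\<mu>)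
      + (\<Sum>i\<in>UNIV. \<integral>x. (?D i x + ?D i (antipode x))\<^sup>2 \<partial>\<mu>)"
    using odd poincare_even[OF f mean] parallelogram[OF smooth_map_imp_continuous[OF f]] by linarith
  also have "\<dots> = (\<Sum>i\<in>UNIV. 4 * (\<integral>x. (?D i x)\<^sup>2 \<partial>\<mu>))"
    using parallelogram[OF continuous_on_killing_deriv[OF complex_structure_Q f]]
    by (simp add: sum.distrib[symmetric])
  finally show ?thesis by (simp add: sum_distrib_left[symmetric])
qed

end

section \<open>The first-order inequality for complex-valued functions\<close>

context quaternionic_sphere
begin

lemma smooth_map_linear:
  assumes "bounded_linear L" "smooth_map M f"
  shows "smooth_map M (\<lambda>x. L (f x))"
  using assms(2) smooth_on_compose_linear[OF assms(1)] unfolding smooth_map_def by metis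

lemma smooth_map_inner:
  fixes f g :: "'a \<Rightarrow> 'b::euclidean_space"
  assumes "smooth_map M f" "smooth_map M g"
  shows "smooth_map M (\<lambda>x. f x \<bullet> g x)"
  unfolding smooth_map_def
proof
  fix p assume p: "p \<in> M"
  obtain U u where U: "open U" "p \<in> U" "smooth_on U u" "\<forall>x\<in>M \<inter> U. f x = u x"
    using assms(1) p unfolding smooth_map_def by blast
  obtain W w where W: "open W" "p \<in> W" "smooth_on W w" "\<forall>x\<in>M \<inter> W. g x = w x"
    using assms(2) p unfolding smooth_map_def by blast
  have "smooth_on (U \<inter> W) (\<lambda>x. u x \<bullet> w x)"
    using U W by (intro smooth_on_inner open_Int smooth_on_subset[OF U(3)] smooth_on_subset[OF W(3)]) auto
  then show "\<exists>U k. open U \<and> p \<in> U \<and> smooth_on U k \<and> (\<forall>x\<in>M \<inter> U. f x \<bullet> g x = k x)"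
    using U W by (intro exI[of _ "U \<inter> W"] exI[of _ "\<lambda>x. u x \<bullet> w x"]) auto
qed

lemma killing_deriv_eqI:
  assumes J: "complex_structure J" and f: "smooth_map M f" and x: "x \<in> M"
    and "((\<lambda>t. f (rot J t x)) has_vector_derivative d) (at 0)"
  shows "killing_deriv J f x = d"
  using vector_derivative_unique_at[OF has_vector_derivative_along_rot[OF J f x, of 0] assms(4)]
  by (simp add: rot_0)

lemma killing_deriv_inner:
  fixes f g :: "'a \<Rightarrow> 'b::euclidean_space"
  assumes J: "complex_structure J" and f: "smooth_map M f" and g: "smooth_map M g" and x: "x \<in> M"
  shows "killing_deriv J (\<lambda>x. f x \<bullet> g x) x = f x \<bullet> killing_deriv J g x + killing_deriv J f x \<bullet> g x"
  using bounded_bilinear.has_vector_derivative[OF bounded_bilinear_inner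
      has_vector_derivative_along_rot[OF J f x, of 0] has_vector_derivative_along_rot[OF J g x, of 0]]
  by (intro killing_deriv_eqI[OF J smooth_map_inner[OF f g] x]) (simp add: rot_0)

lemma killing_deriv_linear:
  assumes L: "bounded_linear L" and J: "complex_structure J" and f: "smooth_map M f" and x: "x \<in> M"
  shows "killing_deriv J (\<lambda>x. L (f x)) x = L (killing_deriv J f x)"
  using bounded_linear.has_vector_derivative[OF L has_vector_derivative_along_rot[OF J f x, of 0]]
  by (intro killing_deriv_eqI[OF J smooth_map_linear[OF L f] x]) (simp add: rot_0)

text \<open>In terms of a local extension \<open>g\<close> of \<open>f\<close>, the second derivative along two Killing fields is
  a value of the Hessian of \<open>g\<close>, which is symmetric, plus a first derivative. Only the latter
  contributes to the commutator.\<close>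

lemma killing_deriv_commutator:
  fixes f :: "'a \<Rightarrow> 'b::euclidean_space"
  assumes f: "smooth_map M f" and x: "x \<in> M"
  shows "killing_deriv (Q 3) (killing_deriv (Q 2) f) x - killing_deriv (Q 2) (killing_deriv (Q 3) f) x
    = 2 *\<^sub>R killing_deriv (Q 1) f x"
proof -
  obtain U g where U: "open U" "x \<in> U" "smooth_on U g" "\<And>x. x \<in> M \<inter> U \<Longrightarrow> f x = g x"
    "\<And>q v. q \<in> M \<inter> U \<Longrightarrow> v \<in> tangent_space M q \<Longrightarrow> tderiv M f q v = frechet_derivative g (at q) v"
    using smooth_map_local[OF f x] by metis
  define y where "y = x - c"
  have y: "y \<in> V" using x by (simp add: y_def mem_M)
  define D where "D z b = frechet_derivative g (at z) b" for z b
  define P where "P b v = frechet_derivative (\<lambda>z. D z b) (at x) v" for b v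
  define G where "G k z = (\<Sum>b\<in>Basis. (Q k (z - c) \<bullet> b) *\<^sub>R D z b)" for k z
  have l: "linear (D z)" if "z \<in> U" for z
    using smooth_onD_diff[OF U(3) that] has_derivative_linear unfolding D_def by blast
  have dP: "((\<lambda>z. D z b) has_derivative P b) (at x)" for b
    unfolding P_def[abs_def] D_def[abs_def] by (rule smooth_onD_diff[OF smooth_on_frechet[OF U(3)] U(2)])
  have lP: "linear (P b)" for b using dP has_derivative_linear by blast
  have sym: "P a b = P b a" for a b
    unfolding P_def D_def by (rule frechet_derivative_commute[OF U(1,3,2)])
  have G: "killing_deriv (Q k) f z = G k z" if "z \<in> M \<inter> U" for k z
  proof -
    have "killing_deriv (Q k) f z = D z (\<Sum>b\<in>Basis. (Q k (z - c) \<bullet> b) *\<^sub>R b)"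
      using U(5)[OF that Q_tangent] that by (simp add: killing_deriv_def D_def euclidean_representation)
    then show ?thesis
      using that by (simp only: linear_sum[OF l] linear_cmul[OF l] G_def Int_iff)
  qed
  define S where "S k j = (\<Sum>b\<in>Basis. (Q k y \<bullet> b) *\<^sub>R P b (Q j y))" for k j
  have S: "S k j = (\<Sum>b\<in>Basis. \<Sum>b'\<in>Basis. ((Q k y \<bullet> b) * (Q j y \<bullet> b')) *\<^sub>R P b b')" for k j
  proof -
    have "P b (Q j y) = (\<Sum>b'\<in>Basis. (Q j y \<bullet> b') *\<^sub>R P b b')" for b
      by (subst euclidean_representation[of "Q j y", symmetric])
        (simp only: linear_sum[OF lP] linear_cmul[OF lP])
    then show ?thesis by (simp add: S_def scaleR_sum_right)
  qed
  have S_sym: "S k j = S j k" for k j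
  proof -
    have "S j k = (\<Sum>b'\<in>Basis. \<Sum>b\<in>Basis. ((Q j y \<bullet> b) * (Q k y \<bullet> b')) *\<^sub>R P b b')"
      unfolding S by (rule sum.swap)
    then show ?thesis unfolding S by (simp only: sym mult.commute)
  qed
  have dd: "killing_deriv (Q j) (killing_deriv (Q k) f) x = D x (Q k (Q j y)) + S k j" for j k
  proof -
    have dQ: "((\<lambda>z. Q k (z - c) \<bullet> b) has_derivative (\<lambda>v. Q k v \<bullet> b)) (at x)" for b
      by (auto intro!: derivative_eq_intros bounded_linear.has_derivative[OF bounded_linear_Q])
    have "(G k has_derivative (\<lambda>v. \<Sum>b\<in>Basis. (Q k y \<bullet> b) *\<^sub>R P b v + (Q k v \<bullet> b) *\<^sub>R D x b)) (at x)"
      unfolding G_def[abs_def] y_def by (intro has_derivative_sum has_derivative_scaleR dQ dP)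
    from tderiv_local[OF Q_tangent[OF x] this U(1,2) G]
    have "killing_deriv (Q j) (killing_deriv (Q k) f) x
        = (\<Sum>b\<in>Basis. (Q k y \<bullet> b) *\<^sub>R P b (Q j y) + (Q k (Q j y) \<bullet> b) *\<^sub>R D x b)"
      unfolding killing_deriv_def[of "Q j"] y_def by blast
    also have "\<dots> = S k j + D x (\<Sum>b\<in>Basis. (Q k (Q j y) \<bullet> b) *\<^sub>R b)"
      by (simp only: sum.distrib S_def linear_sum[OF l[OF U(2)]] linear_cmul[OF l[OF U(2)]])
    finally show ?thesis by (simp add: euclidean_representation)
  qed
  have "Q 2 (Q 3 y) + Q 3 (Q 2 y) = 0" using Q_clifford[OF y, of 2 3] by simp
  then have "Q 3 (Q 2 y) = - Q 1 y" using Q_product[OF y] by (simp add: eq_neg_iff_add_eq_0 add.commute)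
  then have "killing_deriv (Q 3) (killing_deriv (Q 2) f) x - killing_deriv (Q 2) (killing_deriv (Q 3) f) x
      = D x (Q 1 y) - D x (- Q 1 y)"
    unfolding dd S_sym[of 3 2] Q_product[OF y] by simp
  also have "\<dots> = 2 *\<^sub>R D x (Q 1 y)" by (simp add: linear_neg[OF l[OF U(2)]] scaleR_2)
  also have "D x (Q 1 y) = killing_deriv (Q 1) f x"
    using U(5)[OF _ Q_tangent[OF x]] x U(2) by (simp add: killing_deriv_def D_def y_def)
  finally show ?thesis .
qed

end

text \<open>In the complex notation \<open>I = \<i>\<close>: the function \<open>t \<mapsto> e\<^sup>-\<^sup>\<i>\<^sup>t\<^sup>/\<^sup>2 Y t\<close> is antiperiodic, so the
  antiperiodic Wirtinger inequality bounds the mean of \<open>\<bar>Y' - \<i> Y / 2\<bar>\<^sup>2\<close> below by that of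
  \<open>\<bar>Y\<bar>\<^sup>2 / 4\<close>. On the Fourier
  side this is \<open>m\<^sup>2 - m \<ge> 0\<close> for integers \<open>m\<close>.\<close>

lemma circle_first_order:
  fixes Y Y' :: "real \<Rightarrow> 'b::euclidean_space" and I :: "'b \<Rightarrow> 'b"
  assumes I: "bounded_linear I" "\<And>y. I y \<bullet> y = 0" "\<And>y. norm (I y) = norm y" "\<And>y. I (I y) = - y"
    and der: "\<And>t. (Y has_vector_derivative Y' t) (at t)" and cont: "continuous_on UNIV Y'"
    and per: "\<And>t. Y (t + 2 * pi) = Y t" and per': "\<And>t. Y' (t + 2 * pi) = Y' t"
  shows "0 \<le> integral {0..2 * pi} (\<lambda>t. Y' t \<bullet> Y' t - I (Y t) \<bullet> Y' t)"
proof -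
  define R where "R t y = cos (t / 2) *\<^sub>R y - sin (t / 2) *\<^sub>R I y" for t y
  define G where "G t = R t (Y t)" for t
  define G' where "G' t = R t (Y' t - (1/2) *\<^sub>R I (Y t))" for t
  note lin = linear_add[OF bounded_linear.linear[OF I(1)]] linear_diff[OF bounded_linear.linear[OF I(1)]]
    linear_cmul[OF bounded_linear.linear[OF I(1)]]
  have contY: "continuous_on UNIV Y"
    using der by (intro continuous_at_imp_continuous_on) (auto intro: has_vector_derivative_continuous)
  have dG: "(G has_vector_derivative G' t) (at t)" for t
  proof -
    have "(G has_vector_derivative
        (cos (t / 2) *\<^sub>R Y' t + (- sin (t / 2) * (1/2)) *\<^sub>R Y t)
        - (sin (t / 2) *\<^sub>R I (Y' t) + (cos (t / 2) * (1/2)) *\<^sub>R I (Y t))) (at t)"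
      unfolding G_def[abs_def] R_def
      by (intro has_vector_derivative_diff has_vector_derivative_scaleR der
          bounded_linear.has_vector_derivative[OF I(1) der])
        (auto intro!: derivative_eq_intros)
    moreover have "(cos (t / 2) *\<^sub>R Y' t + (- sin (t / 2) * (1/2)) *\<^sub>R Y t)
        - (sin (t / 2) *\<^sub>R I (Y' t) + (cos (t / 2) * (1/2)) *\<^sub>R I (Y t)) = G' t"
      unfolding G'_def R_def lin I(4) by (simp add: algebra_simps)
    ultimately show ?thesis by simp
  qed
  have contR: "continuous_on UNIV (\<lambda>t. R t (Z t))" if "continuous_on UNIV Z" for Z
    unfolding R_def by (intro continuous_intros that bounded_linear.continuous_on[OF I(1)]) auto
  have contG: "continuous_on UNIV G" unfolding G_def[abs_def] by (rule contR[OF contY])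
  have "continuous_on UNIV (\<lambda>t. Y' t - (1/2) *\<^sub>R I (Y t))"
    using bounded_linear.continuous_on[OF I(1) contY] cont
    by (intro continuous_on_diff continuous_on_scaleR continuous_on_const)
  from contR[OF this] have contG': "continuous_on UNIV G'" unfolding G'_def[abs_def] .
  have Rshift: "R (t + 2 * pi) y = - R t y" for t y
  proof -
    have *: "(t + 2 * pi) / 2 = t / 2 + pi" by simp
    show ?thesis unfolding R_def * by (simp add: cos_add sin_add)
  qed
  have R_inner: "R t y \<bullet> R t y = y \<bullet> y" for t y
  proof -
    have "I y \<bullet> I y = y \<bullet> y" using I(3)[of y] by (simp add: norm_eq)
    then have "R t y \<bullet> R t y = (cos (t / 2))\<^sup>2 * (y \<bullet> y) + (sin (t / 2))\<^sup>2 * (y \<bullet> y)"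
      using I(2)[of y] unfolding R_def
      by (simp add: inner_diff inner_commute[of y "I y"] power2_eq_square)
    then show ?thesis by (simp only: distrib_right[symmetric] sin_cos_squared_add2 mult_1_left)
  qed
  have int: "h integrable_on {0..2 * pi}" if "continuous_on UNIV h" for h :: "real \<Rightarrow> real"
    using that continuous_on_subset integrable_continuous_real by blast
  have wir: "(1/4) * integral {0..2 * pi} (\<lambda>t. (G t \<bullet> b)\<^sup>2) \<le> integral {0..2 * pi} (\<lambda>t. (G' t \<bullet> b)\<^sup>2)" for b
  proof -
    have d: "((\<lambda>t. G t \<bullet> b) has_real_derivative G' t \<bullet> b) (at t)" for t
      using bounded_linear.has_vector_derivative[OF bounded_linear_inner_left dG, of b]
      by (simp add: has_real_derivative_iff_has_vector_derivative)
    have "(pi / (2 * pi))\<^sup>2 * integral {0..2 * pi} (\<lambda>t. (G t \<bullet> b)\<^sup>2) \<le> integral {0..2 * pi} (\<lambda>t. (G' t \<bullet> b)\<^sup>2)"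
      using continuous_on_inner[OF contG' continuous_on_const]
      by (rule wirtinger_antiperiodic[OF d]) (simp_all add: G_def G'_def Rshift per per')
    then show ?thesis by (simp add: power2_eq_square)
  qed
  have sumint: "(\<Sum>b\<in>Basis. integral {0..2 * pi} (\<lambda>t. (Z t \<bullet> b)\<^sup>2)) = integral {0..2 * pi} (\<lambda>t. Z t \<bullet> Z t)"
    if "continuous_on UNIV Z" for Z :: "real \<Rightarrow> 'b"
  proof -
    have "integral {0..2 * pi} (\<lambda>t. Z t \<bullet> Z t) = integral {0..2 * pi} (\<lambda>t. \<Sum>b\<in>Basis. (Z t \<bullet> b)\<^sup>2)"
      by (intro arg_cong[where f = "integral _"] ext) (simp add: euclidean_inner[of "Z _" "Z _"] power2_eq_square)
    also have "\<dots> = (\<Sum>b\<in>Basis. integral {0..2 * pi} (\<lambda>t. (Z t \<bullet> b)\<^sup>2))"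
      by (intro integral_sum int continuous_intros that) auto
    finally show ?thesis by simp
  qed
  have "(1/4) * (\<Sum>b\<in>Basis. integral {0..2 * pi} (\<lambda>t. (G t \<bullet> b)\<^sup>2)) \<le> (\<Sum>b\<in>Basis. integral {0..2 * pi} (\<lambda>t. (G' t \<bullet> b)\<^sup>2))"
    unfolding sum_distrib_left by (intro sum_mono wir)
  then have "(1/4) * integral {0..2 * pi} (\<lambda>t. G t \<bullet> G t) \<le> integral {0..2 * pi} (\<lambda>t. G' t \<bullet> G' t)"
    unfolding sumint[OF contG] sumint[OF contG'] .
  then have "0 \<le> integral {0..2 * pi} (\<lambda>t. G' t \<bullet> G' t) - integral {0..2 * pi} (\<lambda>t. (1/4) * (G t \<bullet> G t))"
    by simp
  also have "\<dots> = integral {0..2 * pi} (\<lambda>t. G' t \<bullet> G' t - (1/4) * (G t \<bullet> G t))"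
    by (intro integral_diff[symmetric] int continuous_intros contG contG')
  also have "(\<lambda>t. G' t \<bullet> G' t - (1/4) * (G t \<bullet> G t)) = (\<lambda>t. Y' t \<bullet> Y' t - I (Y t) \<bullet> Y' t)"
  proof
    fix t
    have "I (Y t) \<bullet> I (Y t) = Y t \<bullet> Y t" using I(3)[of "Y t"] by (simp add: norm_eq)
    then show "G' t \<bullet> G' t - (1/4) * (G t \<bullet> G t) = Y' t \<bullet> Y' t - I (Y t) \<bullet> Y' t"
      unfolding G_def G'_def R_inner
      by (simp add: inner_diff inner_commute[of "Y' t" "I (Y t)"] algebra_simps)
  qed
  finally show ?thesis .
qed

context quaternionic_sphere
begin

text \<open>The operators \<open>X\<^sub>2\<close> and \<open>X\<^sub>3\<close> combine to a Cauchy-Riemann operator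
  \<open>Z = X\<^sub>2 + \<i> X\<^sub>3\<close>; by the commutator relation \<open>\<integral>\<bar>Z h\<bar>\<^sup>2\<close> absorbs two of the three units of the
  first-order term, and the remaining one is estimated on the circles of \<open>X\<^sub>1\<close>.\<close>

theorem first_order_inequality:
  fixes h :: "'a \<Rightarrow> 'b::euclidean_space" and I :: "'b \<Rightarrow> 'b"
  assumes I: "bounded_linear I" "\<And>y. I y \<bullet> y = 0" "\<And>y. norm (I y) = norm y" "\<And>y. I (I y) = - y"
    and h: "smooth_map M h"
  shows "3 * (\<integral>x. I (h x) \<bullet> killing_deriv (Q 1) h x \<partial>\<mu>)
    \<le> (\<Sum>i\<in>UNIV. \<integral>x. (norm (killing_deriv (Q i) h x))\<^sup>2 \<partial>\<mu>)"
proof -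
  define D where "D i = killing_deriv (Q i) h" for i
  note J = complex_structure_Q
  have sD: "smooth_map M (D i)" for i unfolding D_def by (rule smooth_map_killing_deriv[OF J h])
  have ch: "continuous_on M h" by (rule smooth_map_imp_continuous[OF h])
  have cD: "continuous_on M (D i)" for i by (rule smooth_map_imp_continuous[OF sD])
  have cID: "continuous_on M (\<lambda>x. I (D i x))" and cIh: "continuous_on M (\<lambda>x. I (h x))" for i
    by (intro bounded_linear.continuous_on[OF I(1)] cD ch)+
  have skew: "I u \<bullet> v = - (u \<bullet> I v)" for u v
    using I(2)[of "u + v"] I(2)[of u] I(2)[of v]
    by (simp add: linear_add[OF bounded_linear.linear[OF I(1)]] inner_add inner_commute)
  note int = continuous_on_M_integrable
  define T where "T = (\<integral>x. I (h x) \<bullet> D 1 x \<partial>\<mu>)"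
  have circle: "T \<le> (\<integral>x. D 1 x \<bullet> D 1 x \<partial>\<mu>)"
  proof -
    have "0 \<le> (\<integral>x. D 1 x \<bullet> D 1 x - I (h x) \<bullet> D 1 x \<partial>\<mu>)"
    proof (rule integral_nonneg_circles[OF J, of _ "2 * pi" 1])
      show "continuous_on M (\<lambda>x. D 1 x \<bullet> D 1 x - I (h x) \<bullet> D 1 x)"
        by (intro continuous_intros cD cIh)
      fix x assume x: "x \<in> M"
      have per: "rot (Q 1) (t + 2 * pi) x = rot (Q 1) t x" for t
        using rot_add[OF J x, of 1 t "2 * pi"] by (simp add: rot_2pi)
      show "0 \<le> integral {0..2 * pi} (\<lambda>t. D 1 (rot (Q 1) t x) \<bullet> D 1 (rot (Q 1) t x)
          - I (h (rot (Q 1) t x)) \<bullet> D 1 (rot (Q 1) t x))"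
        by (rule circle_first_order[OF I])
          (auto simp: per D_def intro!: has_vector_derivative_along_rot J h x
            continuous_along_rot[OF J cD[unfolded D_def] x])
    qed simp
    then show ?thesis
      by (simp add: T_def Bochner_Integration.integral_diff int continuous_intros cD cIh)
  qed
  define W where "W = (\<integral>x. D 2 x \<bullet> I (D 3 x) \<partial>\<mu>)"
  have parts: "(\<integral>x. h x \<bullet> I (killing_deriv (Q i) (D j) x) \<partial>\<mu>) = - (\<integral>x. D i x \<bullet> I (D j x) \<partial>\<mu>)" for i j
  proof -
    note sID = smooth_map_linear[OF I(1) sD]
    have c1: "continuous_on M (\<lambda>x. h x \<bullet> I (killing_deriv (Q i) (D j) x))"
      by (intro continuous_intros ch bounded_linear.continuous_on[OF I(1)] continuous_on_killing_deriv[OF J sD])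
    have c2: "continuous_on M (\<lambda>x. D i x \<bullet> I (D j x))"
      by (intro continuous_intros cD cID)
    have "0 = (\<integral>x. killing_deriv (Q i) (\<lambda>x. h x \<bullet> I (D j x)) x \<partial>\<mu>)"
      by (rule integral_killing_deriv[symmetric, OF J smooth_map_inner[OF h sID]])
    also have "\<dots> = (\<integral>x. h x \<bullet> I (killing_deriv (Q i) (D j) x) + D i x \<bullet> I (D j x) \<partial>\<mu>)"
      by (intro Bochner_Integration.integral_cong refl)
        (simp add: space_\<mu> killing_deriv_inner[OF J h sID] killing_deriv_linear[OF I(1) J sD] D_def[symmetric])
    also have "\<dots> = (\<integral>x. h x \<bullet> I (killing_deriv (Q i) (D j) x) \<partial>\<mu>) + (\<integral>x. D i x \<bullet> I (D j x) \<partial>\<mu>)"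
      by (rule Bochner_Integration.integral_add[OF int[OF c1] int[OF c2]])
    finally show ?thesis by simp
  qed
  have W: "W = - T"
  proof -
    let ?h23 = "\<lambda>x. h x \<bullet> I (killing_deriv (Q 2) (D 3) x)"
    let ?h32 = "\<lambda>x. h x \<bullet> I (killing_deriv (Q 3) (D 2) x)"
    have c: "continuous_on M ?h23" "continuous_on M ?h32"
      by (intro continuous_intros ch bounded_linear.continuous_on[OF I(1)] continuous_on_killing_deriv[OF J sD])+
    have "(\<integral>x. D 3 x \<bullet> I (D 2 x) \<partial>\<mu>) = - W"
      unfolding W_def using skew[of "D 2 _" "D 3 _"] by (simp add: inner_commute)
    then have "2 * W = (\<integral>x. ?h32 x \<partial>\<mu>) - (\<integral>x. ?h23 x \<partial>\<mu>)"
      using parts[of 2 3] parts[of 3 2] by (simp add: W_def)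
    also have "\<dots> = (\<integral>x. ?h32 x - ?h23 x \<partial>\<mu>)"
      by (rule Bochner_Integration.integral_diff[symmetric, OF int[OF c(2)] int[OF c(1)]])
    also have "\<dots> = (\<integral>x. - 2 * (I (h x) \<bullet> D 1 x) \<partial>\<mu>)"
    proof (intro Bochner_Integration.integral_cong refl)
      fix x assume "x \<in> space \<mu>"
      then have x: "x \<in> M" by (simp add: space_\<mu>)
      have "?h32 x - ?h23 x = h x \<bullet> I (killing_deriv (Q 3) (D 2) x - killing_deriv (Q 2) (D 3) x)"
        by (simp add: linear_diff[OF bounded_linear.linear[OF I(1)]] inner_diff_right)
      also have "\<dots> = 2 * (h x \<bullet> I (D 1 x))"
        unfolding D_def killing_deriv_commutator[OF h x]
        by (simp add: linear_cmul[OF bounded_linear.linear[OF I(1)]])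
      finally show "?h32 x - ?h23 x = - 2 * (I (h x) \<bullet> D 1 x)" by (simp add: skew)
    qed
    also have "\<dots> = - 2 * T" unfolding T_def by (rule integral_mult_right_zero)
    finally show ?thesis by simp
  qed
  have "0 \<le> (\<integral>x. (norm (D 2 x + I (D 3 x)))\<^sup>2 \<partial>\<mu>)" by (rule integral_nonneg_AE) simp
  also have "\<dots> = (\<integral>x. D 2 x \<bullet> D 2 x + D 3 x \<bullet> D 3 x + 2 * (D 2 x \<bullet> I (D 3 x)) \<partial>\<mu>)"
  proof (intro Bochner_Integration.integral_cong refl)
    fix x
    have "I (D 3 x) \<bullet> I (D 3 x) = D 3 x \<bullet> D 3 x" using I(3)[of "D 3 x"] by (simp add: norm_eq)
    then show "(norm (D 2 x + I (D 3 x)))\<^sup>2 = D 2 x \<bullet> D 2 x + D 3 x \<bullet> D 3 x + 2 * (D 2 x \<bullet> I (D 3 x))"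
      by (simp add: power2_norm_eq_inner inner_add inner_commute[of "I (D 3 x)" "D 2 x"])
  qed
  also have "\<dots> = (\<integral>x. D 2 x \<bullet> D 2 x \<partial>\<mu>) + (\<integral>x. D 3 x \<bullet> D 3 x \<partial>\<mu>) + 2 * W"
    unfolding W_def
    by (simp add: Bochner_Integration.integral_add int continuous_intros cD cID)
  finally show ?thesis
    using circle unfolding W T_def sum_3 power2_norm_eq_inner D_def by linarith
qed

end

section \<open>The Kaehler calibration in coordinate-free form\<close>

abbreviation imul :: "complex^3 \<Rightarrow> complex^3" where "imul v \<equiv> \<i> *s v"

lemma scaleR_eq_smult: "r *\<^sub>R (v :: complex^'n) = complex_of_real r *s v"
  unfolding vec_eq_iff
proof
  fix i show "(r *\<^sub>R v) $ i = (complex_of_real r *s v) $ i"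
    unfolding vector_scaleR_component vector_smult_component by (rule scaleR_conv_of_real)
qed

lemma linear_imul: "linear imul"
  by (rule linearI) (simp_all add: vec_eq_iff algebra_simps)

lemma imul_inner: "imul v \<bullet> w = - (v \<bullet> imul w)"
  by (simp add: inner_vec_def sum_negf[symmetric] inner_complex_def algebra_simps)

lemma imul_orthogonal: "imul v \<bullet> v = 0"
  by (simp add: inner_vec_def inner_complex_def mult.commute)

lemma imul_imul: "imul (imul v) = - v"
  by (simp add: vec_eq_iff vector_smult_assoc[symmetric])

lemma norm_imul: "norm (imul v) = norm v"
  by (simp add: norm_eq_sqrt_inner imul_inner imul_imul)

lemma sum_permutes_2: "sum f {p. p permutes {..<2::nat}} = f id + f (Transposition.transpose 0 (Suc 0))"
proof -
  have "{..<2::nat} = {0, 1}" by auto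
  then show ?thesis
    by (simp add: sum_over_permutations_insert permutes_sing)
qed

lemma wedge_1_1: "wedge 1 1 \<alpha> \<beta> [v, w] = \<alpha> [v] * \<beta> [w] - \<alpha> [w] * \<beta> [v]"
  unfolding wedge_def one_add_one sum_permutes_2
  by (simp add: sign_swap_id sign_id)

lemma kahler_form_eq: "kahler_form [v, w] = imul v \<bullet> w"
  unfolding kahler_form_def wedge_1_1 dx_def
  by (simp add: inner_vec_def sum_3 inner_complex_def)

text \<open>The 24 permutations, as products of transpositions.\<close>

lemma sum_permutes_4:
  "sum f {p. p permutes {..<4::nat}} = (\<Sum>b\<in>{0, 1, 2, 3}. \<Sum>c\<in>{1, 2, 3}. \<Sum>d\<in>{2, 3}.
    f (Transposition.transpose 0 b \<circ> (Transposition.transpose 1 c \<circ> Transposition.transpose 2 d)))"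
proof -
  have e: "{..<4::nat} = {0, 1, 2, 3}" by auto
  have s: "finite {1, 2, 3::nat}" "0 \<notin> {1, 2, 3::nat}" "finite {2, 3::nat}" "1 \<notin> {2, 3::nat}"
    "finite {3::nat}" "2 \<notin> {3::nat}" by auto
  have 1: "{p. p permutes {3::nat}} = {id}" by (auto simp: permutes_sing)
  show ?thesis
    unfolding e sum_over_permutations_insert[OF s(1,2)] sum_over_permutations_insert[OF s(3,4)]
      sum_over_permutations_insert[OF s(5,6)] 1 by simp
qed

lemma wedge_2_2:
  assumes "\<And>v w. \<omega> [v, w] = - \<omega> [w, v]"
  shows "wedge 2 2 \<omega> \<omega> [a, b, c, d] = 2 * (\<omega> [a, b] * \<omega> [c, d] - \<omega> [a, c] * \<omega> [b, d] + \<omega> [a, d] * \<omega> [b, c])"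
proof -
  define vs where "vs = [a, b, c, d]"
  have n: "vs ! 0 = a" "vs ! 1 = b" "vs ! 2 = c" "vs ! 3 = d" "vs ! Suc 0 = b" by (simp_all add: vs_def)
  have m: "map h [0..<2] = [h 0, h 1]" for h :: "nat \<Rightarrow> 'a" by (simp add: numeral_2_eq_2)
  have sgn: "sign (Transposition.transpose x x' \<circ> (Transposition.transpose y y' \<circ> Transposition.transpose z z'))
      = (if x = x' then 1 else - 1) * ((if y = y' then 1 else - 1) * (if z = z' then 1 else - 1))" for x x' y y' z z' :: nat
    by (simp add: sign_compose sign_swap_id permutation_compose permutation_swap_id)
  have "(\<Sum>p | p permutes {..<2 + 2}. of_int (sign p) * \<omega> (map (\<lambda>i. vs ! p i) [0..<2]) * \<omega> (map (\<lambda>i. vs ! p (2 + i)) [0..<2]))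
      = 8 * (\<omega> [a, b] * \<omega> [c, d] - \<omega> [a, c] * \<omega> [b, d] + \<omega> [a, d] * \<omega> [b, c])"
    unfolding m numeral_plus_numeral semiring_norm sum_permutes_4 sgn
    using assms[of b a] assms[of c a] assms[of d a] assms[of c b] assms[of d b] assms[of d c]
    by (simp add: Transposition.transpose_def n)
  then show ?thesis
    unfolding wedge_def vs_def[symmetric] by (simp add: fact_2)
qed

lemma kahler_calibration_eq:
  "kahler_calibration [a, b, c, d] =
    (imul a \<bullet> b) * (imul c \<bullet> d) - (imul a \<bullet> c) * (imul b \<bullet> d) + (imul a \<bullet> d) * (imul b \<bullet> c)"
proof -
  have "kahler_form [v, w] = - kahler_form [w, v]" for v w
    unfolding kahler_form_eq by (metis imul_inner inner_commute)
  from wedge_2_2[of kahler_form, OF this] show ?thesis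
    unfolding kahler_calibration_def by (simp add: kahler_form_eq)
qed

section \<open>A quaternionic structure on a complex plane\<close>

definition herm :: "complex^3 \<Rightarrow> complex^3 \<Rightarrow> complex" where
  "herm x y = (\<Sum>k\<in>UNIV. x $ k * cnj (y $ k))"

lemma herm_add: "herm (x + y) z = herm x z + herm y z"
  and herm_diff: "herm (x - y) z = herm x z - herm y z"
  and herm_smult: "herm (u *s x) z = u * herm x z" and herm_smult_right: "herm x (u *s z) = cnj u * herm x z"
  by (simp_all add: herm_def sum.distrib sum_subtractf sum_distrib_left algebra_simps)

lemma inner_eq_herm: "x \<bullet> y = Re (herm x y)"
  by (simp add: herm_def inner_vec_def inner_complex_def)

lemma herm_self: "herm x x = complex_of_real ((norm x)\<^sup>2)"
proof -
  have "herm x x = (\<Sum>k\<in>UNIV. complex_of_real ((cmod (x $ k))\<^sup>2))"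
    unfolding herm_def by (intro sum.cong refl) (simp only: complex_norm_square)
  then show ?thesis by (simp add: norm_vec_def L2_set_def sum_nonneg)
qed

lemma herm_cnj: "herm y x = cnj (herm x y)"
  by (simp add: herm_def mult.commute)

text \<open>Gram-Schmidt for a complex basis of two vectors.\<close>

lemma unitary_basis:
  assumes V: "vec.subspace V" "vec.dim V = 2"
  obtains a b :: "complex^3" where "herm a a = 1" "herm b b = 1" "herm a b = 0" "herm b a = 0"
    "V = range (\<lambda>(z, w). z *s a + w *s b)"
proof -
  obtain B where B: "B \<subseteq> V" "vec.independent B" "V \<subseteq> vec.span B" "card B = 2"
    using vec.basis_exists[of V] V(2) by metis
  obtain v1 v2 where v: "B = {v1, v2}" "v1 \<noteq> v2" using B(4) by (auto simp: card_2_iff)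
  have v1: "v1 \<noteq> 0" using B(2) v vec.dependent_zero by auto
  define a where "a = complex_of_real (inverse (norm v1)) *s v1"
  have a: "herm a a = 1"
    using v1 by (simp only: herm_self a_def scaleR_eq_smult[symmetric]) simp
  define b' where "b' = v2 - herm v2 a *s a"
  have b'0: "b' \<noteq> 0"
  proof
    assume "b' = 0"
    then have "v2 = (herm v2 a * complex_of_real (inverse (norm v1))) *s v1"
      by (simp add: b'_def a_def vector_smult_assoc)
    then have "v2 \<in> vec.span {v1}" by (metis vec.span_base vec.span_scale singletonI)
    then show False using B(2) v vec.independent_insert[of v2 "{v1}"] by (simp add: insert_commute)
  qed
  have b'a: "herm b' a = 0" by (simp add: b'_def herm_diff herm_smult a)
  define b where "b = complex_of_real (inverse (norm b')) *s b'"
  have b: "herm b b = 1"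
    using b'0 by (simp only: herm_self b_def scaleR_eq_smult[symmetric]) simp
  have ba: "herm b a = 0" by (simp add: b_def herm_smult b'a)
  have ab: "herm a b = 0" using herm_cnj[of a b] ba by simp
  have aV: "a \<in> V" and v2V: "v2 \<in> V" using B v V(1) by (auto simp: a_def vec.subspace_scale)
  then have bV: "b \<in> V" using V(1) by (auto simp: b_def b'_def intro: vec.subspace_scale vec.subspace_diff)
  have "v1 = complex_of_real (norm v1) *s a + 0 *s b" using v1 by (simp add: a_def vector_smult_assoc)
  moreover have "v2 = herm v2 a *s a + complex_of_real (norm b') *s b"
    using b'0 by (simp add: b_def vector_smult_assoc) (simp add: b'_def)
  ultimately have gen: "v1 \<in> vec.span {a, b}" "v2 \<in> vec.span {a, b}"
    by (metis insertI1 insertI2 vec.span_add vec.span_base vec.span_scale)+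
  have "V = range (\<lambda>(z, w). z *s a + w *s b)"
  proof (intro equalityI subsetI)
    fix x assume "x \<in> V"
    then have "x \<in> vec.span {v1, v2}" using B v by auto
    moreover have "vec.span {v1, v2} \<subseteq> vec.span {a, b}"
      using gen by (intro vec.span_minimal vec.subspace_span) auto
    ultimately have "x \<in> vec.span {a, b}" by blast
    then obtain z w where "x - z *s a = w *s b"
      by (auto simp: vec.span_breakdown_eq vec.span_singleton)
    then have "x = z *s a + w *s b" by (simp add: algebra_simps)
    then show "x \<in> range (\<lambda>(z, w). z *s a + w *s b)" by force
  next
    fix x assume "x \<in> range (\<lambda>(z, w). z *s a + w *s b)"
    then show "x \<in> V" using aV bV V(1) by (auto intro!: vec.subspace_add vec.subspace_scale)
  qed
  then show ?thesis using that a b ab ba by blast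
qed

text \<open>In the coordinates \<open>(z, w)\<close> of a unitary basis, the quaternions \<open>\<i>\<close>, \<open>j : (z, w) \<mapsto> (- cnj w, cnj z)\<close>
  and \<open>\<i> j\<close>.\<close>

definition plane_quaternion :: "complex^3 \<Rightarrow> complex^3 \<Rightarrow> 3 \<Rightarrow> complex^3 \<Rightarrow> complex^3" where
  "plane_quaternion a b i x =
    (let j = - cnj (herm x b) *s a + cnj (herm x a) *s b
     in if i = 1 then imul x else if i = 2 then j else imul j)"

lemma quaternionic_sphere_complex_plane:
  assumes V: "vec.subspace V" "vec.dim V = 2" and c: "c \<in> V" and r: "r > 0" and M: "M = sphere c r \<inter> V"
  obtains Q where "quaternionic_sphere V c r M Q" "Q 1 = imul"
proof -
  obtain a b where ab: "herm a a = 1" "herm b b = 1" "herm a b = 0" "herm b a = 0"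
    and VL: "V = range (\<lambda>(z, w). z *s a + w *s b)"
    using unitary_basis[OF V] by metis
  define L where "L z w = z *s a + w *s b" for z w
  have V_iff: "x \<in> V \<longleftrightarrow> (\<exists>z w. x = L z w)" for x by (auto simp: VL L_def)
  have LV: "L z w \<in> V" for z w using V_iff by blast
  have hL: "herm (L z w) a = z" "herm (L z w) b = w" for z w
    by (simp_all add: L_def herm_add herm_smult ab)
  have smL: "u *s L z w = L (u * z) (u * w)" for u z w
    by (simp add: L_def vector_add_ldistrib vector_smult_assoc)
  have addL: "L z w + L z' w' = L (z + z') (w + w')" for z w z' w'
    by (simp add: L_def vec_eq_iff algebra_simps)
  have scL: "s *\<^sub>R L z w = L (complex_of_real s * z) (complex_of_real s * w)" for s z w
    by (simp add: scaleR_eq_smult smL)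
  have inL: "L z w \<bullet> L z' w' = Re (z * cnj z' + w * cnj w')" for z w z' w'
  proof -
    have "herm (L z w) (L z' w') = cnj (herm (z' *s a + w' *s b) (L z w))"
      unfolding L_def[of z'] by (rule herm_cnj)
    also have "\<dots> = cnj (z' * cnj (herm (L z w) a) + w' * cnj (herm (L z w) b))"
      unfolding herm_add herm_smult using herm_cnj[of a "L z w"] herm_cnj[of b "L z w"] by simp
    finally show ?thesis by (simp add: inner_eq_herm hL mult.commute)
  qed
  define Q where "Q = plane_quaternion a b"
  have Q1: "Q 1 = imul" by (rule ext) (simp add: Q_def plane_quaternion_def)
  have QL: "Q 1 (L z w) = L (\<i> * z) (\<i> * w)" "Q 2 (L z w) = L (- cnj w) (cnj z)" "Q 3 (L z w) = L (- \<i> * cnj w) (\<i> * cnj z)" for z w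
    by (simp_all add: Q1 smL) (simp_all add: Q_def plane_quaternion_def hL, simp_all add: L_def vec_eq_iff algebra_simps)
  have "quaternionic_sphere V c r M Q"
  proof
    show sub: "subspace V"
      using V(1) by (auto simp: subspace_def scaleR_eq_smult vec.subspace_0 vec.subspace_add vec.subspace_scale)
    show "dim V = 4"
    proof (rule dim_unique)
      let ?B = "{L 1 0, L \<i> 0, L 0 1, L 0 \<i>}"
      show "?B \<subseteq> V" by (auto simp: V_iff)
      have o: "L 1 0 \<bullet> L \<i> 0 = 0" "L 1 0 \<bullet> L 0 1 = 0" "L 1 0 \<bullet> L 0 \<i> = 0" "L \<i> 0 \<bullet> L 0 1 = 0"
        "L \<i> 0 \<bullet> L 0 \<i> = 0" "L 0 1 \<bullet> L 0 \<i> = 0" and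
        n: "L 1 0 \<bullet> L 1 0 = 1" "L \<i> 0 \<bullet> L \<i> 0 = 1" "L 0 1 \<bullet> L 0 1 = 1" "L 0 \<i> \<bullet> L 0 \<i> = 1"
        by (simp_all add: inL)
      have ne: "L 1 0 \<noteq> L \<i> 0" "L 1 0 \<noteq> L 0 1" "L 1 0 \<noteq> L 0 \<i>" "L \<i> 0 \<noteq> L 0 1" "L \<i> 0 \<noteq> L 0 \<i>" "L 0 1 \<noteq> L 0 \<i>"
        using o n by (metis zero_neq_one)+
      show "independent ?B"
      proof (rule pairwise_orthogonal_independent)
        show "pairwise orthogonal ?B"
          using o by (auto simp: pairwise_def orthogonal_def inner_commute)
        show "0 \<notin> ?B" using n by (metis inner_zero_left insertE emptyE zero_neq_one)
      qed
      show "card ?B = 4" using ne by simp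
      show "V \<subseteq> span ?B"
      proof
        fix x assume "x \<in> V"
        then obtain z w where x: "x = L z w" using V_iff by blast
        have "x = Re z *\<^sub>R L 1 0 + Im z *\<^sub>R L \<i> 0 + Re w *\<^sub>R L 0 1 + Im w *\<^sub>R L 0 \<i>"
          unfolding x scL addL by (simp add: mult.commute[of _ \<i>] complex_eq[symmetric])
        also have "\<dots> \<in> span ?B"
          by (intro span_add span_mul) (auto intro: span_base)
        finally show "x \<in> span ?B" .
      qed
    qed
    have lin: "linear (Q i)" for i
      unfolding Q_def plane_quaternion_def
      by (rule linearI) (auto simp: Let_def herm_add herm_smult scaleR_eq_smult vec_eq_iff algebra_simps)
    show "Q i (x + y) = Q i x + Q i y" "Q i (s *\<^sub>R x) = s *\<^sub>R Q i x" for i x y s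
      using linear_add[OF lin] linear_cmul[OF lin] by auto
    fix x i j
    assume "x \<in> V"
    then obtain z w where x: "x = L z w" using V_iff by blast
    note i = exhaust_3[of i] and j = exhaust_3[of j]
    show "Q i x \<in> V" using i LV by (auto simp: x QL)
    show "Q i x \<bullet> x = 0" using i by (auto simp: x QL inL algebra_simps)
    show "Q i (Q j x) + Q j (Q i x) = (if i = j then - 2 else 0) *\<^sub>R x"
      using i j unfolding x scL by (elim disjE; simp only: QL addL; simp)
    show "Q 2 (Q 3 x) = Q 1 x" by (simp add: x QL)
  qed (use c r M in auto)
  then show ?thesis using Q1 by (rule that)
qed

section \<open>Stability\<close>

lemma sum_lessThan_3: "(\<Sum>i<3::nat. g i) = g 0 + g 1 + (g 2 :: 'b::comm_monoid_add)"
  by (simp add: numeral_3_eq_3 numeral_2_eq_2)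

lemma length_3: "length vs = 3 \<Longrightarrow> \<exists>x y z. vs = [x, y, z]"
  by (auto simp: numeral_3_eq_3 length_Suc_conv)

context quaternionic_sphere
begin

lemma frame_expansion_tangent:
  assumes p: "p \<in> M" and es: "orthonormal_frame M p es" and n: "n = (- 1 / r) *\<^sub>R (p - c)" and v: "v \<in> V"
  shows "v = (v \<bullet> n) *\<^sub>R n + (\<Sum>i<3. (v \<bullet> es ! i) *\<^sub>R es ! i)"
    and "v \<bullet> w = (v \<bullet> n) * (n \<bullet> w) + (\<Sum>i<3. (v \<bullet> es ! i) * (es ! i \<bullet> w))"
proof -
  have nV: "n \<in> V" and nn: "n \<bullet> n = 1"
    using p r_pos subspace_V inner_radius[OF p] by (auto simp: n mem_M power2_eq_square intro: subspace_mul subspace_neg)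
  have pn: "p - c = (- r) *\<^sub>R n" using r_pos by (simp add: n)
  let ?u = "v - (v \<bullet> n) *\<^sub>R n"
  have u: "?u \<in> tangent_space M p"
    unfolding tangent_space_M[OF p] using v nV nn subspace_V
    by (auto simp: pn inner_diff_left intro: subspace_diff subspace_mul)
  have "n \<bullet> es ! i = 0" if "i < 3" for i
  proof -
    have "es ! i \<in> tangent_space M p" using es that by (auto simp: orthonormal_frame_def subset_eq)
    then show ?thesis using r_pos by (simp add: tangent_space_M[OF p] pn inner_commute)
  qed
  then have "(\<Sum>i<3. (?u \<bullet> es ! i) *\<^sub>R es ! i) = (\<Sum>i<3. (v \<bullet> es ! i) *\<^sub>R es ! i)"
    by (intro sum.cong refl) (simp add: inner_diff_left)
  then have "?u = (\<Sum>i<3. (v \<bullet> es ! i) *\<^sub>R es ! i)"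
    using orthonormal_frame_M(1)[OF p es u] by simp
  then show 1: "v = (v \<bullet> n) *\<^sub>R n + (\<Sum>i<3. (v \<bullet> es ! i) *\<^sub>R es ! i)"
    by (simp add: algebra_simps)
  have "v \<bullet> w = ((v \<bullet> n) *\<^sub>R n + (\<Sum>i<3. (v \<bullet> es ! i) *\<^sub>R es ! i)) \<bullet> w"
    using 1 by (rule arg_cong)
  then show "v \<bullet> w = (v \<bullet> n) * (n \<bullet> w) + (\<Sum>i<3. (v \<bullet> es ! i) * (es ! i \<bullet> w))"
    by (simp only: inner_add_left inner_sum_left inner_scaleR_left)
qed

text \<open>Parseval for the change of basis to the orthonormal frame \<open>Q k (p - c) / r\<close>.\<close>

lemma norm_differential_frame:
  fixes f :: "'a \<Rightarrow> 'b::euclidean_space"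
  assumes f: "smooth_map M f" and p: "p \<in> M" and es: "orthonormal_frame M p es"
  shows "(\<Sum>i<3. (norm (tderiv M f p (es ! i)))\<^sup>2) = (\<Sum>k\<in>UNIV. (norm (killing_deriv (Q k) f p))\<^sup>2) / r\<^sup>2"
proof -
  let ?E = "\<lambda>k. Q k (p - c) /\<^sub>R r"
  let ?d = "\<lambda>v. tderiv M f p v"
  have fE: "frame ((p - c) /\<^sub>R r) ?E" by (rule radius_frame[OF p])
  have E: "?E k \<in> tangent_space M p" for k
    by (rule subspace_mul[OF subspace_tangent[OF p] Q_tangent[OF p]])
  have esT: "es ! i \<in> tangent_space M p" if "i < 3" for i
    using es that by (auto simp: orthonormal_frame_def subset_eq)
  have d_es: "?d (es ! i) = (\<Sum>k\<in>UNIV. (es ! i \<bullet> ?E k) *\<^sub>R ?d (?E k))" if "i < 3" for i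
  proof -
    have e: "es ! i \<in> V" "es ! i \<bullet> (p - c) = 0" using esT[OF that] by (auto simp: tangent_space_M[OF p])
    have "es ! i = (\<Sum>k\<in>UNIV. (es ! i \<bullet> ?E k) *\<^sub>R ?E k)"
      using frame_expansion[OF fE e(1)] e(2) by simp
    then have "?d (es ! i) = ?d (\<Sum>k\<in>UNIV. (es ! i \<bullet> ?E k) *\<^sub>R ?E k)" by (rule arg_cong)
    then show ?thesis unfolding tderiv_sum[OF f p subspace_tangent[OF p] E] .
  qed
  have orth: "(\<Sum>i<3. (es ! i \<bullet> ?E k) * (es ! i \<bullet> ?E l)) = (if k = l then 1 else 0)" for k l
  proof -
    have "?E k \<bullet> ?E l = (\<Sum>i<3. (?E k \<bullet> es ! i) * (?E l \<bullet> es ! i))"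
      by (rule orthonormal_frame_M(2)[OF p es E])
    moreover have "?E k \<bullet> ?E l = (if k = l then 1 else 0)" using fE unfolding frame_def by blast
    ultimately show ?thesis by (simp only: inner_commute[of "es ! _"])
  qed
  have "(\<Sum>i<3. (norm (?d (es ! i)))\<^sup>2)
      = (\<Sum>i<3. \<Sum>k\<in>UNIV. \<Sum>l\<in>UNIV. (es ! i \<bullet> ?E k) * (es ! i \<bullet> ?E l) * (?d (?E l) \<bullet> ?d (?E k)))"
    by (intro sum.cong refl)
      (simp only: lessThan_iff d_es power2_norm_eq_inner inner_sum_left inner_sum_right inner_scaleR_left
        inner_scaleR_right sum_distrib_left mult.assoc)
  also have "\<dots> = (\<Sum>k\<in>UNIV. \<Sum>l\<in>UNIV. (\<Sum>i<3. (es ! i \<bullet> ?E k) * (es ! i \<bullet> ?E l)) * (?d (?E l) \<bullet> ?d (?E k)))"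
    by (subst sum.swap, intro sum.cong refl, subst sum.swap) (simp only: sum_distrib_right)
  also have "\<dots> = (\<Sum>k\<in>UNIV. \<Sum>l\<in>UNIV. if l = k then ?d (?E k) \<bullet> ?d (?E k) else 0)"
    unfolding orth by (intro sum.cong refl) auto
  also have "\<dots> = (\<Sum>k\<in>UNIV. ?d (?E k) \<bullet> ?d (?E k))" by simp
  also have "\<dots> = (\<Sum>k\<in>UNIV. (norm (killing_deriv (Q k) f p))\<^sup>2 / r\<^sup>2)"
  proof (intro sum.cong refl)
    fix k
    have "?d (?E k) = inverse r *\<^sub>R killing_deriv (Q k) f p"
      using tderiv_sum[OF f p subspace_tangent[OF p], of "{k}" "\<lambda>k. Q k (p - c)" "\<lambda>_. inverse r"] Q_tangent[OF p]
      by (simp add: killing_deriv_def)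
    then show "?d (?E k) \<bullet> ?d (?E k) = (norm (killing_deriv (Q k) f p))\<^sup>2 / r\<^sup>2"
      unfolding power2_norm_eq_inner by (simp add: power2_eq_square divide_inverse)
  qed
  finally show ?thesis by (simp add: sum_divide_distrib)
qed

end

locale complex_sphere = quaternionic_sphere V c r M Q
  for V :: "(complex^3) set" and c r M Q +
  assumes Q_1: "Q 1 = imul"
begin

lemma imul_in_V: "v \<in> V \<Longrightarrow> imul v \<in> V"
  using Q_in_V[of v 1] by (simp add: Q_1)

lemma imul_perp:
  assumes "w \<in> orthogonal_comp V" shows "imul w \<in> orthogonal_comp V"
proof -
  have "v \<bullet> imul w = 0" if "v \<in> V" for v
    using assms imul_in_V[OF that] imul_inner[of v w] by (simp add: orthogonal_comp_def orthogonal_def)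
  then show ?thesis by (simp add: orthogonal_comp_def orthogonal_def)
qed

text \<open>Write \<open>a\<^sub>i = \<varpi>(\<nu>, e\<^sub>i)\<close> and \<open>b\<^sub>i = \<varpi>(e\<^sub>j, e\<^sub>k)\<close> for cyclic \<open>i, j, k\<close>. Both vectors have unit length and
  they are parallel, because \<open>\<i> \<nu> = \<Sum> a\<^sub>i e\<^sub>i\<close> and \<open>\<i> (\<i> \<nu>) = - \<nu>\<close> is orthogonal to the frame. As
  \<open>\<Omega>(\<nu>, e\<^sub>1, e\<^sub>2, e\<^sub>3) = a \<bullet> b\<close>, its value is \<open>1\<close> or \<open>- 1\<close>, and in the first case \<open>a = b\<close>.\<close>

lemma calibration_frame:
  assumes p: "p \<in> M" and es: "orthonormal_frame M p [x, y, z]" and n: "n = (- 1 / r) *\<^sub>R (p - c)"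
  shows "(kahler_calibration [n, x, y, z])\<^sup>2 = 1"
    and "kahler_calibration [n, x, y, z] = 1 \<Longrightarrow>
      imul y \<bullet> z = imul n \<bullet> x \<and> imul z \<bullet> x = imul n \<bullet> y \<and> imul x \<bullet> y = imul n \<bullet> z"
proof -
  define a0 a1 a2 where a_def: "a0 = imul n \<bullet> x" "a1 = imul n \<bullet> y" "a2 = imul n \<bullet> z"
  define b0 b1 b2 where b_def: "b0 = imul y \<bullet> z" "b1 = imul z \<bullet> x" "b2 = imul x \<bullet> y"
  have T: "x \<in> tangent_space M p" "y \<in> tangent_space M p" "z \<in> tangent_space M p"
    using es by (auto simp: orthonormal_frame_def)
  then have inV: "x \<in> V" "y \<in> V" "z \<in> V" by (auto simp: tangent_space_M[OF p])
  have on: "[x, y, z] ! i \<bullet> [x, y, z] ! j = (if i = j then 1 else 0)" if "i < 3" "j < 3" for i j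
    using es that by (auto simp: orthonormal_frame_def)
  have unit: "x \<bullet> x = 1" "y \<bullet> y = 1" "z \<bullet> z = 1"
    using on[of 0 0] on[of 1 1] on[of 2 2] by auto
  have nV: "n \<in> V" and nn: "n \<bullet> n = 1"
    using p r_pos subspace_V inner_radius[OF p] by (auto simp: n mem_M power2_eq_square intro: subspace_mul subspace_neg)
  have nx: "n \<bullet> x = 0" "n \<bullet> y = 0" "n \<bullet> z = 0"
    using T by (auto simp: n tangent_space_M[OF p] inner_commute)
  have anti: "imul u \<bullet> v = - (imul v \<bullet> u)" for u v by (metis imul_inner inner_commute)
  have II: "imul u \<bullet> imul v = u \<bullet> v" for u v by (simp add: imul_inner imul_imul)
  note ex = frame_expansion_tangent(2)[OF p es n, unfolded sum_lessThan_3]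
  have s: "imul u \<bullet> imul u = (imul u \<bullet> n)\<^sup>2 + (imul u \<bullet> x)\<^sup>2 + (imul u \<bullet> y)\<^sup>2 + (imul u \<bullet> z)\<^sup>2" if "u \<in> V" for u
    using ex[OF imul_in_V[OF that], of "imul u"]
    by (simp add: power2_eq_square inner_commute[of n "imul u"] inner_commute[of x "imul u"]
        inner_commute[of y "imul u"] inner_commute[of z "imul u"])
  have "a0\<^sup>2 + a1\<^sup>2 + a2\<^sup>2 = 1"
    using s[OF nV] by (simp add: a_def II nn imul_orthogonal)
  moreover have "b2\<^sup>2 + b1\<^sup>2 + a0\<^sup>2 = 1"
    using s[OF inV(1)] anti[of x n] anti[of x z] by (simp add: a_def b_def II unit imul_orthogonal)
  moreover have "b2\<^sup>2 + b0\<^sup>2 + a1\<^sup>2 = 1"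
    using s[OF inV(2)] anti[of y n] anti[of y x] by (simp add: a_def b_def II unit imul_orthogonal)
  moreover have "b1\<^sup>2 + b0\<^sup>2 + a2\<^sup>2 = 1"
    using s[OF inV(3)] anti[of z n] anti[of z y] by (simp add: a_def b_def II unit imul_orthogonal)
  ultimately have ab: "a0\<^sup>2 + a1\<^sup>2 + a2\<^sup>2 = 1" "b0\<^sup>2 + b1\<^sup>2 + b2\<^sup>2 = 1" by linarith+
  have par: "0 = a0 * (imul x \<bullet> v) + a1 * (imul y \<bullet> v) + a2 * (imul z \<bullet> v)" if "v \<in> {x, y, z}" for v
  proof -
    have "imul n \<bullet> imul v = (imul n \<bullet> n) * (n \<bullet> imul v) + (a0 * (x \<bullet> imul v) + a1 * (y \<bullet> imul v) + a2 * (z \<bullet> imul v))"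
      using ex[OF imul_in_V[OF nV], of "imul v"] by (simp add: a_def)
    moreover have "n \<bullet> v = 0" using that nx by auto
    ultimately show ?thesis
      by (simp add: II imul_orthogonal) (simp add: imul_inner)
  qed
  have cross: "a2 * b1 = a1 * b2" "a0 * b2 = a2 * b0" "a1 * b0 = a0 * b1"
    using par[of x] par[of y] par[of z] anti[of y x] anti[of z y] anti[of x z]
    by (simp_all add: b_def imul_orthogonal)
  have \<Omega>: "kahler_calibration [n, x, y, z] = a0 * b0 + a1 * b1 + a2 * b2"
    using anti[of x z] by (simp add: kahler_calibration_eq a_def b_def)
  have "(a0 * b0 + a1 * b1 + a2 * b2)\<^sup>2 = (a0\<^sup>2 + a1\<^sup>2 + a2\<^sup>2) * (b0\<^sup>2 + b1\<^sup>2 + b2\<^sup>2)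
      - (a2 * b1 - a1 * b2)\<^sup>2 - (a0 * b2 - a2 * b0)\<^sup>2 - (a1 * b0 - a0 * b1)\<^sup>2"
    by (simp add: power2_eq_square algebra_simps)
  then show "(kahler_calibration [n, x, y, z])\<^sup>2 = 1"
    unfolding \<Omega> by (simp add: ab cross)
  assume "kahler_calibration [n, x, y, z] = 1"
  then have "(b0 - a0)\<^sup>2 + (b1 - a1)\<^sup>2 + (b2 - a2)\<^sup>2 = 0"
    using ab unfolding \<Omega> by (simp add: power2_eq_square algebra_simps)
  then have "b0 = a0 \<and> b1 = a1 \<and> b2 = a2"
    by (smt (verit) zero_le_power2 power2_eq_iff_nonneg power_zero_numeral zero_eq_power2 right_minus_eq)
  then show "imul y \<bullet> z = imul n \<bullet> x \<and> imul z \<bullet> x = imul n \<bullet> y \<and> imul x \<bullet> y = imul n \<bullet> z"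
    by (simp add: a_def b_def)
qed

text \<open>A positive multiple of the contraction of the calibration with \<open>\<nu>\<close>. It depends on \<open>p\<close> by an affine
  map, hence smoothly.\<close>

definition calibrating_form :: "complex^3 \<Rightarrow> (complex^3) list \<Rightarrow> real" where
  "calibrating_form p vs = kahler_calibration ((c - p) # vs)"

lemma alternating_calibrating_form: "alternating_form 3 (calibrating_form p)"
proof -
  have ii: "i = 0 \<or> i = 1 \<or> i = 2" if "i < 3" for i :: nat using that by auto
  have anti: "imul u \<bullet> v = - (imul v \<bullet> u)" for u v by (metis imul_inner inner_commute)
  have add: "imul (u + v) = imul u + imul v" and scale: "imul (s *\<^sub>R u) = s *\<^sub>R imul u" for u v s
    using linear_add[OF linear_imul] linear_cmul[OF linear_imul] by auto
  show ?thesis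
    unfolding alternating_form_def
  proof (intro conjI allI impI)
    fix vs :: "(complex^3) list" and i :: nat
    assume "length vs = 3 \<and> i < 3"
    then obtain x y z where vs: "vs = [x, y, z]" and i: "i = 0 \<or> i = 1 \<or> i = 2" using length_3 ii by blast
    show "linear (\<lambda>v. calibrating_form p (vs[i := v]))"
      by (rule linearI)
        (use i in \<open>auto simp: vs calibrating_form_def kahler_calibration_eq add scale inner_add algebra_simps\<close>)
  next
    fix vs :: "(complex^3) list" and i j :: nat
    assume a: "length vs = 3 \<and> i < j \<and> j < 3 \<and> vs ! i = vs ! j"
    then obtain x y z where vs: "vs = [x, y, z]" using length_3 by blast
    have "i = 0 \<and> j = 1 \<or> i = 0 \<and> j = 2 \<or> i = 1 \<and> j = 2" using a by auto
    then show "calibrating_form p vs = 0"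
      using a anti[of z y] by (auto simp: vs calibrating_form_def kahler_calibration_eq imul_orthogonal)
  qed
qed

lemma calibrating_form_eq:
  assumes "p \<in> M" shows "calibrating_form p [x, y, z] = r * kahler_calibration [(- 1 / r) *\<^sub>R (p - c), x, y, z]"
proof -
  have e: "c - p = r *\<^sub>R ((- 1 / r) *\<^sub>R (p - c))" using r_pos by simp
  show ?thesis
    unfolding calibrating_form_def kahler_calibration_eq e linear_cmul[OF linear_imul]
    by (simp add: algebra_simps)
qed

lemma orientation_calibrating_form: "orientation M calibrating_form"
  unfolding orientation_def
proof (intro conjI ballI allI impI)
  fix vs :: "(complex^3) list" assume "length vs = 3"
  then obtain x y z where vs: "vs = [x, y, z]" using length_3 by blast
  have bi: "bounded_linear imul" using linear_imul linear_conv_bounded_linear by blast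
  have "smooth_on UNIV (\<lambda>p. calibrating_form p vs)"
    unfolding vs calibrating_form_def kahler_calibration_eq
    by (intro smooth_on_add smooth_on_diff smooth_on_mult smooth_on_inner_left smooth_on_const
        smooth_on_compose_linear[OF bi] smooth_on_id open_UNIV)
  then show "smooth_map M (\<lambda>p. calibrating_form p vs)" by (rule smooth_mapI[OF open_UNIV subset_UNIV])
next
  fix p es assume p: "p \<in> M" and es: "orthonormal_frame M p es"
  obtain x y z where xyz: "es = [x, y, z]" using es length_3 unfolding orthonormal_frame_def by blast
  show "calibrating_form p es \<noteq> 0"
    using calibration_frame(1)[OF p es[unfolded xyz] refl] r_pos
    unfolding xyz calibrating_form_eq[OF p] by auto
qed (rule alternating_calibrating_form)

lemma calibrated_calibrating_form: "calibrated_extended_tangent kahler_calibration M calibrating_form"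
  unfolding calibrated_extended_tangent_def direct_frame_def
proof (intro ballI allI impI)
  fix p es assume p: "p \<in> M" and es: "orthonormal_frame M p es \<and> calibrating_form p es > 0"
  obtain x y z where xyz: "es = [x, y, z]" using es length_3 unfolding orthonormal_frame_def by blast
  have "0 < kahler_calibration [(- 1 / r) *\<^sub>R (p - c), x, y, z]"
    using es r_pos unfolding xyz calibrating_form_eq[OF p] by (simp add: zero_less_mult_iff)
  then show "kahler_calibration (unit_mean_curvature M p # es) = 1"
    using calibration_frame(1)[OF p conjunct1[OF es, unfolded xyz] refl]
    unfolding xyz unit_mean_curvature_M[OF p] by (simp add: power2_eq_1_iff)
qed

text \<open>The normal bundle is spanned by \<open>\<nu>\<close> and the constant complex line orthogonal to \<open>V\<close>, and both
  are parallel for the normal connection.\<close>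

lemma normal_connection_twisted:
  assumes f: "smooth_map M f" and w: "smooth_map M w" and perp: "\<And>x. x \<in> M \<Longrightarrow> w x \<in> orthogonal_comp V"
    and W: "W = (\<lambda>x. f x *\<^sub>R unit_mean_curvature M x + w x)"
    and p: "p \<in> M" and v: "v \<in> tangent_space M p"
  shows "normal_connection M W p v = tderiv M f p v *\<^sub>R unit_mean_curvature M p + tderiv M w p v"
proof -
  obtain U g where U: "open U" "p \<in> U" "smooth_on U g" "\<And>x. x \<in> M \<inter> U \<Longrightarrow> f x = g x"
    "\<And>q v. q \<in> M \<inter> U \<Longrightarrow> v \<in> tangent_space M q \<Longrightarrow> tderiv M f q v = frechet_derivative g (at q) v"
    using smooth_map_local[OF f p] by metis
  obtain U' g' where U': "open U'" "p \<in> U'" "smooth_on U' g'" "\<And>x. x \<in> M \<inter> U' \<Longrightarrow> w x = g' x"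
    "\<And>q v. q \<in> M \<inter> U' \<Longrightarrow> v \<in> tangent_space M q \<Longrightarrow> tderiv M w q v = frechet_derivative g' (at q) v"
    using smooth_map_local[OF w p] by metis
  have "((\<lambda>x. g x *\<^sub>R ((- 1 / r) *\<^sub>R (x - c)) + g' x) has_derivative
      (\<lambda>h. g p *\<^sub>R ((- 1 / r) *\<^sub>R h) + frechet_derivative g (at p) h *\<^sub>R ((- 1 / r) *\<^sub>R (p - c))
        + frechet_derivative g' (at p) h)) (at p)"
    by (intro has_derivative_add has_derivative_scaleR smooth_onD_diff[OF U(3,2)] smooth_onD_diff[OF U'(3,2)])
      (auto intro!: derivative_eq_intros)
  then have "tderiv M W p v = g p *\<^sub>R ((- 1 / r) *\<^sub>R v)
      + frechet_derivative g (at p) v *\<^sub>R ((- 1 / r) *\<^sub>R (p - c)) + frechet_derivative g' (at p) v"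
    by (rule tderiv_local[OF v _ open_Int[OF U(1) U'(1)]])
      (use U U' in \<open>auto simp: W unit_mean_curvature_M\<close>)
  then have d: "tderiv M W p v = (f p * (- 1 / r)) *\<^sub>R v + (tderiv M f p v * (- 1 / r)) *\<^sub>R (p - c) + tderiv M w p v"
    using U(2,4,5) U'(2,5) p v by simp
  have "normal_connection M W p v = (tderiv M f p v * (- 1 / r)) *\<^sub>R (p - c) + tderiv M w p v"
    unfolding normal_connection_def
  proof (rule normal_part_M[OF p _ _ _ d])
    show "(f p * (- 1 / r)) *\<^sub>R v \<in> V" "((f p * (- 1 / r)) *\<^sub>R v) \<bullet> (p - c) = 0"
      using v subspace_V by (auto simp: tangent_space_M[OF p] intro: subspace_mul subspace_neg)
    show "tderiv M w p v \<in> orthogonal_comp V"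
      by (rule tderiv_in_subspace[OF w p v subspace_orthogonal_comp perp])
  qed
  then show ?thesis by (simp add: unit_mean_curvature_M[OF p])
qed

text \<open>In the calibration term, the parts with \<open>\<nu>\<close> in two slots vanish by alternation, and so do those in
  which exactly one vector is orthogonal to \<open>V\<close>. Only \<open>\<varpi>(w, \<nabla>\<^sub>i w) \<varpi>(e\<^sub>j, e\<^sub>k)\<close> survives, and by
  \<open>calibration_frame\<close> the sum over \<open>i\<close> involves the derivative of \<open>w\<close> in the direction \<open>\<i> \<nu>\<close>.\<close>

lemma jacobi_integrand_twisted:
  assumes f: "smooth_map M f" and w: "smooth_map M w" and perp: "\<And>x. x \<in> M \<Longrightarrow> w x \<in> orthogonal_comp V"
    and W: "W = (\<lambda>x. f x *\<^sub>R unit_mean_curvature M x + w x)"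
    and p: "p \<in> M" and es: "orthonormal_frame M p es"
    and cal: "kahler_calibration (unit_mean_curvature M p # es) = 1"
  shows "jacobi_integrand kahler_calibration M W p es =
    (((\<Sum>k\<in>UNIV. (killing_deriv (Q k) f p)\<^sup>2) - 3 * (f p)\<^sup>2)
     + ((\<Sum>k\<in>UNIV. (norm (killing_deriv (Q k) w p))\<^sup>2) - 3 * (imul (w p) \<bullet> killing_deriv (Q 1) w p))) / r\<^sup>2"
proof -
  obtain x y z where xyz: "es = [x, y, z]" using es length_3 unfolding orthonormal_frame_def by blast
  define n where "n = (- 1 / r) *\<^sub>R (p - c)"
  have n: "unit_mean_curvature M p = n" by (simp add: n_def unit_mean_curvature_M[OF p])
  have T: "x \<in> tangent_space M p" "y \<in> tangent_space M p" "z \<in> tangent_space M p"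
    using es by (auto simp: orthonormal_frame_def xyz)
  then have inV: "x \<in> V" "y \<in> V" "z \<in> V" by (auto simp: tangent_space_M[OF p])
  have esT: "es ! i \<in> tangent_space M p" if "i < 3" for i
    using es that by (auto simp: orthonormal_frame_def subset_eq)
  have nV: "n \<in> V" and nn: "n \<bullet> n = 1"
    using p r_pos subspace_V inner_radius[OF p]
    by (auto simp: n_def mem_M power2_eq_square intro: subspace_mul subspace_neg)
  have pn: "p - c = (- r) *\<^sub>R n" using r_pos by (simp add: n_def)
  define df where "df i = tderiv M f p (es ! i)" for i
  define dw where "dw i = tderiv M w p (es ! i)" for i
  have wp: "w p \<in> orthogonal_comp V" by (rule perp[OF p])
  have dwp: "dw i \<in> orthogonal_comp V" if "i < 3" for i
    unfolding dw_def by (rule tderiv_in_subspace[OF w p esT[OF that] subspace_orthogonal_comp perp])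
  have perp0: "u \<bullet> v = 0" "v \<bullet> u = 0" if "u \<in> orthogonal_comp V" "v \<in> V" for u v
    using that by (auto simp: orthogonal_comp_def orthogonal_def inner_commute)
  have NC: "normal_connection M W p (es ! i) = df i *\<^sub>R n + dw i" if "i < 3" for i
    using normal_connection_twisted[OF f w perp W p esT[OF that]] by (simp add: n df_def dw_def)
  have Wp: "W p = f p *\<^sub>R n + w p" by (simp add: W n)
  have "(\<Sum>i<3. (norm (normal_connection M W p (es ! i)))\<^sup>2) = (\<Sum>i<3. (norm (df i))\<^sup>2 + (norm (dw i))\<^sup>2)"
  proof (intro sum.cong refl)
    fix i :: nat assume "i \<in> {..<3}"
    then have i: "i < 3" by simp
    show "(norm (normal_connection M W p (es ! i)))\<^sup>2 = (norm (df i))\<^sup>2 + (norm (dw i))\<^sup>2"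
      unfolding NC[OF i] power2_norm_eq_inner using perp0[OF dwp[OF i] nV] nn
      by (simp add: inner_add)
  qed
  also have "\<dots> = (\<Sum>k\<in>UNIV. (norm (killing_deriv (Q k) f p))\<^sup>2) / r\<^sup>2 + (\<Sum>k\<in>UNIV. (norm (killing_deriv (Q k) w p))\<^sup>2) / r\<^sup>2"
    unfolding sum.distrib df_def dw_def norm_differential_frame[OF f p es] norm_differential_frame[OF w p es] ..
  finally have term1: "(\<Sum>i<3. (norm (normal_connection M W p (es ! i)))\<^sup>2) =
      (\<Sum>k\<in>UNIV. (killing_deriv (Q k) f p)\<^sup>2) / r\<^sup>2 + (\<Sum>k\<in>UNIV. (norm (killing_deriv (Q k) w p))\<^sup>2) / r\<^sup>2"
    by simp
  have "(\<Sum>i<3. \<Sum>j<3. (second_ff M p (es ! i) (es ! j) \<bullet> W p)\<^sup>2) = (\<Sum>i<3::nat. \<Sum>j<3::nat. if j = i then (f p)\<^sup>2 / r\<^sup>2 else 0)"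
  proof (intro sum.cong refl)
    fix i j :: nat assume "i \<in> {..<3}" "j \<in> {..<3}"
    then have ij: "i < 3" "j < 3" by auto
    have "es ! i \<bullet> es ! j = (if i = j then 1 else 0)" using es ij by (auto simp: orthonormal_frame_def)
    moreover have "(p - c) \<bullet> W p = - r * f p"
      unfolding pn Wp using perp0[OF wp nV] nn by (simp add: inner_add_right)
    ultimately show "(second_ff M p (es ! i) (es ! j) \<bullet> W p)\<^sup>2 = (if j = i then (f p)\<^sup>2 / r\<^sup>2 else 0)"
      unfolding second_ff_M[OF p esT[OF ij(1)] esT[OF ij(2)]] using r_pos
      by (simp add: power2_eq_square)
  qed
  then have term2: "(\<Sum>i<3. \<Sum>j<3. (second_ff M p (es ! i) (es ! j) \<bullet> W p)\<^sup>2) = 3 * (f p)\<^sup>2 / r\<^sup>2"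
    by simp
  have cal': "kahler_calibration [n, x, y, z] = 1" using cal by (simp add: n xyz)
  note b = calibration_frame(2)[OF p es[unfolded xyz] n_def cal']
  have anti: "imul u \<bullet> v = - (imul v \<bullet> u)" for u v by (metis imul_inner inner_commute)
  have iw: "imul (w p) \<in> orthogonal_comp V" by (rule imul_perp[OF wp])
  have idw: "imul (dw i) \<in> orthogonal_comp V" if "i < 3" for i by (rule imul_perp[OF dwp[OF that]])
  have add: "imul (s *\<^sub>R u + v) = s *\<^sub>R imul u + imul v" for u v s
    by (simp add: linear_add[OF linear_imul] linear_cmul[OF linear_imul])
  have WN: "imul (W p) \<bullet> (df i *\<^sub>R n + dw i) = imul (w p) \<bullet> dw i" if "i < 3" for i
    unfolding Wp add using perp0[OF dwp[OF that] imul_in_V[OF nV]] perp0[OF iw nV]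
    by (simp add: inner_add imul_orthogonal)
  have We: "imul (W p) \<bullet> u = f p * (imul n \<bullet> u)" if "u \<in> V" for u
    unfolding Wp add using perp0[OF iw that] by (simp add: inner_add)
  have Ne: "imul (df i *\<^sub>R n + dw i) \<bullet> u = df i * (imul n \<bullet> u)" if "i < 3" "u \<in> V" for i u
    unfolding add using perp0[OF idw[OF that(1)] that(2)] by (simp add: inner_add)
  have eN: "imul u \<bullet> (df i *\<^sub>R n + dw i) = - (df i * (imul n \<bullet> u))" if "i < 3" "u \<in> V" for i u
    using Ne[OF that] anti by metis
  have t0: "kahler_calibration [W p, df 0 *\<^sub>R n + dw 0, y, z] = (imul n \<bullet> x) * (imul (w p) \<bullet> dw 0)"
    unfolding kahler_calibration_eq using WN[of 0] We inV Ne[of 0] b by (simp add: algebra_simps)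
  have t1: "kahler_calibration [W p, x, df 1 *\<^sub>R n + dw 1, z] = (imul n \<bullet> y) * (imul (w p) \<bullet> dw 1)"
    unfolding kahler_calibration_eq using WN[of 1] We inV Ne[of 1] eN[of 1] b anti[of x z] by (simp add: algebra_simps)
  have t2: "kahler_calibration [W p, x, y, df 2 *\<^sub>R n + dw 2] = (imul n \<bullet> z) * (imul (w p) \<bullet> dw 2)"
    unfolding kahler_calibration_eq using WN[of 2] We inV eN[of 2] b by (simp add: algebra_simps)
  have "(\<Sum>i<3. kahler_calibration (W p # es[i := normal_connection M W p (es ! i)])) =
      imul (w p) \<bullet> ((imul n \<bullet> x) *\<^sub>R dw 0 + (imul n \<bullet> y) *\<^sub>R dw 1 + (imul n \<bullet> z) *\<^sub>R dw 2)"
    unfolding sum_lessThan_3 using NC[of 0] NC[of 1] NC[of 2] t0 t1 t2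
    by (simp add: xyz inner_add_right)
  also have "(imul n \<bullet> x) *\<^sub>R dw 0 + (imul n \<bullet> y) *\<^sub>R dw 1 + (imul n \<bullet> z) *\<^sub>R dw 2 = tderiv M w p (imul n)"
  proof -
    have "imul n = (\<Sum>i<3. (imul n \<bullet> es ! i) *\<^sub>R es ! i)"
      using frame_expansion_tangent(1)[OF p es n_def imul_in_V[OF nV]] by (simp add: imul_orthogonal)
    then have "tderiv M w p (imul n) = (\<Sum>i<3. (imul n \<bullet> es ! i) *\<^sub>R dw i)"
      using tderiv_sum[OF w p subspace_tangent[OF p], of "{..<3}" "\<lambda>i. es ! i" "\<lambda>i. imul n \<bullet> es ! i"] esT
      by (simp add: dw_def)
    then show ?thesis unfolding sum_lessThan_3 by (simp add: xyz)
  qed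
  also have "tderiv M w p (imul n) = (- 1 / r) *\<^sub>R killing_deriv (Q 1) w p"
  proof -
    have "imul n = (- 1 / r) *\<^sub>R Q 1 (p - c)"
      unfolding n_def Q_1 by (rule linear_cmul[OF linear_imul])
    then show ?thesis
      using tderiv_sum[OF w p subspace_tangent[OF p], of "{1}" "\<lambda>k. Q k (p - c)" "\<lambda>_. - 1 / r"] Q_tangent[OF p]
      by (simp add: killing_deriv_def)
  qed
  finally have term3: "(\<Sum>i<3. kahler_calibration (W p # es[i := normal_connection M W p (es ! i)])) =
      - (imul (w p) \<bullet> killing_deriv (Q 1) w p) / r" by simp
  show ?thesis
    unfolding jacobi_integrand_def term1 term2 term3 norm_mean_curvature[OF p]
    using r_pos by (simp add: field_simps power2_eq_square)
qed

theorem Omega_stable_sphere: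
  assumes ori: "orientation M \<eta>" and cal: "calibrated_extended_tangent kahler_calibration M \<eta>"
  shows "Omega_stable kahler_calibration M \<eta>"
  unfolding Omega_stable_def
proof (intro conjI allI impI)
  fix W e
  assume We: "twisted_normal_field M W \<and> (\<forall>p\<in>M. direct_frame M \<eta> p (e p))"
  then have fr: "direct_frame M \<eta> p (e p)" if "p \<in> M" for p using that by blast
  obtain f w where f: "smooth_map M f" "(\<integral>p. f p \<partial>\<mu>) = 0" and w: "smooth_map M w"
    and nor': "\<forall>p\<in>M. w p \<in> normal_space M p \<and> w p \<bullet> unit_mean_curvature M p = 0"
    and W: "W = (\<lambda>p. f p *\<^sub>R unit_mean_curvature M p + w p)"
    using conjunct1[OF We] unfolding twisted_normal_field_def by (elim exE conjE) (rule that)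
  have nor: "w p \<in> normal_space M p" "w p \<bullet> unit_mean_curvature M p = 0" if "p \<in> M" for p
    using nor' that by auto
  have perp: "w p \<in> orthogonal_comp V" if p: "p \<in> M" for p
  proof -
    have "v \<bullet> w p = 0" if v: "v \<in> V" for v
    proof -
      have es: "orthonormal_frame M p (e p)" using fr[OF p] by (simp add: direct_frame_def)
      have "(e p ! i) \<bullet> w p = 0" if "i < 3" for i
        using nor(1)[OF p] es that
        by (auto simp: normal_space_def orthogonal_comp_def orthogonal_def orthonormal_frame_def subset_eq)
      moreover have "((- 1 / r) *\<^sub>R (p - c)) \<bullet> w p = 0"
        using nor(2)[OF p] by (simp add: unit_mean_curvature_M[OF p] inner_commute)
      ultimately show ?thesis
        using frame_expansion_tangent(2)[OF p es refl v, of "w p"] by simp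
    qed
    then show ?thesis by (simp add: orthogonal_comp_def orthogonal_def)
  qed
  let ?D = "\<lambda>k. killing_deriv (Q k)"
  note J = complex_structure_Q
  have cf: "continuous_on M f" and cw: "continuous_on M w"
    using f w by (auto intro: smooth_map_imp_continuous)
  have cDf: "continuous_on M (?D k f)" and cDw: "continuous_on M (?D k w)" for k
    using f w by (auto intro: continuous_on_killing_deriv J)
  have bi: "bounded_linear imul" using linear_imul linear_conv_bounded_linear by blast
  have ciw: "continuous_on M (\<lambda>p. imul (w p))" by (rule bounded_linear.continuous_on[OF bi cw])
  note int = continuous_on_M_integrable
  define A where "A p = (\<Sum>k\<in>UNIV. (?D k f p)\<^sup>2) - 3 * (f p)\<^sup>2" for p
  define B where "B p = (\<Sum>k\<in>UNIV. (norm (?D k w p))\<^sup>2) - 3 * (imul (w p) \<bullet> ?D 1 w p)" for p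
  have cA: "continuous_on M A" unfolding A_def[abs_def] by (intro continuous_intros cf cDf)
  have cB: "continuous_on M B" unfolding B_def[abs_def] by (intro continuous_intros ciw cDw)
  have "(\<integral>p. jacobi_integrand kahler_calibration M W p (e p) \<partial>\<mu>) = (\<integral>p. (A p + B p) / r\<^sup>2 \<partial>\<mu>)"
  proof (intro Bochner_Integration.integral_cong refl)
    fix p assume "p \<in> space \<mu>"
    then have p: "p \<in> M" by (simp add: space_\<mu>)
    have "kahler_calibration (unit_mean_curvature M p # e p) = 1"
      using cal fr p by (auto simp: calibrated_extended_tangent_def)
    then show "jacobi_integrand kahler_calibration M W p (e p) = (A p + B p) / r\<^sup>2"
      unfolding A_def B_def using fr[OF p]
      by (intro jacobi_integrand_twisted[OF f(1) w perp W p]) (auto simp: direct_frame_def)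
  qed
  also have "\<dots> = ((\<integral>p. A p \<partial>\<mu>) + (\<integral>p. B p \<partial>\<mu>)) / r\<^sup>2"
    by (simp add: Bochner_Integration.integral_add int cA cB)
  also have "\<dots> \<ge> 0"
  proof -
    have "(\<integral>p. A p \<partial>\<mu>) = (\<Sum>k\<in>UNIV. \<integral>p. (?D k f p)\<^sup>2 \<partial>\<mu>) - 3 * (\<integral>p. (f p)\<^sup>2 \<partial>\<mu>)"
      unfolding A_def
      by (simp add: Bochner_Integration.integral_diff Bochner_Integration.integral_sum int continuous_intros cf cDf)
    then have "0 \<le> (\<integral>p. A p \<partial>\<mu>)" using poincare_inequality[OF f] by simp
    moreover have "(\<integral>p. B p \<partial>\<mu>) = (\<Sum>k\<in>UNIV. \<integral>p. (norm (?D k w p))\<^sup>2 \<partial>\<mu>) - 3 * (\<integral>p. imul (w p) \<bullet> ?D 1 w p \<partial>\<mu>)"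
      unfolding B_def
      by (simp add: Bochner_Integration.integral_diff Bochner_Integration.integral_sum int continuous_intros ciw cDw)
    then have "0 \<le> (\<integral>p. B p \<partial>\<mu>)"
      using first_order_inequality[OF bi imul_orthogonal norm_imul imul_imul w] by simp
    ultimately show ?thesis by simp
  qed
  finally show "0 \<le> (\<integral>p. jacobi_integrand kahler_calibration M W p (e p) \<partial>\<mu>)" .
qed (auto simp: ori cal closed_submanifold3_M parallel_mean_curvature_M nonzero_mean_curvature_M)

end

theorem theorem1p2:
  fixes V M :: "(complex^3) set" and c :: "complex^3" and r :: real
  assumes "vec.subspace V" and "vec.dim V = 2"
    and "c \<in> V" and "r > 0"
    and "M = sphere c r \<inter> V"
  shows "closed_submanifold3 M \<and> parallel_mean_curvature M \<and>
    (\<exists>\<eta>. orientation M \<eta> \<and> calibrated_extended_tangent kahler_calibration M \<eta>) \<and>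
    (\<forall>\<eta>. orientation M \<eta> \<and> calibrated_extended_tangent kahler_calibration M \<eta> \<longrightarrow>
         Omega_stable kahler_calibration M \<eta>)"
proof -
  obtain Q where Q: "quaternionic_sphere V c r M Q" "Q 1 = imul"
    using quaternionic_sphere_complex_plane[OF assms] by blast
  interpret quaternionic_sphere V c r M Q by (rule Q(1))
  interpret complex_sphere V c r M Q by unfold_locales (rule Q(2))
  show ?thesis
    using closed_submanifold3_M parallel_mean_curvature_M orientation_calibrating_form
      calibrated_calibrating_form Omega_stable_sphere by blast
qed

end
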